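(* Let $d \geq 3$ be an integer and let $G$ be a graph with no $K_{d+1}$ subgraph. If $\operatorname{mad}(G) \leq d+\frac{1}{28}$, then $G$ is correspondence $d$-colorable. Furthermore, if $d \geq 351$ and $\operatorname{mad}(G) \leq d + \frac{1}{24}$, then $G$ is correspondence $d$-colorable.
   Context: Graphs are finite, with no loops or parallel edges. $\operatorname{mad}(G) = \max_{\emptyset\neq F\subseteq G} \frac{2|E(F)|}{|V(F)|}$ is the maximum average degree, the maximum being over nonempty subgraphs $F$ of $G$. A correspondence cover of $G$ is a pair $(H,L)$ where $H$ is a graph, $L: V(G)\to 2^{V(H)}$, each $L(v)$ is independent in $H$, the sets $L(v)$ partition $V(H)$, and for distinct $u,v\in V(G)$ the edges of $H$ between $L(u)$ and $L(v)$ form a (possibly empty) matching if $uv\in E(G)$, and there are no such edges if $uv\notin E(G)$. An $(H,L)$-coloring of $G$ is a function $\phi: V(G)\to V(H)$ with $\phi(v)\in L(v)$ for every $v$ whose image is independent in $H$. $G$ is correspondence $d$-colorable if it has an $(H,L)$-coloring for every correspondence cover $(H,L)$ with $|L(v)|\ge d$ for all $v \in V(G)$. *)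

theory Defs
  imports Complex_Main "HOL-Library.Disjoint_Sets" "Graph_Theory.Graph_Theory"
begin

text \<open>
  A finite simple graph is a \<^locale>\<open>pair_graph\<close>: a finite, loop-free, symmetric set of
  arcs without parallel arcs. Each undirected edge \<open>uv\<close> is present as the two arcs \<open>(u, v)\<close> and
  \<open>(v, u)\<close>; \<open>edges\<close> is the undirected edge set, so that each edge is counted once.
\<close>

definition edges :: "'a pair_pre_digraph \<Rightarrow> 'a set set" where
  "edges G = {{u, v} | u v. (u, v) \<in> parcs G}"

text \<open>
  The condition \<open>pair_graph F\<close> is needed because \<^const>\<open>subgraph\<close> alone also admits
  sub-digraphs whose arc set is not symmetric.
\<close>

definition simple_subgraph :: "'a pair_pre_digraph \<Rightarrow> 'a pair_pre_digraph \<Rightarrow> bool" where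
  "simple_subgraph F G \<longleftrightarrow> pair_graph F \<and> subgraph (with_proj F) (with_proj G)"

text \<open>
  For the graph without vertices the maximum below is over the empty set, so \<open>mad\<close> is
  an unspecified number there.
\<close>

definition mad :: "'a pair_pre_digraph \<Rightarrow> real" where
  "mad G = Max {2 * real (card (edges F)) / real (card (pverts F)) | F.
                  simple_subgraph F G \<and> pverts F \<noteq> {}}"

lemma finite_simple_subgraphs:
  assumes "pair_graph G"
  shows "finite {F. simple_subgraph F G}"
proof (rule finite_subset)
  interpret pair_graph G by fact
  show "{F. simple_subgraph F G} \<subseteq>
      (\<lambda>(V, A). \<lparr>pverts = V, parcs = A\<rparr>) ` (Pow (pverts G) \<times> Pow (parcs G))"
  proof
    fix F assume "F \<in> {F. simple_subgraph F G}"
    then have "pverts F \<in> Pow (pverts G)" "parcs F \<in> Pow (parcs G)"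
      by (auto simp: simple_subgraph_def subgraph_def)
    then show "F \<in> (\<lambda>(V, A). \<lparr>pverts = V, parcs = A\<rparr>) ` (Pow (pverts G) \<times> Pow (parcs G))"
      by (intro image_eqI[of _ _ "(pverts F, parcs F)"]) auto
  qed
  show "finite ((\<lambda>(V, A). \<lparr>pverts = V, parcs = A\<rparr>) ` (Pow (pverts G) \<times> Pow (parcs G)))"
    using pair_finite_verts pair_finite_arcs by simp
qed

definition independent_in :: "'b pair_pre_digraph \<Rightarrow> 'b set \<Rightarrow> bool" where
  "independent_in H S \<longleftrightarrow> S \<subseteq> pverts H \<and> (\<forall>x\<in>S. \<forall>y\<in>S. {x, y} \<notin> edges H)"

definition edges_between :: "'b pair_pre_digraph \<Rightarrow> 'b set \<Rightarrow> 'b set \<Rightarrow> 'b set set" where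
  "edges_between H A B = {e \<in> edges H. \<exists>x\<in>A. \<exists>y\<in>B. e = {x, y}}"

definition matching :: "'b set set \<Rightarrow> bool" where
  "matching M \<longleftrightarrow> (\<forall>e\<in>M. \<forall>f\<in>M. e \<noteq> f \<longrightarrow> e \<inter> f = {})"

definition correspondence_cover ::
  "'a pair_pre_digraph \<Rightarrow> 'b pair_pre_digraph \<Rightarrow> ('a \<Rightarrow> 'b set) \<Rightarrow> bool" where
  "correspondence_cover G H L \<longleftrightarrow>
     pair_graph H \<and>
     (\<forall>v\<in>pverts G. independent_in H (L v)) \<and>
     disjoint_family_on L (pverts G) \<and> (\<Union>v\<in>pverts G. L v) = pverts H \<and>
     (\<forall>u\<in>pverts G. \<forall>v\<in>pverts G. u \<noteq> v \<longrightarrow>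
        ({u, v} \<in> edges G \<longrightarrow> matching (edges_between H (L u) (L v))) \<and>
        ({u, v} \<notin> edges G \<longrightarrow> edges_between H (L u) (L v) = {}))"

definition cover_coloring ::
  "'a pair_pre_digraph \<Rightarrow> 'b pair_pre_digraph \<Rightarrow> ('a \<Rightarrow> 'b set) \<Rightarrow> ('a \<Rightarrow> 'b) \<Rightarrow> bool" where
  "cover_coloring G H L \<phi> \<longleftrightarrow>
     (\<forall>v\<in>pverts G. \<phi> v \<in> L v) \<and> independent_in H (\<phi> ` pverts G)"

text \<open>
  HOL cannot quantify over types inside a formula, so the type \<open>'b\<close> of the vertices of the cover
  graphs is a parameter. To say that \<open>G\<close> is correspondence \<open>d\<close>-colorable is to assert
  \<open>correspondence_colorable TYPE('b) d G\<close> for every type \<open>'b\<close>; a theorem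
  with \<open>'b\<close> as a free type variable says exactly this.
\<close>

definition correspondence_colorable ::
  "'b itself \<Rightarrow> nat \<Rightarrow> 'a pair_pre_digraph \<Rightarrow> bool" where
  "correspondence_colorable TYPE('b) d G \<longleftrightarrow>
     (\<forall>(H :: 'b pair_pre_digraph) L.
        correspondence_cover G H L \<and> (\<forall>v\<in>pverts G. card (L v) \<ge> d) \<longrightarrow>
        (\<exists>\<phi>. cover_coloring G H L \<phi>))"

end

theory Submission
  imports Defs
begin

text \<open>
  Suppose the theorem fails and take a vertex-minimal non-colourable induced subgraph, on \<open>V\<close>. Its
  vertices have degree at least \<open>d\<close>; call them low if the degree is exactly \<open>d\<close> and high otherwise,
  and let \<open>e\<close> be the sum of the excesses \<open>deg y - d\<close> over the high vertices. The density
  assumption says \<open>e \<le> |V| / 28\<close>, or \<open>e \<le> |V| / 24\<close>. There are at most \<open>e\<close> high vertices, and at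
  most \<open>(d + 1) e\<close> edges lead from low to high vertices. On the other hand, the blocks of the low
  subgraph are cliques and cycles by Gallai's theorem (\<open>gallai_low\<close>, \<open>nocut_cases\<close>), and since there
  is no \<open>K\<^sub>d\<^sub>+\<^sub>1\<close> this forces on average almost one edge from each low vertex to a high one
  (\<open>gallai_bound\<close>). For \<open>d \<le> 23\<close> the two counts already contradict each other.

  For \<open>d \<ge> 24\<close> they say something about the shape of the low subgraph: more than half of its vertices lie in
  pieces, that is, in classes of at least \<open>2d/3\<close> low vertices having the same clique as closed
  neighbourhood (\<open>card_outside_pieces\<close>, \<open>defect_ge_weight\<close>). Distinct pieces are not adjacent. If the
  vertices outside some pieces are coloured, each of these pieces can be finished independently,
  unless the lists that remain on it are perfectly matched to one another. Such a failure is
  very unlikely for a random colouring of the high vertices, and the proof counts colourings to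
  make this precise.

  Minimality excludes the pieces for which failure is not unlikely. A high vertex that is adjacent to
  some but not all vertices of a piece has at most one more neighbour in it than its excess
  (\<open>few_neighbours\<close>), and not all high neighbours of a piece can be adjacent to all of it unless one
  of them has large excess
  (\<open>rich_or_partial_neighbour\<close>; this is where \<open>K\<^sub>d\<^sub>+\<^sub>1\<close> is excluded a second time). A maximization
  then selects a set \<open>S\<close> of high vertices of small excess and a set \<open>A\<close> of pieces such that every
  vertex of \<open>S\<close> has at least ten times as many neighbours in \<open>A\<close> as its excess, and every piece
  of \<open>A\<close> has two partial neighbours in \<open>S\<close> (\<open>select\<close>).

  All other vertices are coloured first, by minimality. Then the colourings of subsets of \<open>S\<close> after
  which every piece can still be finished are counted: adding one vertex to the subset
  multiplies their number by at least 4 (\<open>good_extensions\<close>). The reason is that in a failing piece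
  the colours of two partial neighbours are determined, up to two choices, by the other colours
  (\<open>card_bad_pair\<close>), so failing colourings correspond to colourings of a subset with two
  fewer vertices, of which there are 16 times fewer. In particular there is a good colouring
  of all of \<open>S\<close>, and it extends to the pieces, a contradiction.
\<close>

section \<open>Connected vertex sets and blocks\<close>

locale sym_graph =
  fixes adj :: "'a \<Rightarrow> 'a \<Rightarrow> bool"
  assumes adj_sym: "adj u v \<Longrightarrow> adj v u"
    and adj_irrefl: "\<not> adj v v"
begin

definition nb :: "'a set \<Rightarrow> 'a \<Rightarrow> 'a set" where
  "nb X v = {u \<in> X. adj v u}"

definition dg :: "'a set \<Rightarrow> 'a \<Rightarrow> nat" where
  "dg X v = card (nb X v)"

definition separated :: "'a set \<Rightarrow> 'a set \<Rightarrow> bool" where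
  "separated A C \<longleftrightarrow> (\<forall>a\<in>A. \<forall>c\<in>C. \<not> adj a c)"

text \<open>
  Connectedness is stated by cuts instead of paths: all arguments below either cut a set in two or
  grow a subset along an edge leaving it.
\<close>

definition conn :: "'a set \<Rightarrow> bool" where
  "conn X \<longleftrightarrow> X \<noteq> {} \<and> (\<forall>A. A \<noteq> {} \<longrightarrow> A \<subset> X \<longrightarrow> \<not> separated A (X - A))"

text \<open>
  No vertex is a cut vertex, so a single vertex and a single edge count as blocks.
\<close>

definition nocut :: "'a set \<Rightarrow> bool" where
  "nocut X \<longleftrightarrow> conn X \<and> (\<forall>u\<in>X. X = {u} \<or> conn (X - {u}))"

definition clique :: "'a set \<Rightarrow> bool" where
  "clique X \<longleftrightarrow> (\<forall>u\<in>X. \<forall>v\<in>X. u \<noteq> v \<longrightarrow> adj u v)"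

lemma adj_commute: "adj u v \<longleftrightarrow> adj v u"
  using adj_sym by blast

lemma separated_sym: "separated A C \<Longrightarrow> separated C A"
  unfolding separated_def using adj_sym by blast

lemma finite_nb [simp]: "finite X \<Longrightarrow> finite (nb X v)"
  by (simp add: nb_def)

lemma dg_mono: "finite Y \<Longrightarrow> X \<subseteq> Y \<Longrightarrow> dg X v \<le> dg Y v"
  unfolding dg_def by (rule card_mono) (auto simp: nb_def)

lemma dg_union: "finite X \<Longrightarrow> finite Y \<Longrightarrow> X \<inter> Y = {} \<Longrightarrow> dg (X \<union> Y) v = dg X v + dg Y v"
  unfolding dg_def
  by (subst card_Un_disjoint[symmetric]) (auto simp: nb_def intro!: arg_cong[of _ _ card])

lemma dg_clique: "clique X \<Longrightarrow> v \<in> X \<Longrightarrow> finite X \<Longrightarrow> dg X v = card X - 1"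
proof -
  assume "clique X" "v \<in> X" "finite X"
  then have "nb X v = X - {v}"
    using adj_irrefl by (auto simp: nb_def clique_def)
  then show ?thesis using \<open>v \<in> X\<close> by (simp add: dg_def)
qed

lemma dg_eq_0: "finite X \<Longrightarrow> (\<And>u. u \<in> X \<Longrightarrow> \<not> adj v u) \<Longrightarrow> dg X v = 0"
  by (auto simp: dg_def nb_def)

lemma dg_pos: "finite X \<Longrightarrow> u \<in> X \<Longrightarrow> adj v u \<Longrightarrow> dg X v > 0"
  by (auto simp: dg_def nb_def card_gt_0_iff)

lemma sum_dg_commute:
  assumes "finite X" "finite Y"
  shows "(\<Sum>x\<in>X. dg Y x) = (\<Sum>y\<in>Y. dg X y)"
proof -
  have "(\<Sum>x\<in>X. dg Y x) = (\<Sum>x\<in>X. \<Sum>y\<in>Y. if adj x y then 1 else 0)"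
    using assms by (simp add: dg_def nb_def sum.If_cases Int_def)
  also have "\<dots> = (\<Sum>y\<in>Y. \<Sum>x\<in>X. if adj y x then 1 else 0)"
    by (subst sum.swap) (simp add: adj_commute)
  also have "\<dots> = (\<Sum>y\<in>Y. dg X y)"
    using assms by (simp add: dg_def nb_def sum.If_cases Int_def)
  finally show ?thesis .
qed

lemma connD: "conn X \<Longrightarrow> A \<noteq> {} \<Longrightarrow> A \<subset> X \<Longrightarrow> \<exists>a\<in>A. \<exists>b\<in>X - A. adj a b"
  by (auto simp: conn_def separated_def)

lemma conn_singleton [simp]: "conn {x}"
  by (auto simp: conn_def)

text \<open>
  In a bipartition of a vertex set one may always look at the side avoiding a given vertex.
\<close>

lemma connI_avoid:
  assumes "v \<in> X"
    and "\<And>P. P \<noteq> {} \<Longrightarrow> P \<subset> X \<Longrightarrow> v \<notin> P \<Longrightarrow> \<not> separated P (X - P)"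
  shows "conn X"
  unfolding conn_def
proof (intro conjI allI impI)
  show "X \<noteq> {}" using assms(1) by auto
next
  fix A assume A: "A \<noteq> {}" "A \<subset> X"
  show "\<not> separated A (X - A)"
  proof (cases "v \<in> A")
    case False then show ?thesis using assms(2) A by auto
  next
    case True
    have "X - (X - A) = A" using A by auto
    moreover have "\<not> separated (X - A) (X - (X - A))"
      using assms(2)[of "X - A"] A True by auto
    ultimately show ?thesis using separated_sym by metis
  qed
qed

lemma conn_insert:
  assumes "conn X" "u \<in> X" "adj v u"
  shows "conn (insert v X)"
proof (cases "v \<in> X")
  case True then show ?thesis using assms by (simp add: insert_absorb)
next
  case False
  show ?thesis
  proof (rule connI_avoid[of v])
    fix P assume P: "P \<noteq> {}" "P \<subset> insert v X" "v \<notin> P"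
    show "\<not> separated P (insert v X - P)"
    proof (cases "P = X")
      case True then show ?thesis using assms(2,3) False adj_sym by (auto simp: separated_def)
    next
      case False
      then have "P \<subset> X" using P by auto
      then show ?thesis using connD[OF assms(1) P(1)] by (auto simp: separated_def)
    qed
  qed simp
qed

lemma conn_clique: "clique X \<Longrightarrow> X \<noteq> {} \<Longrightarrow> conn X"
  by (auto simp: conn_def separated_def clique_def) (metis Diff_iff ex_in_conv psubset_imp_ex_mem psubset_eq subset_eq)

text \<open>
  An end block: cut at a vertex \<open>v\<close> so that the part \<open>A\<close> cut off is as small as possible.
  A cut vertex of \<open>A + v\<close> would cut off a smaller part.
\<close>

lemma end_block:
  assumes fin: "finite X" and X: "conn X" and u: "u \<in> X" "X \<noteq> {u}" "\<not> conn (X - {u})"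
  obtains v A where "v \<in> X" "A \<noteq> {}" "A \<subset> X - {v}" "separated A (X - {v} - A)"
    "nocut (insert v A)" "conn (X - A)"
proof -
  define S where "S = (\<lambda>(v, A). v \<in> X \<and> A \<noteq> {} \<and> A \<subset> X - {v} \<and> separated A (X - {v} - A))"
  have "\<exists>A. S (u, A)"
    using u unfolding conn_def S_def by auto
  then obtain p where p: "S p" "\<And>q. S q \<Longrightarrow> card (snd p) \<le> card (snd q)"
    using ex_has_least_nat[of S _ "\<lambda>q. card (snd q)"] by metis
  obtain v A where vA: "p = (v, A)" by (cases p)
  have S: "v \<in> X" "A \<noteq> {}" "A \<subset> X - {v}" "separated A (X - {v} - A)"
    using p(1) unfolding S_def vA by auto
  have finA: "finite A" using S fin by (meson finite_Diff finite_subset psubset_imp_subset)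
  have minimal: "\<not> (w \<in> X \<and> P \<noteq> {} \<and> P \<subset> X - {w} \<and> separated P (X - {w} - P))" if "P \<subset> A" for w P
  proof
    assume "w \<in> X \<and> P \<noteq> {} \<and> P \<subset> X - {w} \<and> separated P (X - {w} - P)"
    then have "S (w, P)" by (simp add: S_def)
    then have "card A \<le> card P" using p(2) vA by fastforce
    then show False using psubset_card_mono[OF finA that] by simp
  qed
  have c: "conn (insert v A)"
  proof (rule connI_avoid[of v])
    fix P assume P: "P \<noteq> {}" "P \<subset> insert v A" "v \<notin> P"
    have PX: "P \<subset> X" using P S by auto
    show "\<not> separated P (insert v A - P)"
      using connD[OF X P(1) PX] S(4) P unfolding separated_def by blast
  qed simp
  have "conn (insert v A - {w})" if w: "w \<in> insert v A" for w
  proof (cases "w = v")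
    case True
    have e: "insert v A - {w} = A" using True S by auto
    show ?thesis unfolding e conn_def
    proof (intro conjI allI impI)
      fix P assume P: "P \<noteq> {}" "P \<subset> A"
      show "\<not> separated P (A - P)"
      proof
        assume s: "separated P (A - P)"
        have "separated P (X - {v} - P)"
          using s S(4) P unfolding separated_def by blast
        then show False using minimal[OF P(2), of v] P S by blast
      qed
    qed (rule S)
  next
    case False
    then have wA: "w \<in> A" using w by auto
    show ?thesis
    proof (rule connI_avoid[of v])
      show "v \<in> insert v A - {w}" using False by auto
      fix P assume P: "P \<noteq> {}" "P \<subset> insert v A - {w}" "v \<notin> P"
      have PA: "P \<subset> A" using P wA by auto
      show "\<not> separated P (insert v A - {w} - P)"
      proof
        assume s: "separated P (insert v A - {w} - P)"
        have "separated P (X - {w} - P)"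
          using s S(4) P PA unfolding separated_def by blast
        moreover have "P \<subset> X - {w}" using PA P S by auto
        moreover have "w \<in> X" using wA S by auto
        ultimately show False using minimal[OF PA, of w] P by blast
      qed
    qed
  qed
  then have nc: "nocut (insert v A)" using c by (auto simp: nocut_def)
  have "conn (X - A)"
  proof (rule connI_avoid[of v])
    show "v \<in> X - A" using S by auto
    fix P assume P: "P \<noteq> {}" "P \<subset> X - A" "v \<notin> P"
    have "P \<subset> X" using P by auto
    moreover have "\<not> adj a b" if "a \<in> P" "b \<in> A" for a b
      using S(4) that P adj_sym unfolding separated_def by blast
    ultimately show "\<not> separated P (X - A - P)"
      using connD[OF X P(1)] unfolding separated_def by blast
  qed
  then show ?thesis using that S nc by blast
qed

text \<open>
  All that is used about the low vertices of a critical cover. It passes to subsets and already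
  implies that blocks are cliques or cycles, so that no structure of the lists has to be
  carried along.
\<close>

definition gallai :: "'a set \<Rightarrow> bool" where
  "gallai B \<longleftrightarrow> (\<forall>X u v. X \<subseteq> B \<longrightarrow> u \<in> X \<longrightarrow> v \<in> X \<longrightarrow> adj u v \<longrightarrow> conn (X - {v}) \<longrightarrow> dg X v \<le> dg X u)"

lemma gallaiD: "gallai B \<Longrightarrow> X \<subseteq> B \<Longrightarrow> u \<in> X \<Longrightarrow> v \<in> X \<Longrightarrow> adj u v \<Longrightarrow> conn (X - {v}) \<Longrightarrow> dg X v \<le> dg X u"
  by (auto simp: gallai_def)

lemma nocut_regular:
  assumes g: "gallai B" and X: "X \<subseteq> B" "nocut X" and uv: "u \<in> X" "v \<in> X"
  shows "dg X u = dg X v"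
proof -
  have conn: "conn X" using X by (simp add: nocut_def)
  have le: "dg X b \<le> dg X a" if "a \<in> X" "b \<in> X" "adj a b" for a b
  proof -
    have "X \<noteq> {b}" using that adj_irrefl by auto
    then have "conn (X - {b})" using X that by (auto simp: nocut_def)
    then show ?thesis using gallaiD[OF g X(1)] that by blast
  qed
  let ?A = "{w \<in> X. dg X w = dg X u}"
  show ?thesis
  proof (rule ccontr)
    assume "dg X u \<noteq> dg X v"
    then have "u \<in> ?A" "v \<notin> ?A" using uv by auto
    then have "?A \<noteq> {}" "?A \<subset> X" using uv by blast+
    from connD[OF conn this] obtain a b where "a \<in> ?A" "b \<in> X - ?A" "adj a b" by blast
    then show False using le[of a b] le[of b a] adj_sym by fastforce
  qed
qed

lemma clique_if_dg: "finite X \<Longrightarrow> (\<And>v. v \<in> X \<Longrightarrow> dg X v = card X - 1) \<Longrightarrow> clique X"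
proof -
  assume fin: "finite X" and d: "\<And>v. v \<in> X \<Longrightarrow> dg X v = card X - 1"
  show "clique X"
    unfolding clique_def
  proof (intro ballI impI)
    fix u v assume uv: "u \<in> X" "v \<in> X" "u \<noteq> v"
    have "nb X u \<subseteq> X - {u}" using adj_irrefl by (auto simp: nb_def)
    moreover have "card (nb X u) = card (X - {u})"
      using d[OF uv(1)] uv fin by (simp add: dg_def)
    ultimately have "nb X u = X - {u}" using fin by (intro card_subset_eq) auto
    then show "adj u v" using uv by (auto simp: nb_def)
  qed
qed

text \<open>
  Regularity of all sets without cut vertex forces such a set to be a clique or a cycle. If
  deleting \<open>x\<close> creates a cut vertex, an end block \<open>D\<close> of \<open>X - x\<close> is regular of degree one less, so
  \<open>x\<close> is adjacent to all of \<open>D\<close> except possibly its cut vertex; now \<open>D + x\<close> is regular of the full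
  degree and uses up all neighbours of \<open>x\<close>, although \<open>x\<close> needs a neighbour on the other side of the
  cut.
\<close>

lemma nocut_clique:
  assumes g: "gallai B" and X: "X \<subseteq> B" "nocut X" "finite X" and x: "x \<in> X" "dg X x \<ge> 3"
  shows "clique X"
proof -
  have conn: "conn X" using X by (simp add: nocut_def)
  define r where "r = dg X x"
  have reg: "dg X v = r" if "v \<in> X" for v
    using nocut_regular[OF g X(1,2) that x(1)] by (simp add: r_def)
  have r3: "r \<ge> 3" using x by (simp add: r_def)
  have Xx: "X \<noteq> {x}"
  proof
    assume "X = {x}"
    then have "nb X x = {}" using adj_irrefl by (auto simp: nb_def)
    then show False using x by (simp add: dg_def)
  qed
  then have cx: "conn (X - {x})" using X x by (auto simp: nocut_def)
  have dgx: "dg (X - {x}) v = r - (if adj v x then 1 else 0)" if "v \<in> X" for v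
  proof -
    have "nb (X - {x}) v = nb X v - {x}" by (auto simp: nb_def)
    then have "dg (X - {x}) v = card (nb X v) - (if x \<in> nb X v then 1 else 0)"
      using X(3) by (simp add: dg_def)
    then show ?thesis using reg[OF that] x by (simp add: dg_def nb_def)
  qed
  show ?thesis
  proof (cases "nocut (X - {x})")
    case True
    have "nb X x \<noteq> {}" using x by (auto simp: dg_def)
    then obtain y where y: "y \<in> X" "adj x y" by (auto simp: nb_def)
    have yx: "y \<in> X - {x}" using y adj_irrefl by auto
    have all: "adj x w" if w: "w \<in> X - {x}" for w
    proof (rule ccontr)
      assume n: "\<not> adj x w"
      have "dg (X - {x}) w = dg (X - {x}) y"
        using nocut_regular[OF g _ True w yx] X by auto
      then show False using dgx[of w] dgx[of y] n y w r3 adj_commute[of _ x] by auto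
    qed
    have "nb X x = X - {x}" using all adj_irrefl by (auto simp: nb_def)
    then have "r = card X - 1" using x by (simp add: r_def dg_def)
    then show ?thesis using clique_if_dg[OF X(3)] reg by auto
  next
    case False
    then obtain w where w: "w \<in> X - {x}" "X - {x} \<noteq> {w}" "\<not> conn (X - {x} - {w})"
      using cx unfolding nocut_def by blast
    obtain z C where z: "z \<in> X - {x}" "C \<noteq> {}" "C \<subset> X - {x} - {z}"
      "separated C (X - {x} - {z} - C)" "nocut (insert z C)" "conn (X - {x} - C)"
      using end_block[OF _ cx w] X(3) by (metis finite_Diff)
    define D where "D = insert z C"
    have DX: "D \<subseteq> X - {x}" using z by (auto simp: D_def)
    have finD: "finite D" using DX X(3) finite_subset by blast
    have cz: "conn (X - {z})"
      using X z by (auto simp: nocut_def)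
    have dgC: "dg D c = dg (X - {x}) c" if "c \<in> C" for c
    proof -
      have "nb (X - {x}) c \<subseteq> D" using that z unfolding nb_def separated_def D_def by blast
      then have "nb D c = nb (X - {x}) c" using DX by (auto simp: nb_def)
      then show ?thesis by (simp add: dg_def)
    qed
    have "\<exists>c\<in>C. adj x c"
    proof -
      have "C \<subset> X - {z}" using z by auto
      from connD[OF cz z(2) this] obtain c b where cb: "c \<in> C" "b \<in> X - {z} - C" "adj c b" by blast
      then have "b = x" using z(4) unfolding separated_def by blast
      then show ?thesis using cb adj_sym by blast
    qed
    then obtain c where c: "c \<in> C" "adj x c" by blast
    have cX: "c \<in> X" using c z by auto
    have dDc: "dg D c = r - 1" using dgC[OF c(1)] dgx[OF cX] c adj_commute by auto
    have Creg: "dg D c' = r - 1" if "c' \<in> C" for c'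
      using nocut_regular[OF g, of D c' c] z(5) DX X(1) that c dDc by (auto simp: D_def)
    have xC: "adj x c'" if "c' \<in> C" for c'
    proof (rule ccontr)
      assume "\<not> adj x c'"
      moreover have "c' \<in> X" using that z by auto
      ultimately show False
        using Creg[OF that] dgC[OF that] dgx[of c'] adj_commute[of c' x] r3 by auto
    qed
    have "card C \<ge> 2"
    proof -
      have "nb D c \<subseteq> insert z (C - {c})" using adj_irrefl by (auto simp: nb_def D_def)
      then have "dg D c \<le> card (insert z (C - {c}))"
        unfolding dg_def using finD by (intro card_mono) (auto simp: D_def)
      also have "\<dots> \<le> Suc (card (C - {c}))" by (rule card_insert_le_m1) auto
      also have "card (C - {c}) = card C - 1" using c finD by (simp add: D_def)
      finally show ?thesis using dDc r3 by linarith
    qed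
    have C2: "\<exists>c'\<in>C. c' \<noteq> v" for v
    proof (rule ccontr)
      assume "\<not> ?thesis"
      then have "card C \<le> card {v}" by (intro card_mono) auto
      then show False using \<open>card C \<ge> 2\<close> by simp
    qed
    let ?E = "insert x D"
    have "conn (?E - {v})" if v: "v \<in> ?E" for v
    proof (cases "v = x")
      case True
      have "?E - {v} = D" using True DX by auto
      then show ?thesis using z(5) by (simp add: D_def nocut_def)
    next
      case False
      obtain c' where c': "c' \<in> C" "c' \<noteq> v" using C2 by blast
      have "D \<noteq> {v}" using c' by (auto simp: D_def)
      then have "conn (D - {v})" using z(5) v False by (auto simp: D_def nocut_def)
      then have "conn (insert x (D - {v}))"
        by (rule conn_insert[of _ c']) (use c' xC in \<open>auto simp: D_def\<close>)
      moreover have "insert x (D - {v}) = ?E - {v}" using False by auto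
      ultimately show ?thesis by simp
    qed
    moreover have "conn ?E"
      using z(5) xC[OF c(1)] c by (intro conn_insert[of D c]) (auto simp: D_def nocut_def)
    ultimately have "nocut ?E" by (auto simp: nocut_def)
    then have "dg ?E x = dg ?E c"
      using nocut_regular[OF g, of ?E x c] DX X(1) x(1) c by (auto simp: D_def)
    also have "dg ?E c = r"
    proof -
      have "nb ?E c = insert x (nb D c)" using c adj_sym by (auto simp: nb_def)
      moreover have "x \<notin> nb D c" using DX by (auto simp: nb_def)
      ultimately show ?thesis using dDc finD r3 by (simp add: dg_def)
    qed
    finally have "card (nb ?E x) = card (nb X x)" by (simp add: dg_def[symmetric] r_def)
    moreover have "nb ?E x \<subseteq> nb X x" using DX x by (auto simp: nb_def)
    ultimately have nbE: "nb ?E x = nb X x" using X(3) by (intro card_subset_eq) auto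
    let ?R = "X - {x} - {z} - C"
    have "?R \<noteq> {}" "?R \<subset> X - {z}" using z x by auto
    from connD[OF cz this] obtain a b where ab: "a \<in> ?R" "b \<in> X - {z} - ?R" "adj a b" by blast
    have "b \<in> C \<or> b = x" using ab by auto
    moreover have "b \<notin> C" using ab z(4) adj_sym unfolding separated_def by blast
    ultimately have "a \<in> nb X x" using ab adj_sym by (auto simp: nb_def)
    then have "a \<in> nb ?E x" using nbE by simp
    then have "a \<in> D" using ab by (auto simp: nb_def)
    then show ?thesis using ab by (auto simp: D_def)
  qed
qed

lemma nocut_cases:
  assumes g: "gallai B" and X: "X \<subseteq> B" "nocut X" "finite X"
  shows "clique X \<or> (\<forall>v\<in>X. dg X v = 2)"
proof -
  have conn: "conn X" using X by (simp add: nocut_def)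
  then obtain x where x: "x \<in> X" by (auto simp: conn_def)
  have reg: "dg X v = dg X x" if "v \<in> X" for v
    using nocut_regular[OF g X(1,2) that x] .
  consider "dg X x = 0" | "dg X x = 1" | "dg X x = 2" | "dg X x \<ge> 3" by linarith
  then show ?thesis
  proof cases
    case 1
    have "X = {x}"
    proof (rule ccontr)
      assume "X \<noteq> {x}"
      then have "{x} \<subset> X" using x by auto
      from connD[OF conn _ this] obtain b where "b \<in> X" "adj x b" by auto
      then show False using dg_pos[OF X(3), of b x] 1 by simp
    qed
    then show ?thesis by (auto simp: clique_def)
  next
    case 2
    then obtain y where y: "nb X x = {y}" by (auto simp: dg_def card_1_singleton_iff)
    then have yX: "y \<in> X" "adj x y" by (auto simp: nb_def)
    then have "dg X y = 1" using reg 2 by simp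
    then obtain x' where "nb X y = {x'}" by (auto simp: dg_def card_1_singleton_iff)
    moreover have "x \<in> nb X y" using x yX adj_sym by (auto simp: nb_def)
    ultimately have yx: "nb X y = {x}" by auto
    have "X = {x, y}"
    proof (rule ccontr)
      assume "X \<noteq> {x, y}"
      then have "{x, y} \<subset> X" using x yX by auto
      from connD[OF conn _ this] obtain a b where "a \<in> {x, y}" "b \<in> X - {x, y}" "adj a b" by auto
      then have "b \<in> nb X x \<or> b \<in> nb X y" by (auto simp: nb_def)
      then show False using y yx \<open>b \<in> X - {x, y}\<close> by auto
    qed
    then show ?thesis using yX adj_sym by (auto simp: clique_def)
  next
    case 3 then show ?thesis using reg by auto
  next
    case 4 then show ?thesis using nocut_clique[OF g X x] by simp
  qed
qed

end

section \<open>Edges leaving the low vertices\<close>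

context sym_graph begin

lemma conn_remove_leaf:
  assumes c: "conn X" and v: "v \<in> X" "nb X v = {t}"
  shows "conn (X - {v})"
proof (rule connI_avoid[of t])
  show tX: "t \<in> X - {v}" using v adj_irrefl by (auto simp: nb_def)
  fix P assume P: "P \<noteq> {}" "P \<subset> X - {v}" "t \<notin> P"
  have "P \<subset> X" using P by auto
  from connD[OF c P(1) this] obtain a b where ab: "a \<in> P" "b \<in> X - P" "adj a b" by blast
  have "b \<noteq> v"
  proof
    assume "b = v"
    then have "a \<in> nb X v" using ab P adj_sym by (auto simp: nb_def)
    then show False using v ab P by auto
  qed
  then show "\<not> separated P (X - {v} - P)" using ab by (auto simp: separated_def)
qed

text \<open>
  If \<open>X\<close> is the set of low vertices, this is the number of edges between low and high vertices.
\<close>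

definition defect :: "nat \<Rightarrow> 'a set \<Rightarrow> real" where
  "defect d X = (\<Sum>x\<in>X. real d - real (dg X x))"

lemma defect_split:
  assumes "finite X" "R \<subseteq> X" "t \<in> X - R" "separated R (X - {t} - R)"
  shows "defect d X = defect d (X - R) + (\<Sum>r\<in>R. real d - real (dg (insert t R) r)) - real (dg R t)"
proof -
  have fR: "finite R" using assms finite_subset by blast
  have XR: "X = (X - R) \<union> R" using assms by auto
  have 1: "dg X r = dg (insert t R) r" if "r \<in> R" for r
  proof -
    have "nb X r = nb (insert t R) r"
      using that assms unfolding nb_def separated_def by blast
    then show ?thesis by (simp add: dg_def)
  qed
  have 2: "dg X x = dg (X - R) x + dg R x" for x
    using dg_union[of "X - R" R x] fR assms XR by auto
  have 3: "(\<Sum>x\<in>X - R. real (dg R x)) = real (dg R t)"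
  proof -
    have "(\<Sum>x\<in>X - R. real (dg R x)) = (\<Sum>x\<in>{t}. real (dg R x))"
    proof (rule sum.mono_neutral_right)
      show "\<forall>i\<in>X - R - {t}. real (dg R i) = 0"
      proof
        fix x assume "x \<in> X - R - {t}"
        then have "dg R x = 0"
          using assms(4) adj_commute fR unfolding separated_def by (intro dg_eq_0) auto
        then show "real (dg R x) = 0" by simp
      qed
    qed (use assms in auto)
    then show ?thesis by simp
  qed
  have "defect d X = (\<Sum>x\<in>X - R. real d - real (dg X x)) + (\<Sum>x\<in>R. real d - real (dg X x))"
    unfolding defect_def using assms(1,2) by (subst sum.subset_diff[of R X]) auto
  also have "(\<Sum>x\<in>X - R. real d - real (dg X x)) = defect d (X - R) - (\<Sum>x\<in>X - R. real (dg R x))"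
    unfolding defect_def sum_subtractf[symmetric] by (intro sum.cong) (auto simp: 2)
  also have "(\<Sum>x\<in>R. real d - real (dg X x)) = (\<Sum>r\<in>R. real d - real (dg (insert t R) r))"
    by (intro sum.cong) (auto simp: 1)
  finally show ?thesis using 3 by simp
qed

lemma defect_separated:
  assumes "finite X" "A \<subseteq> X" "separated A (X - A)"
  shows "defect d X = defect d A + defect d (X - A)"
proof -
  have "nb X a = nb A a" if "a \<in> A" for a
    using that assms unfolding nb_def separated_def by blast
  moreover have "nb X a = nb (X - A) a" if "a \<in> X - A" for a
    using that assms adj_sym unfolding nb_def separated_def by blast
  ultimately show ?thesis
    unfolding defect_def dg_def using assms(1,2) by (subst sum.subset_diff[of A X]) auto
qed

end

locale low_graph = sym_graph adj for adj :: "'a \<Rightarrow> 'a \<Rightarrow> bool" +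
  fixes B :: "'a set" and d :: nat
  assumes d3: "3 \<le> d"
    and finB: "finite B"
    and gallaiB: "gallai B"
    and dg_le: "x \<in> B \<Longrightarrow> dg B x \<le> d"
    and no_clique: "K \<subseteq> B \<Longrightarrow> clique K \<Longrightarrow> card K \<noteq> d + 1"
begin

lemma clique_card_le:
  assumes "K \<subseteq> B" "clique K"
  shows "card K \<le> d"
proof (rule ccontr)
  assume "\<not> card K \<le> d"
  then obtain K' where "K' \<subseteq> K" "card K' = d + 1"
    by (metis Suc_eq_plus1 not_less_eq_eq obtain_subset_with_card_n)
  moreover have "clique K'" using assms \<open>K' \<subseteq> K\<close> by (auto simp: clique_def)
  ultimately show False using no_clique assms by auto
qed

text \<open>
  An end block is cut off at its cut vertex \<open>t\<close>, and its contribution to the defect is computed. The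
  contribution would be 0 for a clique of size \<open>d\<close>. In this case the cut vertex of the block
  has only one neighbour \<open>t\<close> outside it; the cut vertex, called \<open>v\<close>, is then cut off as well.
\<close>

lemma peel:
  assumes XB: "X \<subseteq> B" and X: "conn X"
  obtains
    (clique) "clique X" "card X \<le> d"
  | (cycle) "\<forall>v\<in>X. dg X v = 2"
  | (clique_block) R t where "R \<noteq> {}" "R \<subseteq> X" "t \<in> X - R" "X - R \<noteq> {t}" "separated R (X - {t} - R)" "conn (X - R)"
      "clique (insert t R)" "card R \<le> d - 2"
      "defect d X = defect d (X - R) + real (card R) * (real d - 1 - real (card R))"
  | (cycle_block) R t where "R \<subseteq> X" "t \<in> X - R" "X - R \<noteq> {t}" "separated R (X - {t} - R)" "conn (X - R)"
      "3 \<le> card R" "defect d X = defect d (X - R) + real (card R) * (real d - 2) - 2"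
  | (pendant) R t v where "R \<subseteq> X" "t \<in> X - R" "separated R (X - {t} - R)" "conn (X - R)"
      "clique R" "card R = d" "v \<in> R" "\<forall>r\<in>R. adj r t \<longleftrightarrow> r = v"
      "defect d X = defect d (X - R) + (real d - 2)"
proof (cases "nocut X")
  case True
  have fX: "finite X" using XB finB finite_subset by blast
  show thesis using nocut_cases[OF gallaiB XB True fX] clique_card_le[OF XB] that(1,2) by blast
next
  case False
  have fX: "finite X" using XB finB finite_subset by blast
  obtain u where u: "u \<in> X" "X \<noteq> {u}" "\<not> conn (X - {u})" using False X by (auto simp: nocut_def)
  obtain t R where tR: "t \<in> X" "R \<noteq> {}" "R \<subset> X - {t}" "separated R (X - {t} - R)"
    "nocut (insert t R)" "conn (X - R)"
    using end_block[OF fX X u] by blast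
  have R: "R \<subseteq> X" "t \<in> X - R" "X - R \<noteq> {t}" using tR by auto
  have fR: "finite R" using R fX finite_subset by blast
  have DB: "insert t R \<subseteq> B" using R XB by auto
  have ds: "defect d X = defect d (X - R) + (\<Sum>r\<in>R. real d - real (dg (insert t R) r)) - real (dg R t)"
    by (rule defect_split) (use R tR fX in auto)
  have dgt: "dg (insert t R) t = dg R t"
    using adj_irrefl unfolding dg_def nb_def by (intro arg_cong[of _ _ card]) auto
  from nocut_cases[OF gallaiB DB tR(5)] fR have "clique (insert t R) \<or> (\<forall>v\<in>insert t R. dg (insert t R) v = 2)"
    by auto
  then consider "\<not> clique (insert t R)" "\<forall>v\<in>insert t R. dg (insert t R) v = 2" | "clique (insert t R)"
    by blast
  then show thesis
  proof cases
    case 1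
    note cyc = 1(2)
    then have "dg R t = 2" using dgt by auto
    moreover have "dg R t \<le> card R" unfolding dg_def nb_def using fR by (intro card_mono) auto
    moreover have "card R \<noteq> 2"
    proof
      assume "card R = 2"
      then have "card (insert t R) - 1 = 2" using R fR by simp
      then have "clique (insert t R)" using cyc fR by (intro clique_if_dg) (simp, metis)
      then show False using 1 by simp
    qed
    ultimately have c3: "3 \<le> card R" and t2: "dg R t = 2" by simp_all
    have "(\<Sum>r\<in>R. real d - real (dg (insert t R) r)) = real (card R) * (real d - 2)"
      using cyc by simp
    then have "defect d X = defect d (X - R) + real (card R) * (real d - 2) - 2"
      using ds t2 by simp
    then show thesis by (rule that(4)[OF R tR(4,6) c3])
  next
    case 2
    note cl = 2
    have cD: "card (insert t R) = card R + 1" using R fR by auto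
    then have Rd: "card R \<le> d - 1" using clique_card_le[OF DB cl] by auto
    have dgD: "dg (insert t R) r = card R" if "r \<in> insert t R" for r
      using dg_clique[OF cl that] fR cD by simp
    have ds': "defect d X = defect d (X - R) + real (card R) * (real d - 1 - real (card R))"
      using ds dgD dgt by (simp add: algebra_simps)
    show thesis
    proof (cases "card R \<le> d - 2")
      case True then show thesis using that(3)[of R t] R tR cl ds' by blast
    next
      case False
      then have cR: "card R = d - 1" using Rd by simp
      define Y where "Y = X - R"
      have Y: "conn Y" "t \<in> Y" "Y \<noteq> {t}" using tR R by (auto simp: Y_def)
      then have "{t} \<subset> Y" by auto
      from connD[OF Y(1) _ this] obtain s where s: "s \<in> Y" "adj t s" by auto
      have "dg X t \<le> d"
        using dg_mono[OF finB XB, of t] dg_le[of t] R XB by force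
      moreover have "dg X t = dg Y t + dg R t"
      proof -
        have "Y \<union> R = X" "Y \<inter> R = {}" using R by (auto simp: Y_def)
        moreover have "finite Y" using fX by (simp add: Y_def)
        ultimately show ?thesis using dg_union[of Y R t] fR by simp
      qed
      moreover have "dg Y t > 0" using s fX by (auto simp: Y_def intro: dg_pos)
      moreover have "dg R t = d - 1" using dgD[of t] dgt cR by simp
      ultimately have "dg Y t = 1" using d3 by linarith
      then obtain s' where "nb Y t = {s'}" by (auto simp: dg_def card_1_singleton_iff)
      moreover have "s \<in> nb Y t" using s by (simp add: nb_def)
      ultimately have nbY: "nb Y t = {s}" by simp
      let ?R = "insert t R"
      have e: "X - ?R = Y - {t}" by (auto simp: Y_def)
      have sep: "separated ?R (X - {s} - ?R)"
        using tR(4) nbY unfolding separated_def nb_def Y_def by blast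
      have st: "s \<in> X - ?R" using s adj_irrefl by (auto simp: Y_def)
      have adjs: "\<forall>r\<in>?R. adj r s \<longleftrightarrow> r = t"
        using s tR(4) st unfolding separated_def by blast
      have cnn: "conn (X - ?R)" unfolding e by (rule conn_remove_leaf[OF Y(1,2) nbY])
      have ds2: "defect d X = defect d (X - ?R) + (\<Sum>r\<in>?R. real d - real (dg (insert s ?R) r)) - real (dg ?R s)"
        by (rule defect_split) (use R st sep fX in auto)
      have "nb ?R s = {t}" using adjs adj_sym by (auto simp: nb_def)
      then have d1: "dg ?R s = 1" by (simp add: dg_def)
      have d2: "dg (insert s ?R) r = d - 1 + (if r = t then 1 else 0)" if "r \<in> ?R" for r
      proof -
        have "dg (?R \<union> {s}) r = dg ?R r + dg {s} r"
          by (rule dg_union) (use fR st in auto)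
        moreover have "dg ?R r = d - 1" using dgD[OF that] cR by simp
        moreover have "dg {s} r = (if r = t then 1 else 0)"
        proof -
          have "nb {s} r = (if r = t then {s} else {})" using adjs that by (auto simp: nb_def)
          then show ?thesis by (simp add: dg_def)
        qed
        ultimately show ?thesis by simp
      qed
      have "(\<Sum>r\<in>?R. real d - real (dg (insert s ?R) r)) = (\<Sum>r\<in>?R. 1 - (if r = t then 1 else 0))"
      proof (rule sum.cong)
        fix r assume "r \<in> ?R"
        then show "real d - real (dg (insert s ?R) r) = 1 - (if r = t then 1 else 0)"
          using d2[of r] d3 by (simp add: of_nat_diff)
      qed simp
      also have "\<dots> = real (card ?R) - 1"
        using fR by (subst sum_subtractf) (simp del: card_insert_disjoint)
      also have "\<dots> = real d - 1"
        using cD cR d3 by simp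
      finally have "defect d X = defect d (X - ?R) + (real d - 2)" using ds2 d1 by simp
      moreover have "card ?R = d" using cD cR d3 by simp
      moreover have "?R \<subseteq> X" using R by auto
      ultimately show thesis
        using that(5)[of ?R s t] st sep cnn cl adjs by blast
    qed
  qed
qed

lemma defect_clique: "clique X \<Longrightarrow> finite X \<Longrightarrow> X \<noteq> {} \<Longrightarrow> defect d X = real (card X) * (real d + 1 - real (card X))"
proof -
  assume X: "clique X" "finite X" "X \<noteq> {}"
  then have "card X \<ge> 1" by (simp add: Suc_leI card_gt_0_iff)
  then show ?thesis
    using X by (simp add: defect_def dg_clique of_nat_diff algebra_simps)
qed

text \<open>
  Every peeling step contributes at least \<open>(d - 2) / d\<close> to the defect for each removed vertex, with
  equality for a pendant clique of size \<open>d\<close>.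
\<close>

lemma gallai_bound:
  assumes "X \<subseteq> B"
  shows "(real d - 2) * real (card X) \<le> real d * defect d X"
  using assms
proof (induction "card X" arbitrary: X rule: less_induct)
  case less
  have fX: "finite X" using less.prems finB finite_subset by blast
  have d: "real d \<ge> 3" using d3 by simp
  consider "X = {}" | "X \<noteq> {}" "\<not> conn X" | "conn X" by blast
  then show ?case
  proof cases
    case 1 then show ?thesis by (simp add: defect_def)
  next
    case 2
    then obtain A where A: "A \<noteq> {}" "A \<subset> X" "separated A (X - A)" by (auto simp: conn_def)
    have "card A < card X" "card (X - A) < card X"
      using A fX by (auto intro!: psubset_card_mono)
    then have IH: "(real d - 2) * real (card A) \<le> real d * defect d A"
      "(real d - 2) * real (card (X - A)) \<le> real d * defect d (X - A)"
      using less.hyps[of A] less.hyps[of "X - A"] less.prems A by auto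
    have "real (card X) = real (card A) + real (card (X - A))"
      using A fX by (metis card_Diff_subset card_mono finite_subset le_add_diff_inverse of_nat_add psubset_imp_subset)
    then show ?thesis
      using IH defect_separated[OF fX _ A(3), of d] A by (simp add: algebra_simps)
  next
    case 3
    have step: ?thesis
      if R: "R \<noteq> {}" "R \<subseteq> X" and g: "defect d X = defect d (X - R) + g"
        and le: "(real d - 2) * real (card R) \<le> real d * g" for R g
    proof -
      have "card (X - R) < card X" using R fX by (intro psubset_card_mono) auto
      then have "(real d - 2) * real (card (X - R)) \<le> real d * defect d (X - R)"
        using less.hyps[of "X - R"] less.prems by auto
      moreover have "real (card X) = real (card (X - R)) + real (card R)"
        using R fX by (metis card_Diff_subset card_mono finite_subset le_add_diff_inverse2 of_nat_add)
      ultimately show ?thesis using g le by (simp add: distrib_left)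
    qed
    from less.prems 3 show ?thesis
    proof (cases rule: peel)
      case clique
      have "real (card X) \<le> real d" using clique by simp
      then have "real (card X) * (real d - 2) \<le> real (card X) * (real d * (real d + 1 - real (card X)))"
        using d mult_left_mono[of 1 "real d + 1 - real (card X)" "real d"] \<open>real (card X) \<le> real d\<close>
        by (intro mult_left_mono) linarith+
      moreover have "X \<noteq> {}" using 3 by (simp add: conn_def)
      ultimately show ?thesis using defect_clique[OF clique(1) fX] by (simp add: mult_ac)
    next
      case cycle
      have "defect d X = real (card X) * (real d - 2)" using cycle by (simp add: defect_def)
      moreover have "0 \<le> real (card X) * (real d - 2)" using d by simp
      ultimately show ?thesis
        using d mult_right_mono[of 1 "real d" "defect d X"] by (simp add: mult.commute)
    next
      case (clique_block R t)
      have m: "real (card R) \<le> real d - 2" using clique_block(8) d3 by (simp add: of_nat_diff)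
      have "real (card R) * (real d - 2) \<le> real (card R) * (real d * (real d - 1 - real (card R)))"
        using d m mult_left_mono[of 1 "real d - 1 - real (card R)" "real d"]
        by (intro mult_left_mono) linarith+
      then show ?thesis using step[OF clique_block(1,2,9)] by (simp add: mult_ac)
    next
      case (cycle_block R t)
      have ne: "R \<noteq> {}" using cycle_block(6) by auto
      have "(real d - 1) * (real d - 2) * 3 \<le> (real d - 1) * (real d - 2) * real (card R)"
        using d cycle_block(6) by (intro mult_left_mono) auto
      moreover have "0 \<le> (3 * real d - 2) * (real d - 3)" using d by simp
      ultimately have "(real d - 2) * real (card R) \<le> real d * (real (card R) * (real d - 2) - 2)"
        by (simp add: algebra_simps)
      moreover have "defect d X = defect d (X - R) + (real (card R) * (real d - 2) - 2)"
        using cycle_block(7) by simp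
      ultimately show ?thesis using step[OF ne cycle_block(1)] by blast
    next
      case (pendant R t v)
      have ne: "R \<noteq> {}" using pendant by auto
      show ?thesis
        using step[OF ne pendant(1,9)] pendant(6) by (simp add: mult.commute)
    qed
  qed
qed

end

section \<open>Attachment vertices of large cliques\<close>

context sym_graph begin

definition cl :: "'a set \<Rightarrow> 'a \<Rightarrow> 'a set" where
  "cl X x = insert x (nb X x)"

definition big :: "nat \<Rightarrow> 'a set \<Rightarrow> bool" where
  "big d Q \<longleftrightarrow> clique Q \<and> 5 * d \<le> 6 * card Q"

text \<open>
  The weights are chosen to bound the number of vertices outside large pieces. Such a vertex is
  outside the large cliques (weight 1), or it attaches a large clique to the rest (weight 5), or
  it lies in a large clique with so many attachment vertices that there are at most four other
  vertices for each of them; the attachment vertices pay for these.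
\<close>

definition weight :: "nat \<Rightarrow> 'a set \<Rightarrow> 'a \<Rightarrow> real" where
  "weight d X x = (if big d (cl X x) then 0 else if \<exists>y\<in>X. big d (cl X y) \<and> x \<in> cl X y then 5 else 1)"

lemma weight_bounds: "0 \<le> weight d X x" "weight d X x \<le> 5"
  by (auto simp: weight_def)

lemma cl_clique: "clique X \<Longrightarrow> x \<in> X \<Longrightarrow> cl X x = X"
  by (auto simp: cl_def nb_def clique_def)

lemma weight_separated:
  assumes "A \<subseteq> X" "separated A (X - A)" "x \<in> A"
  shows "weight d X x = weight d A x"
proof -
  have 1: "cl X a = cl A a" if "a \<in> A" for a
    using that assms unfolding cl_def nb_def separated_def by blast
  have 2: "x \<notin> cl X y" if "y \<in> X - A" for y
    using that assms adj_sym unfolding cl_def nb_def separated_def by blast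
  show ?thesis using 1 2 assms unfolding weight_def by (smt (verit, best) Diff_iff subset_eq)
qed

lemma weight_delete_mono:
  assumes "R \<subseteq> X" "t \<in> X - R" "separated R (X - {t} - R)" "\<not> big d (cl X t)" "x \<in> X - R" "x \<noteq> t"
  shows "weight d X x \<le> weight d (X - R) x"
proof -
  have 1: "cl X a = cl (X - R) a" if "a \<in> X - R" "a \<noteq> t" for a
    using that assms adj_sym unfolding cl_def nb_def separated_def by blast
  have 2: "x \<notin> cl X y" if "y \<in> R" for y
    using that assms unfolding cl_def nb_def separated_def by blast
  show ?thesis
  proof (cases "\<exists>y\<in>X. big d (cl X y) \<and> x \<in> cl X y")
    case True
    then obtain y where y: "y \<in> X" "big d (cl X y)" "x \<in> cl X y" by blast
    then have "y \<in> X - R" "y \<noteq> t" using 2 assms(4) by auto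
    then have "\<exists>y\<in>X - R. big d (cl (X - R) y) \<and> x \<in> cl (X - R) y" using y 1 by metis
    then show ?thesis using 1[of x] assms(5,6) by (simp add: weight_def)
  next
    case False
    have "weight d X x = (if big d (cl X x) then 0 else 1)"
      unfolding weight_def if_not_P[OF False] ..
    then show ?thesis using 1[of x] assms(5,6) by (auto simp: weight_def)
  qed
qed

lemma sum_weight_delete:
  assumes "finite X" "R \<subseteq> X" "t \<in> X - R" "separated R (X - {t} - R)" "\<not> big d (cl X t)"
  shows "(\<Sum>x\<in>X. weight d X x) \<le> (\<Sum>x\<in>X - R. weight d (X - R) x) + 5 + (\<Sum>r\<in>R. weight d X r)"
proof -
  have "(\<Sum>x\<in>X. weight d X x) = (\<Sum>x\<in>X - R. weight d X x) + (\<Sum>r\<in>R. weight d X r)"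
    using assms by (subst sum.subset_diff[of R X]) auto
  also have "(\<Sum>x\<in>X - R. weight d X x) = (\<Sum>x\<in>X - R - {t}. weight d X x) + weight d X t"
    using assms by (subst sum.remove[of "X - R" t]) auto
  also have "(\<Sum>x\<in>X - R - {t}. weight d X x) \<le> (\<Sum>x\<in>X - R - {t}. weight d (X - R) x)"
    using assms by (intro sum_mono weight_delete_mono) auto
  also have "\<dots> \<le> (\<Sum>x\<in>X - R. weight d (X - R) x)"
    using assms weight_bounds by (intro sum_mono2) auto
  finally show ?thesis using weight_bounds(2)[of d X t] by linarith
qed

end

context low_graph begin

text \<open>
  Attaching \<open>R\<close> at \<open>t\<close> raises no weight outside \<open>R\<close> except possibly that of \<open>t\<close>, by at most 5. The factor 10 comes from a pendant clique of size \<open>d\<close>, which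
  contributes \<open>d - 2\<close> to the defect and may turn both \<open>t\<close> and \<open>v\<close> into attachment vertices.
\<close>

lemma defect_ge_weight:
  assumes "X \<subseteq> B" and d24: "24 \<le> d"
  shows "(real d - 2) * (\<Sum>x\<in>X. weight d X x) \<le> 10 * defect d X"
  using assms(1)
proof (induction "card X" arbitrary: X rule: less_induct)
  case less
  have fX: "finite X" using less.prems finB finite_subset by blast
  have d: "real d \<ge> 24" using d24 by simp
  consider "X = {}" | "X \<noteq> {}" "\<not> conn X" | "conn X" by blast
  then show ?case
  proof cases
    case 1 then show ?thesis by (simp add: defect_def)
  next
    case 2
    then obtain A where A: "A \<noteq> {}" "A \<subset> X" "separated A (X - A)" by (auto simp: conn_def)
    have "card A < card X" "card (X - A) < card X"
      using A fX by (auto intro!: psubset_card_mono)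
    then have IH: "(real d - 2) * (\<Sum>x\<in>A. weight d A x) \<le> 10 * defect d A"
      "(real d - 2) * (\<Sum>x\<in>X - A. weight d (X - A) x) \<le> 10 * defect d (X - A)"
      using less.hyps[of A] less.hyps[of "X - A"] less.prems A by auto
    have XA: "X - (X - A) = A" using A by auto
    have "(\<Sum>x\<in>X. weight d X x) = (\<Sum>x\<in>X - A. weight d X x) + (\<Sum>x\<in>A. weight d X x)"
      using A fX by (subst sum.subset_diff[of A X]) auto
    also have "(\<Sum>x\<in>A. weight d X x) = (\<Sum>x\<in>A. weight d A x)"
      using A by (intro sum.cong weight_separated) auto
    also have "(\<Sum>x\<in>X - A. weight d X x) = (\<Sum>x\<in>X - A. weight d (X - A) x)"
      using A XA separated_sym by (intro sum.cong weight_separated) auto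
    finally show ?thesis
      using IH defect_separated[OF fX _ A(3), of d] A by (simp add: algebra_simps)
  next
    case 3
    let ?W = "\<lambda>X. \<Sum>x\<in>X. weight d X x"
    have step: ?thesis
      if R: "R \<noteq> {}" "R \<subseteq> X" "t \<in> X - R" "separated R (X - {t} - R)" "\<not> big d (cl X t)"
        and g: "defect d X = defect d (X - R) + g"
        and w: "(\<Sum>r\<in>R. weight d X r) \<le> w" and gw: "(real d - 2) * (5 + w) \<le> 10 * g"
      for R t g w
    proof -
      have "card (X - R) < card X" using R fX by (intro psubset_card_mono) auto
      then have "(real d - 2) * ?W (X - R) \<le> 10 * defect d (X - R)"
        using less.hyps[of "X - R"] less.prems by auto
      moreover have "(real d - 2) * ?W X \<le> (real d - 2) * (?W (X - R) + 5 + w)"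
        using sum_weight_delete[OF fX R(2-5)] w d by (intro mult_left_mono) auto
      ultimately show ?thesis using g gw by (simp add: algebra_simps)
    qed
    have notbig: "\<not> big d (cl X t)"
      if "t \<in> X - R" "X - R \<noteq> {t}" "separated R (X - {t} - R)" "conn (X - R)" "R \<subseteq> X" "R \<noteq> {}" for R t
    proof
      assume "big d (cl X t)"
      then have c: "clique (cl X t)" by (simp add: big_def)
      have "{t} \<subset> X - R" using that by auto
      from connD[OF that(4) _ this] obtain s where s: "s \<in> X - R" "adj t s" by auto
      have "R \<subset> X" using that by auto
      from connD[OF 3 that(6) this] obtain r b where rb: "r \<in> R" "b \<in> X - R" "adj r b" by blast
      then have "b = t" using that(3) unfolding separated_def by blast
      then have "r \<in> cl X t" "s \<in> cl X t" "r \<noteq> s" using rb s that(5) adj_sym by (auto simp: cl_def nb_def)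
      then have "adj r s" using c by (auto simp: clique_def)
      then show False using that(3) rb s adj_irrefl unfolding separated_def by blast
    qed
    from less.prems 3 show ?thesis
    proof (cases rule: peel)
      case clique
      have k: "real (card X) \<le> real d" using clique by simp
      have Xne: "X \<noteq> {}" using 3 by (simp add: conn_def)
      have df: "defect d X = real (card X) * (real d + 1 - real (card X))"
        by (rule defect_clique[OF clique(1) fX Xne])
      show ?thesis
      proof (cases "big d X")
        case True
        then have "?W X = 0" using cl_clique[OF clique(1)] by (auto simp: weight_def)
        then show ?thesis using df k by simp
      next
        case False
        then have W: "?W X = real (card X)" using cl_clique[OF clique(1)] by (auto simp: weight_def)
        have "6 * real (card X) < 5 * real d" using False clique by (simp add: big_def)
        then have "real (card X) * (real d - 2) \<le> real (card X) * (10 * (real d + 1 - real (card X)))"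
          by (intro mult_left_mono) auto
        then show ?thesis using W df by (simp add: mult_ac)
      qed
    next
      case cycle
      have "defect d X = real (card X) * (real d - 2)" using cycle by (simp add: defect_def)
      moreover have "?W X \<le> real (card X) * 5" using weight_bounds(2) by (intro sum_bounded_above) auto
      then have "(real d - 2) * ?W X \<le> (real d - 2) * (real (card X) * 5)" using d by (intro mult_left_mono) auto
      moreover have "(real d - 2) * (real (card X) * 5) = 5 * defect d X" using calculation(1) by simp
      moreover have "0 \<le> defect d X" using calculation(1) d by simp
      ultimately show ?thesis by linarith
    next
      case (clique_block R t)
      define m where "m = real (card R)"
      let ?D = "insert t R"
      have fR: "finite R" using clique_block fX finite_subset by blast
      have m: "1 \<le> m" "m \<le> real d - 2"
        using clique_block(1,8) d24 fR by (auto simp: m_def of_nat_diff Suc_le_eq card_gt_0_iff)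
      have nb: "\<not> big d (cl X t)" using notbig clique_block by blast
      have clR: "cl X r = ?D" if "r \<in> R" for r
      proof -
        have "cl X r = cl ?D r"
          using that clique_block(2,3,5) unfolding cl_def nb_def separated_def by blast
        then show ?thesis using cl_clique[OF clique_block(7)] that by simp
      qed
      show ?thesis
      proof (cases "big d ?D")
        case True
        have "(\<Sum>r\<in>R. weight d X r) \<le> 0" using True clR by (simp add: weight_def)
        moreover have "0 \<le> (m - 1) * (real d - 2 - m)" using m by simp
        then have "(real d - 2) * (5 + 0) \<le> 10 * (m * (real d - 1 - m))"
          using d by (simp add: algebra_simps)
        ultimately show ?thesis
          using step[of R t "m * (real d - 1 - m)" 0] clique_block nb by (simp add: m_def)
      next
        case False
        have "weight d X r = 1" if r: "r \<in> R" for r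
        proof -
          have "\<not> (big d (cl X y) \<and> r \<in> cl X y)" if y: "y \<in> X" for y
          proof (cases "y \<in> R \<or> y = t")
            case True then show ?thesis using clR False nb by auto
          next
            case False
            then have "r \<notin> cl X y"
              using y r clique_block(5) adj_sym unfolding cl_def nb_def separated_def by blast
            then show ?thesis by simp
          qed
          then show ?thesis using clR[OF r] False by (auto simp: weight_def)
        qed
        then have "(\<Sum>r\<in>R. weight d X r) \<le> m" by (simp add: m_def)
        moreover have "(real d - 2) * (5 + m) \<le> 10 * (m * (real d - 1 - m))"
        proof -
          have "6 * (m + 1) < 5 * real d"
            using False clique_block(3,7) fR by (simp add: big_def m_def)
          then have "0 \<le> (m - 1) * (5 * real d - 6 - 6 * m)" using m by (intro mult_nonneg_nonneg) auto
          then have 1: "0 \<le> 5 * (real d * m) - 5 * real d - 6 * (m * m) + 6"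
            by (simp add: algebra_simps)
          have 2: "24 * m \<le> real d * m" using d m by (intro mult_right_mono) auto
          have "5 * real d + real d * m - 2 * m - 10 \<le> 10 * (real d * m) - 10 * m - 10 * (m * m)"
            using 1 2 m d by linarith
          then show ?thesis by (simp add: algebra_simps)
        qed
        ultimately show ?thesis
          using step[of R t "m * (real d - 1 - m)" m] clique_block nb by (simp add: m_def)
      qed
    next
      case (cycle_block R t)
      define m where "m = real (card R)"
      have ne: "R \<noteq> {}" using cycle_block by auto
      have nb: "\<not> big d (cl X t)" using notbig cycle_block ne by blast
      have "(\<Sum>r\<in>R. weight d X r) \<le> m * 5"
        unfolding m_def using weight_bounds(2) by (intro sum_bounded_above) auto
      moreover have "(real d - 2) * (5 + m * 5) \<le> 10 * (m * (real d - 2) - 2)"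
      proof -
        have "3 * (real d - 2) \<le> m * (real d - 2)" using cycle_block(6) d by (intro mult_right_mono) (auto simp: m_def)
        then show ?thesis using d by (simp add: algebra_simps)
      qed
      ultimately show ?thesis
        using step[of R t "m * (real d - 2) - 2" "m * 5"] cycle_block nb ne by (simp add: m_def)
    next
      case (pendant R t v)
      have ne: "R \<noteq> {}" using pendant by auto
      have fR: "finite R" using pendant fX finite_subset by blast
      have nbt: "\<not> big d (cl X t)"
      proof
        assume b: "big d (cl X t)"
        have vc: "v \<in> cl X t" using pendant adj_sym by (auto simp: cl_def nb_def)
        have "cl X t \<subseteq> {t, v}"
        proof
          fix w assume w: "w \<in> cl X t"
          show "w \<in> {t, v}"
          proof (rule ccontr)
            assume n: "w \<notin> {t, v}"
            then have wX: "w \<in> X" "adj t w" using w by (auto simp: cl_def nb_def)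
            then have "w \<notin> R" using pendant(8) n adj_sym by blast
            moreover have "adj v w" using b w vc n by (auto simp: big_def clique_def)
            ultimately show False using pendant(3,7) wX n unfolding separated_def by blast
          qed
        qed
        then have "card (cl X t) \<le> card {t, v}" by (intro card_mono) auto
        also have "\<dots> \<le> 2" by (simp add: card_insert_if)
        finally show False using b d24 by (simp add: big_def)
      qed
      have "weight d X r = 0" if "r \<in> R - {v}" for r
      proof -
        have "cl X r = cl R r"
          using that pendant(1,2,3,8) unfolding cl_def nb_def separated_def by blast
        then have "cl X r = R" using cl_clique[OF pendant(5)] that by simp
        then show ?thesis using pendant(5,6) by (simp add: weight_def big_def)
      qed
      then have "(\<Sum>r\<in>R. weight d X r) = weight d X v"
        using fR pendant(7) by (subst sum.remove[of R v]) auto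
      then have "(\<Sum>r\<in>R. weight d X r) \<le> 5" using weight_bounds(2) by simp
      then show ?thesis
        using step[of R t "real d - 2" 5] pendant nbt ne d by (simp add: algebra_simps)
    qed
  qed
qed

end

section \<open>Pieces\<close>

context sym_graph begin

definition twins :: "'a set \<Rightarrow> 'a \<Rightarrow> 'a set" where
  "twins X x = {y \<in> X. cl X y = cl X x}"

lemma cl_eq_if_mem:
  assumes "x \<in> X" "y \<in> X" "clique (cl X x)" "clique (cl X y)" "y \<in> cl X x"
  shows "cl X y = cl X x"
proof -
  have self: "x \<in> cl X x" "y \<in> cl X y" by (simp_all add: cl_def)
  have xy: "x \<in> cl X y" using assms(1,5) adj_sym by (auto simp: cl_def nb_def)
  have sub: "cl X a \<subseteq> cl X b" if "a \<in> cl X b" "b \<in> X" "clique (cl X a)" "b \<in> cl X a" for a b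
  proof
    fix w assume w: "w \<in> cl X a"
    have "w = b \<or> adj b w" using that(3,4) w by (auto simp: clique_def)
    moreover have "w \<in> X" using w that(1,2) by (auto simp: cl_def nb_def)
    ultimately show "w \<in> cl X b" by (auto simp: cl_def nb_def)
  qed
  show ?thesis using sub[of x y] sub[of y x] xy assms by blast
qed

lemma mem_twins: "x \<in> X \<Longrightarrow> x \<in> twins X x"
  by (simp add: twins_def)

lemma twins_eq: "y \<in> twins X x \<Longrightarrow> twins X y = twins X x"
  by (auto simp: twins_def)

lemma twins_subset_cl: "twins X x \<subseteq> cl X x"
proof
  fix y assume "y \<in> twins X x"
  moreover have "y \<in> cl X y" by (simp add: cl_def)
  ultimately show "y \<in> cl X x" by (auto simp: twins_def)
qed

end

context low_graph begin

text \<open>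
  The bound \<open>2d/3\<close> is \<open>4/5\<close> of the least size \<open>5d/6\<close> of a big clique, which limits the loss in small
  classes, and it exceeds half of the degree of a vertex of small excess, so that such a
  vertex is adjacent to all of at most one piece.
\<close>

definition pieces :: "'a set set" where
  "pieces = {twins B x | x. x \<in> B \<and> clique (cl B x) \<and> 2 * d \<le> 3 * card (twins B x)}"

lemma piecesD:
  assumes "C \<in> pieces" "x \<in> C"
  shows "C = twins B x" "x \<in> B" "clique (cl B x)" "2 * d \<le> 3 * card C" "C \<subseteq> cl B x" "C \<subseteq> B"
proof -
  obtain x' where x': "C = twins B x'" "x' \<in> B" "clique (cl B x')" "2 * d \<le> 3 * card C"
    using assms(1) by (auto simp: pieces_def)
  then show "C = twins B x" using twins_eq assms(2) by blast
  then show "C \<subseteq> cl B x" using twins_subset_cl by auto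
  show "x \<in> B" "clique (cl B x)" "2 * d \<le> 3 * card C" "C \<subseteq> B"
    using x' assms(2) by (auto simp: twins_def)
qed

lemma pieces_nonempty: "C \<in> pieces \<Longrightarrow> C \<noteq> {}"
  using mem_twins by (auto simp: pieces_def)

lemma pieces_clique: "C \<in> pieces \<Longrightarrow> clique C"
  using piecesD(3,5) pieces_nonempty unfolding clique_def by (metis subset_eq)

lemma pieces_disjoint: "C \<in> pieces \<Longrightarrow> C' \<in> pieces \<Longrightarrow> x \<in> C \<Longrightarrow> x \<in> C' \<Longrightarrow> C = C'"
  using piecesD(1) by metis

lemma pieces_separated:
  assumes "C \<in> pieces" "C' \<in> pieces" "x \<in> C" "y \<in> C'" "adj x y"
  shows "C = C'"
proof -
  have "cl B y = cl B x"
    using assms piecesD(2,3) by (intro cl_eq_if_mem) (auto simp: cl_def nb_def)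
  then have "twins B x = twins B y" by (simp add: twins_def)
  then show ?thesis using assms piecesD(1) by metis
qed

lemma finite_pieces: "finite pieces" "C \<in> pieces \<Longrightarrow> finite C"
proof -
  have "pieces \<subseteq> Pow B" by (auto simp: pieces_def twins_def)
  then show "finite pieces" "C \<in> pieces \<Longrightarrow> finite C"
    using finB by (auto intro: finite_subset)
qed

text \<open>
  Two big cliques through \<open>y\<close> overlap in a second vertex \<open>z\<close> because \<open>y\<close> has degree at most \<open>d\<close>; with
  a private vertex of each of the two cliques this gives \<open>K\<^sub>4\<close> minus an edge, which is not regular.
\<close>

lemma big_unique:
  assumes d24: "24 \<le> d" and x: "x \<in> B" "big d (cl B x)" and x': "x' \<in> B" "big d (cl B x')"
    and y: "y \<in> cl B x" "y \<in> cl B x'"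
  shows "cl B x = cl B x'"
proof (rule ccontr)
  assume ne: "cl B x \<noteq> cl B x'"
  have c: "clique (cl B x)" "clique (cl B x')" using x x' by (auto simp: big_def)
  have n: "x' \<notin> cl B x" using cl_eq_if_mem[OF x(1) x'(1) c] ne by auto
  have n': "x \<notin> cl B x'" using n x x' adj_sym by (auto simp: cl_def nb_def)
  have yB: "y \<in> B" using y x by (auto simp: cl_def nb_def)
  have fin: "finite (cl B w)" for w using finB by (simp add: cl_def)
  have "cl B w \<subseteq> cl B y" if "w \<in> B" "clique (cl B w)" "y \<in> cl B w" for w
  proof
    fix a assume a: "a \<in> cl B w"
    then have "a = y \<or> adj y a" using that by (auto simp: clique_def)
    moreover have "a \<in> B" using a that(1) by (auto simp: cl_def nb_def)
    ultimately show "a \<in> cl B y" by (auto simp: cl_def nb_def)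
  qed
  then have "cl B x \<union> cl B x' \<subseteq> cl B y" using c y x(1) x'(1) by blast
  then have "card (cl B x \<union> cl B x') \<le> card (cl B y)" using fin by (intro card_mono)
  also have "\<dots> \<le> Suc (dg B y)" unfolding cl_def dg_def by (rule card_insert_le_m1) auto
  also have "\<dots> \<le> d + 1" using dg_le[OF yB] by simp
  finally have "card (cl B x \<union> cl B x') \<le> d + 1" .
  moreover have "card (cl B x) + card (cl B x') = card (cl B x \<union> cl B x') + card (cl B x \<inter> cl B x')"
    using fin by (intro card_Un_Int)
  ultimately have "2 \<le> card (cl B x \<inter> cl B x')" using x(2) x'(2) d24 by (simp add: big_def)
  then have "\<not> cl B x \<inter> cl B x' \<subseteq> {y}"
    using card_mono[of "{y}" "cl B x \<inter> cl B x'"] by auto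
  then obtain z where z: "z \<in> cl B x" "z \<in> cl B x'" "z \<noteq> y" by blast
  have xx: "x \<in> cl B x" "x' \<in> cl B x'" by (auto simp: cl_def)
  have ne4: "y \<noteq> x" "y \<noteq> x'" "z \<noteq> x" "z \<noteq> x'" "x \<noteq> x'" using y z n n' xx by auto
  have adj: "adj x y" "adj x z" "adj x' y" "adj x' z" "adj y z"
    using c xx y z ne4 unfolding clique_def by metis+
  have nadj: "\<not> adj x x'" using n x'(1) by (auto simp: cl_def nb_def)
  have zB: "z \<in> B" using z x by (auto simp: cl_def nb_def)
  let ?X = "{x, x', y, z}"
  have "conn {x', z}" using conn_insert[OF conn_singleton, of z z x'] adj by simp
  then have "conn {x, x', z}" using conn_insert[of "{x', z}" z x] adj by simp
  moreover have "?X - {y} = {x, x', z}" using ne4 z by auto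
  ultimately have "conn (?X - {y})" by simp
  then have "dg ?X y \<le> dg ?X x"
    using x x' yB zB adj by (intro gallaiD[OF gallaiB]) auto
  moreover have "nb ?X y = {x, x', z}" using adj adj_sym adj_irrefl by (auto simp: nb_def)
  moreover have "nb ?X x = {y, z}" using adj nadj adj_irrefl by (auto simp: nb_def)
  ultimately show False using ne4 z by (simp add: dg_def)
qed

text \<open>
  In a big clique a class of fewer than \<open>2d/3\<close> vertices is at most four times as large as the rest of
  the clique. This rest consists of attachment vertices, and the rests of different big cliques are
  disjoint by \<open>big_unique\<close>.
\<close>

lemma card_outside_pieces:
  assumes d24: "24 \<le> d"
  shows "real (card (B - \<Union>pieces)) \<le> (\<Sum>x\<in>B. weight d B x)"
proof -
  (* T: attachment vertices; S: vertices of big cliques whose class is too small to be a piece *)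
  define P where "P = {x \<in> B. \<not> big d (cl B x)}"
  define T where "T = {x \<in> P. \<exists>y\<in>B. big d (cl B y) \<and> x \<in> cl B y}"
  define S where "S = {x \<in> B - \<Union>pieces. big d (cl B x)}"
  let ?Q = "cl B ` S"
  have fin: "finite P" "finite T" "finite S" using finB by (auto simp: P_def T_def S_def)
  have finc: "finite (cl B w)" for w using finB by (simp add: cl_def)
  have W: "(\<Sum>x\<in>B. weight d B x) = real (card P) + 4 * real (card T)"
  proof -
    have "(\<Sum>x\<in>B. weight d B x) = (\<Sum>x\<in>P. weight d B x)"
      using finB by (intro sum.mono_neutral_right) (auto simp: P_def weight_def)
    also have "\<dots> = (\<Sum>x\<in>P. 1 + (if x \<in> T then 4 else 0))"
    proof (rule sum.cong)
      fix x assume x: "x \<in> P"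
      show "weight d B x = 1 + (if x \<in> T then 4 else 0)"
      proof (cases "\<exists>y\<in>B. big d (cl B y) \<and> x \<in> cl B y")
        case True then show ?thesis using x by (simp add: weight_def T_def P_def)
      next
        case False
        then have "x \<notin> T" by (auto simp: T_def)
        then show ?thesis unfolding weight_def if_not_P[OF False] using x by (simp add: P_def)
      qed
    qed simp
    also have "\<dots> = real (card P) + 4 * real (card T)"
    proof -
      have "P \<inter> {x. x \<in> T} = T" by (auto simp: T_def)
      then show ?thesis using fin by (simp add: sum.distrib sum.If_cases)
    qed
    finally show ?thesis .
  qed
  have twQ: "twins B x = {y \<in> B. cl B y = cl B x}" for x by (simp add: twins_def)
  have QT: "cl B x - twins B x \<subseteq> T" if x: "x \<in> S" for x
  proof
    fix y assume y: "y \<in> cl B x - twins B x"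
    have xB: "x \<in> B" "big d (cl B x)" using x by (auto simp: S_def)
    have yB: "y \<in> B" using y xB by (auto simp: cl_def nb_def)
    have "\<not> big d (cl B y)"
    proof
      assume "big d (cl B y)"
      then have "cl B y = cl B x"
        using cl_eq_if_mem[OF xB(1) yB] xB y by (auto simp: big_def)
      then show False using y yB by (simp add: twins_def)
    qed
    then show "y \<in> T" using xB yB y by (auto simp: T_def P_def)
  qed
  have card_le: "card (twins B x) \<le> 4 * card (cl B x - twins B x)" if x: "x \<in> S" for x
  proof -
    have "x \<in> B" "big d (cl B x)" "x \<notin> \<Union>pieces" using x by (auto simp: S_def)
    then have "5 * d \<le> 6 * card (cl B x)" "\<not> 2 * d \<le> 3 * card (twins B x)"
      using mem_twins[of x B] by (auto simp: pieces_def big_def)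
    moreover have "card (cl B x - twins B x) = card (cl B x) - card (twins B x)"
      by (intro card_Diff_subset finite_subset[OF twins_subset_cl finc] twins_subset_cl)
    ultimately show ?thesis by linarith
  qed
  let ?C = "\<lambda>Q. {y \<in> B. cl B y = Q}"
  have "S \<subseteq> (\<Union>Q\<in>?Q. ?C Q)" by (auto simp: S_def)
  then have "card S \<le> card (\<Union>Q\<in>?Q. ?C Q)" using fin finB by (intro card_mono) auto
  also have "\<dots> \<le> (\<Sum>Q\<in>?Q. card (?C Q))" using fin by (intro card_UN_le) auto
  also have "\<dots> \<le> (\<Sum>Q\<in>?Q. 4 * card (Q - ?C Q))"
    using card_le by (intro sum_mono) (auto simp: twQ)
  also have "\<dots> = 4 * card (\<Union>Q\<in>?Q. Q - ?C Q)"
  proof -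
    have "card (\<Union>Q\<in>?Q. Q - ?C Q) = (\<Sum>Q\<in>?Q. card (Q - ?C Q))"
    proof (rule card_UN_disjoint)
      show "\<forall>Q\<in>?Q. \<forall>Q'\<in>?Q. Q \<noteq> Q' \<longrightarrow> (Q - ?C Q) \<inter> (Q' - ?C Q') = {}"
        using big_unique[OF d24] by (auto simp: S_def)
    qed (use fin finc in auto)
    then show ?thesis by (simp add: sum_distrib_left)
  qed
  also have "card (\<Union>Q\<in>?Q. Q - ?C Q) \<le> card T"
    using QT fin by (intro card_mono) (auto simp: twQ)
  finally have S: "card S \<le> 4 * card T" by simp
  have "card (B - \<Union>pieces) \<le> card (P \<union> S)"
    using fin by (intro card_mono) (auto simp: P_def S_def)
  also have "\<dots> \<le> card P + card S" by (rule card_Un_le)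
  finally show ?thesis using W S by linarith
qed

end

section \<open>Colouring from lists in a cover\<close>

context sym_graph begin

text \<open>
  One relation \<open>cf\<close> on all colours suffices, since different vertices of a cover draw their colours
  from disjoint sets; \<open>residual\<close> gives the lists that remain when \<open>W\<close> has been coloured by \<open>f\<close>.
\<close>

definition proper :: "('b \<Rightarrow> 'b \<Rightarrow> bool) \<Rightarrow> 'a set \<Rightarrow> ('a \<Rightarrow> 'b set) \<Rightarrow> ('a \<Rightarrow> 'b) \<Rightarrow> bool" where
  "proper cf X M f \<longleftrightarrow> (\<forall>v\<in>X. f v \<in> M v) \<and> (\<forall>u\<in>X. \<forall>v\<in>X. adj u v \<longrightarrow> \<not> cf (f u) (f v))"

definition residual :: "('b \<Rightarrow> 'b \<Rightarrow> bool) \<Rightarrow> 'a set \<Rightarrow> ('a \<Rightarrow> 'b set) \<Rightarrow> ('a \<Rightarrow> 'b) \<Rightarrow> 'a \<Rightarrow> 'b set" where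
  "residual cf W M f v = {c \<in> M v. \<forall>w\<in>W. adj v w \<longrightarrow> \<not> cf (f w) c}"

end

text \<open>
  The conflicts between the lists of adjacent vertices form a matching; conflicts between colours of
  nonadjacent vertices are ignored by \<open>proper\<close>.
\<close>

locale cover = sym_graph adj for adj :: "'a \<Rightarrow> 'a \<Rightarrow> bool" +
  fixes V :: "'a set" and L :: "'a \<Rightarrow> 'b set" and cf :: "'b \<Rightarrow> 'b \<Rightarrow> bool"
  assumes finV: "finite V"
    and finL: "v \<in> V \<Longrightarrow> finite (L v)"
    and cf_sym: "cf a b \<Longrightarrow> cf b a"
    and cf_inj: "\<lbrakk>u \<in> V; v \<in> V; adj u v; a \<in> L u; b \<in> L v; b' \<in> L v; cf a b; cf a b'\<rbrakk> \<Longrightarrow> b = b'"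
begin

abbreviation "prop_col \<equiv> proper cf"
abbreviation "res \<equiv> residual cf"

definition colorable :: "'a set \<Rightarrow> ('a \<Rightarrow> 'b set) \<Rightarrow> bool" where
  "colorable X M \<longleftrightarrow> (\<exists>f. prop_col X M f)"

lemma proper_cong: "(\<And>v. v \<in> X \<Longrightarrow> f v = g v) \<Longrightarrow> prop_col X M f \<longleftrightarrow> prop_col X M g"
  unfolding proper_def by auto

lemma proper_mono: "prop_col X M f \<Longrightarrow> Y \<subseteq> X \<Longrightarrow> prop_col Y M f"
  unfolding proper_def by blast

lemma res_subset: "res W M f v \<subseteq> M v"
  by (auto simp: residual_def)

lemma proper_union:
  assumes "prop_col W M f" "prop_col X (res W M f) g" "X \<inter> W = {}"
  shows "prop_col (W \<union> X) M (\<lambda>v. if v \<in> X then g v else f v)"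
  unfolding proper_def
proof (intro conjI ballI impI)
  fix v assume "v \<in> W \<union> X"
  then show "(if v \<in> X then g v else f v) \<in> M v"
    using assms by (auto simp: proper_def residual_def)
next
  fix u v assume uv: "u \<in> W \<union> X" "v \<in> W \<union> X" "adj u v"
  have 1: "\<not> cf (f w) (g x)" if "w \<in> W" "x \<in> X" "adj x w" for w x
    using assms(2) that by (auto simp: proper_def residual_def)
  show "\<not> cf (if u \<in> X then g u else f u) (if v \<in> X then g v else f v)"
  proof (cases "u \<in> X"; cases "v \<in> X")
    assume "u \<in> X" "v \<in> X"
    then show ?thesis using assms(2) uv(3) by (simp add: proper_def)
  next
    assume "u \<in> X" "v \<notin> X"
    then show ?thesis using 1[of v u] uv cf_sym[of "g u" "f v"] by auto
  next
    assume "u \<notin> X" "v \<in> X"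
    then show ?thesis using 1[of u v] uv adj_sym by auto
  next
    assume "u \<notin> X" "v \<notin> X"
    then show ?thesis using assms(1) uv by (simp add: proper_def)
  qed
qed

lemma card_residual:
  assumes "W \<subseteq> V" "v \<in> V" "M v \<subseteq> L v" "\<And>w. w \<in> W \<Longrightarrow> f w \<in> L w"
  shows "card (M v) \<le> card (res W M f v) + dg W v"
proof -
  define k where "k w = (SOME c. c \<in> L v \<and> cf (f w) c)" for w
  have fin: "finite W" "finite (M v)" using assms finV finL finite_subset by metis+
  have "M v - res W M f v \<subseteq> k ` nb W v"
  proof
    fix c assume c: "c \<in> M v - res W M f v"
    then obtain w where w: "w \<in> W" "adj v w" "cf (f w) c" by (auto simp: residual_def)
    have "k w \<in> L v \<and> cf (f w) (k w)"
      unfolding k_def by (rule someI[of _ c]) (use c assms(3) w in auto)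
    then have "k w = c"
      using cf_inj[of w v "f w" "k w" c] w assms c adj_sym by blast
    then show "c \<in> k ` nb W v" using w by (auto simp: nb_def)
  qed
  then have "card (M v - res W M f v) \<le> card (k ` nb W v)" using fin by (intro card_mono) auto
  also have "\<dots> \<le> dg W v" using fin by (auto simp: dg_def intro: card_image_le)
  finally have "card (M v - res W M f v) \<le> dg W v" .
  moreover have "card (M v) \<le> card (M v - res W M f v) + card (res W M f v)"
  proof -
    have "(M v - res W M f v) \<union> res W M f v = M v" using res_subset by blast
    then show ?thesis using card_Un_le[of "M v - res W M f v" "res W M f v"] by simp
  qed
  ultimately show ?thesis by simp
qed

text \<open>
  Colour towards \<open>x\<close>: every other vertex is coloured while it still has an uncoloured neighbour.
\<close>

lemma greedy:
  assumes X: "X \<subseteq> V" "conn X" and M: "\<And>v. v \<in> X \<Longrightarrow> M v \<subseteq> L v" "\<And>v. v \<in> X \<Longrightarrow> dg X v \<le> card (M v)"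
    and x: "x \<in> X" "dg X x < card (M x)"
  shows "colorable X M"
proof -
  have finX: "finite X" using X finV finite_subset by blast
  (* Q A: it suffices to colour the vertices outside A *)
  define Q where "Q A \<longleftrightarrow> A \<subseteq> X \<and> x \<in> A \<and> (\<forall>f. prop_col (X - A) M f \<longrightarrow> colorable X M)" for A
  have extend: "\<exists>c. prop_col (insert v Y) M (f(v := c))"
    if "v \<in> X" "Y \<subseteq> X" "v \<notin> Y" "prop_col Y M f" "dg Y v < card (M v)" for v Y f
  proof -
    have "card (M v) \<le> card (res Y M f v) + dg Y v"
    proof (rule card_residual)
      show "f w \<in> L w" if "w \<in> Y" for w
        using that \<open>prop_col Y M f\<close> \<open>Y \<subseteq> X\<close> M(1) unfolding proper_def by blast
    qed (use that X M in auto)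
    then have "res Y M f v \<noteq> {}" using that(5) by auto
    then obtain c where c: "c \<in> res Y M f v" by blast
    have "prop_col {v} (res Y M f) (\<lambda>_. c)" using c adj_irrefl by (auto simp: proper_def)
    from proper_union[OF that(4) this]
    have "prop_col (Y \<union> {v}) M (\<lambda>u. if u \<in> {v} then c else f u)" using that(3) by auto
    moreover have "(\<lambda>u. if u \<in> {v} then c else f u) = f(v := c)" by auto
    ultimately have "prop_col (insert v Y) M (f(v := c))" by simp
    then show ?thesis by blast
  qed
  have Q1: "Q {x}"
    unfolding Q_def
  proof (intro conjI allI impI)
    fix f assume f: "prop_col (X - {x}) M f"
    have "dg (X - {x}) x \<le> dg X x" using finX by (intro dg_mono) auto
    then have "dg (X - {x}) x < card (M x)" using x by simp
    then obtain c where "prop_col (insert x (X - {x})) M (f(x := c))"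
      using extend[OF x(1) _ _ f] by blast
    then show "colorable X M" using x by (auto simp: colorable_def insert_absorb)
  qed (use x in auto)
  have "finite {A. Q A}" using finX by (auto simp: Q_def intro: finite_subset[of _ "Pow X"])
  moreover have "{A. Q A} \<noteq> {}" using Q1 by auto
  ultimately obtain A where A: "Q A" "\<And>A'. Q A' \<Longrightarrow> \<not> A \<subset> A'"
    using finite_has_maximal[of "{A. Q A}"] by (metis mem_Collect_eq psubsetE psubset_imp_subset)
  have "A = X"
  proof (rule ccontr)
    assume "A \<noteq> X"
    then have "A \<noteq> {}" "A \<subset> X" using A(1) by (auto simp: Q_def)
    from connD[OF X(2) this] obtain a b where ab: "a \<in> A" "b \<in> X - A" "adj a b" by blast
    have "Q (insert b A)"
      unfolding Q_def
    proof (intro conjI allI impI)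
      fix f assume f: "prop_col (X - insert b A) M f"
      have "dg (X - insert b A) b < dg X b"
        unfolding dg_def
        by (rule psubset_card_mono) (use ab finX adj_sym A(1) in \<open>auto simp: nb_def Q_def\<close>)
      then have "dg (X - insert b A) b < card (M b)" using M(2)[of b] ab by auto
      then obtain c where "prop_col (insert b (X - insert b A)) M (f(b := c))"
        using extend[of b "X - insert b A" f] f ab by blast
      moreover have "insert b (X - insert b A) = X - A" using ab by auto
      ultimately show "colorable X M" using A(1) by (auto simp: Q_def)
    qed (use A(1) ab in \<open>auto simp: Q_def\<close>)
    then show False using A(2) ab by blast
  qed
  moreover have "prop_col {} M f" for f by (simp add: proper_def)
  ultimately show ?thesis using A(1) by (auto simp: Q_def)
qed

text \<open>
  Giving \<open>v\<close> the colour \<open>c\<close> removes a neighbour of \<open>u\<close> but no colour from its list, so \<open>u\<close> can serve as the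
  last vertex of a greedy colouring.
\<close>

lemma unmatched_color:
  assumes X: "X \<subseteq> V" "conn (X - {v})" and uv: "u \<in> X" "v \<in> X" "adj u v"
    and M: "\<And>w. w \<in> X \<Longrightarrow> M w \<subseteq> L w" "\<And>w. w \<in> X \<Longrightarrow> dg X w \<le> card (M w)"
    and c: "c \<in> M v" "\<And>c'. c' \<in> M u \<Longrightarrow> \<not> cf c c'"
  shows "colorable X M"
proof -
  have finX: "finite X" using X finV finite_subset by blast
  have f: "prop_col {v} M (\<lambda>_. c)" using c adj_irrefl by (auto simp: proper_def)
  let ?N = "res {v} M (\<lambda>_. c)"
  have un: "u \<noteq> v" using uv adj_irrefl by auto
  have dX: "dg X w = dg (X - {v}) w + dg {v} w" for w
  proof -
    have "X = (X - {v}) \<union> {v}" using uv by auto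
    then show ?thesis using dg_union[of "X - {v}" "{v}" w] finX by auto
  qed
  have N: "card (M w) \<le> card (?N w) + dg {v} w" if "w \<in> X" for w
    by (rule card_residual) (use that uv X M c in auto)
  have "?N u = M u" using c cf_sym by (auto simp: residual_def)
  moreover have "dg {v} u > 0" using uv adj_sym by (intro dg_pos[of _ v]) auto
  ultimately have "dg (X - {v}) u < card (?N u)" using dX[of u] M(2)[OF uv(1)] by simp
  moreover have "dg (X - {v}) w \<le> card (?N w)" if "w \<in> X - {v}" for w
    using dX[of w] M(2)[of w] N[of w] that by auto
  moreover have "?N w \<subseteq> L w" if "w \<in> X" for w
    using that M res_subset by blast
  ultimately have "colorable (X - {v}) ?N"
    using uv un X by (intro greedy[of _ _ u]) auto
  then obtain g where "prop_col (X - {v}) ?N g" by (auto simp: colorable_def)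
  from proper_union[OF f this] show ?thesis
    using uv by (auto simp: colorable_def insert_absorb)
qed

end

locale critical_cover = cover adj V L cf for adj :: "'a \<Rightarrow> 'a \<Rightarrow> bool" and V and L :: "'a \<Rightarrow> 'b set" and cf +
  fixes d :: nat
  assumes d3: "3 \<le> d"
    and card_L: "v \<in> V \<Longrightarrow> card (L v) = d"
    and no_clique: "K \<subseteq> V \<Longrightarrow> clique K \<Longrightarrow> card K \<noteq> d + 1"
    and not_colorable: "\<not> colorable V L"
    and critical: "X \<subset> V \<Longrightarrow> colorable X L"
begin

text \<open>
  The truncated subtraction is harmless by \<open>dg_ge\<close>.
\<close>

definition excess :: "'a \<Rightarrow> nat" where
  "excess v = dg V v - d"

lemma remainder_not_colorable:
  assumes "U \<subseteq> V" "U \<noteq> {}"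
  obtains f where "prop_col (V - U) L f" "\<not> colorable U (res (V - U) L f)"
proof -
  have "V - U \<subset> V" using assms by auto
  then obtain f where f: "prop_col (V - U) L f" using critical by (auto simp: colorable_def)
  have "\<not> colorable U (res (V - U) L f)"
  proof
    assume "colorable U (res (V - U) L f)"
    then obtain g where "prop_col U (res (V - U) L f) g" by (auto simp: colorable_def)
    from proper_union[OF f this] assms have "colorable V L"
      by (auto simp: colorable_def Un_absorb2)
    then show False using not_colorable by simp
  qed
  then show thesis using that f by blast
qed

lemma dg_V_split: "U \<subseteq> V \<Longrightarrow> dg V v = dg U v + dg (V - U) v"
  using dg_union[of U "V - U" v] finV finite_subset by (auto simp: Un_absorb1)

lemma card_res_ge:
  assumes "U \<subseteq> V" "prop_col (V - U) L f" "v \<in> V"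
  shows "d \<le> card (res (V - U) L f v) + dg (V - U) v"
  using card_residual[of "V - U" v L f] card_L[OF assms(3)] assms by (auto simp: proper_def)

lemma dg_ge: "v \<in> V \<Longrightarrow> d \<le> dg V v"
proof (rule ccontr)
  assume v: "v \<in> V" "\<not> d \<le> dg V v"
  obtain f where f: "prop_col (V - {v}) L f" "\<not> colorable {v} (res (V - {v}) L f)"
    using remainder_not_colorable[of "{v}"] v by auto
  have "dg (V - {v}) v \<le> dg V v" using finV by (intro dg_mono) auto
  then have "card (res (V - {v}) L f v) > 0" using card_res_ge[of "{v}" f v] f v by auto
  then obtain c where "c \<in> res (V - {v}) L f v" by (metis card.empty ex_in_conv less_irrefl)
  then have "prop_col {v} (res (V - {v}) L f) (\<lambda>_. c)" using adj_irrefl by (auto simp: proper_def)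
  then show False using f by (auto simp: colorable_def)
qed

lemma dg_excess: "v \<in> V \<Longrightarrow> dg V v = d + excess v"
  using dg_ge by (simp add: excess_def)

lemma card_res_excess:
  assumes "U \<subseteq> V" "prop_col (V - U) L f" "v \<in> V"
  shows "dg U v \<le> card (res (V - U) L f v) + excess v"
  using card_res_ge[OF assms] dg_V_split[OF assms(1), of v] dg_excess[OF assms(3)] by simp

definition low :: "'a set" where
  "low = {v \<in> V. excess v = 0}"

text \<open>
  If \<open>v\<close> had larger degree than \<open>u\<close>, the remaining list of \<open>v\<close> would contain a colour in conflict
  with no colour of \<open>u\<close>; after \<open>v\<close> has received this colour, everything else could be coloured
  towards \<open>u\<close>.
\<close>

lemma gallai_low: "gallai low"
  unfolding gallai_def
proof (intro allI impI)
  fix X u v assume X: "X \<subseteq> low" and uv: "u \<in> X" "v \<in> X" "adj u v" and c: "conn (X - {v})"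
  show "dg X v \<le> dg X u"
  proof (rule ccontr)
    assume n: "\<not> dg X v \<le> dg X u"
    have XV: "X \<subseteq> V" using X by (auto simp: low_def)
    obtain f where f: "prop_col (V - X) L f" "\<not> colorable X (res (V - X) L f)"
      using remainder_not_colorable[of X] XV uv by auto
    let ?M = "res (V - X) L f"
    have M: "dg X w \<le> card (?M w)" if "w \<in> X" for w
      using card_res_excess[OF XV f(1), of w] that X by (auto simp: low_def)
    have resL: "?M w \<subseteq> L w" for w by (rule res_subset)
    have cX: "conn X"
    proof -
      have "u \<in> X - {v}" using uv adj_irrefl by auto
      then have "conn (insert v (X - {v}))" using conn_insert[OF c] uv adj_sym by blast
      then show ?thesis using uv by (simp add: insert_absorb)
    qed
    have "card (?M u) = dg X u"
    proof (rule ccontr)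
      assume "card (?M u) \<noteq> dg X u"
      then have "colorable X ?M" using M[OF uv(1)] by (intro greedy[OF XV cX resL M uv(1)]) auto
      then show False using f by simp
    qed
    then have lt: "card (?M u) < card (?M v)" using M[OF uv(2)] n by simp
    have "\<exists>c\<in>?M v. \<forall>c'\<in>?M u. \<not> cf c c'"
    proof (rule ccontr)
      assume "\<not> ?thesis"
      then obtain k where k: "\<And>c. c \<in> ?M v \<Longrightarrow> k c \<in> ?M u \<and> cf c (k c)" by metis
      have "inj_on k (?M v)"
      proof (rule inj_onI)
        fix a b assume ab: "a \<in> ?M v" "b \<in> ?M v" "k a = k b"
        then show "a = b"
          using cf_inj[of u v "k a" a b] k[OF ab(1)] k[OF ab(2)] resL cf_sym uv XV by (metis subset_eq)
      qed
      moreover have "k ` ?M v \<subseteq> ?M u" using k by auto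
      moreover have "finite (?M u)" using resL finL uv XV by (meson finite_subset subset_eq)
      ultimately have "card (?M v) \<le> card (?M u)" by (rule card_inj_on_le)
      then show False using lt by simp
    qed
    then show False using unmatched_color[OF XV c uv resL M] f by blast
  qed
qed

sublocale low_graph adj low d
proof
  show "finite low" using finV by (simp add: low_def)
  show "dg low x \<le> d" if "x \<in> low" for x
  proof -
    have "dg low x \<le> dg V x" using finV by (intro dg_mono) (auto simp: low_def)
    then show ?thesis using that dg_excess[of x] by (auto simp: low_def)
  qed
  show "card K \<noteq> d + 1" if "K \<subseteq> low" "clique K" for K
    using that no_clique by (auto simp: low_def)
qed (use d3 gallai_low in auto)

end

section \<open>Neighbours of pieces in a critical cover\<close>

context cover begin

text \<open>
  If a clique cannot be coloured from lists one short of its size, then each list is matched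
  completely into each other list, so one list determines all others.
\<close>

lemma clique_lists:
  assumes C: "C \<subseteq> V" "clique C" and N: "\<And>x. x \<in> C \<Longrightarrow> N x \<subseteq> L x" "\<And>x. x \<in> C \<Longrightarrow> card C - 1 \<le> card (N x)"
    and bad: "\<not> colorable C N" and xz: "x \<in> C" "z \<in> C" "x \<noteq> z"
  shows "card (N x) = card C - 1" "N x = {c \<in> L x. \<exists>c'\<in>N z. cf c' c}"
proof -
  have finC: "finite C" using C finV finite_subset by blast
  have M: "dg C w \<le> card (N w)" if "w \<in> C" for w
    using N(2)[OF that] dg_clique[OF C(2) that finC] by simp
  have cC: "conn C" using conn_clique[OF C(2)] xz by blast
  have eq: "card (N w) = card C - 1" if "w \<in> C" for w
  proof (rule ccontr)
    assume "card (N w) \<noteq> card C - 1"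
    then have "dg C w < card (N w)" using N(2)[OF that] dg_clique[OF C(2) that finC] by simp
    then show False using greedy[OF C(1) cC N(1) M that] bad by simp
  qed
  then show "card (N x) = card C - 1" using xz by blast
  have az: "adj x z" using C xz by (auto simp: clique_def)
  have "clique (C - {z})" using C by (auto simp: clique_def)
  then have cz: "conn (C - {z})" using conn_clique xz by blast
  have "\<exists>c'\<in>N x. cf c c'" if "c \<in> N z" for c
    using unmatched_color[OF C(1) cz xz(1,2) az N(1) M that] bad by blast
  then obtain k where k: "\<And>c. c \<in> N z \<Longrightarrow> k c \<in> N x \<and> cf c (k c)" by metis
  have inL: "w \<in> L x" if "w \<in> N x" for w using that N(1) xz by blast
  have inLz: "w \<in> L z" if "w \<in> N z" for w using that N(1) xz by blast
  have xV: "x \<in> V" "z \<in> V" using C xz by auto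
  have "inj_on k (N z)"
  proof (rule inj_onI)
    fix a b assume ab: "a \<in> N z" "b \<in> N z" "k a = k b"
    show "a = b"
      using cf_inj[OF xV az, of "k a" a b] k[OF ab(1)] k[OF ab(2)] ab inL inLz cf_sym by metis
  qed
  then have "card (k ` N z) = card (N x)" using eq xz by (simp add: card_image)
  moreover have "finite (N x)" using N(1)[OF xz(1)] finL[OF xV(1)] finite_subset by blast
  moreover have "k ` N z \<subseteq> N x" using k by auto
  ultimately have img: "k ` N z = N x" by (intro card_subset_eq) auto
  show "N x = {c \<in> L x. \<exists>c'\<in>N z. cf c' c}"
  proof (intro equalityI subsetI CollectI conjI)
    fix c assume c: "c \<in> N x"
    then show "c \<in> L x" by (rule inL)
    have "c \<in> k ` N z" using c img by simp
    then show "\<exists>c'\<in>N z. cf c' c" using k by blast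
  next
    fix c assume "c \<in> {c \<in> L x. \<exists>c'\<in>N z. cf c' c}"
    then obtain c' where c': "c \<in> L x" "c' \<in> N z" "cf c' c" by blast
    then have "c = k c'"
      using cf_inj[OF xV(2,1) adj_sym[OF az], of c' c "k c'"] k[OF c'(2)] inL inLz by blast
    then show "c \<in> N x" using k c' by blast
  qed
qed

lemma proper_singleton: "c \<in> M v \<Longrightarrow> prop_col {v} M (\<lambda>_. c)"
  using adj_irrefl by (auto simp: proper_def)

lemma colorable_union:
  assumes "prop_col W M f" "colorable X (res W M f)" "X \<inter> W = {}"
  shows "colorable (W \<union> X) M"
  using assms proper_union unfolding colorable_def by metis

end

context critical_cover begin

lemma excess_low: "v \<in> low \<Longrightarrow> excess v = 0" "v \<in> low \<Longrightarrow> v \<in> V"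
  by (auto simp: low_def)

lemma excess_high: "v \<in> V - low \<Longrightarrow> 1 \<le> excess v"
  by (auto simp: low_def)

lemma pieceV: "C \<in> pieces \<Longrightarrow> C \<subseteq> V"
  using piecesD(6) pieces_nonempty excess_low by blast

text \<open>
  Colour everything except \<open>y\<close> and \<open>C\<close>. If \<open>C\<close> cannot be finished after \<open>y\<close> has received a colour, then
  the list of \<open>z\<close>, on which \<open>y\<close> has no influence, determines the list of \<open>x\<close> and with it the colour of
  \<open>y\<close>. So one of any two available colours of \<open>y\<close> can be extended.
\<close>

lemma few_neighbours:
  assumes C: "C \<in> pieces" and y: "y \<in> V - low" and x: "x \<in> C" "adj y x" and z: "z \<in> C" "\<not> adj y z"
  shows "dg C y \<le> excess y + 1"
proof (rule ccontr)
  assume n: "\<not> dg C y \<le> excess y + 1"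
  have CV: "C \<subseteq> V" "C \<subseteq> low" using C pieceV piecesD(6) x by auto
  have finC: "finite C" using finite_pieces C by auto
  have cl: "clique C" using C by (rule pieces_clique)
  have yC: "y \<notin> C" using CV y by auto
  let ?U = "insert y C"
  have U: "?U \<subseteq> V" using CV y by auto
  obtain f where f: "prop_col (V - ?U) L f" "\<not> colorable ?U (res (V - ?U) L f)"
    using remainder_not_colorable[OF U] by auto
  let ?M = "res (V - ?U) L f"
  have dU: "dg ?U w = dg {y} w + dg C w" for w
    using dg_union[of "{y}" C w] finC yC by simp
  have "dg {y} y = 0" using adj_irrefl by (intro dg_eq_0) auto
  then have "2 \<le> card (?M y)"
    using card_res_excess[OF U f(1), of y] dU[of y] n y by simp
  then have "\<not> is_singleton (?M y)" "?M y \<noteq> {}" by (auto simp: is_singleton_altdef)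
  then obtain c c' where cc: "c \<in> ?M y" "c' \<in> ?M y" "c \<noteq> c'"
    by (metis is_singletonI' )
  define N where "N a = res {y} ?M (\<lambda>_. a)" for a
  have resL: "?M w \<subseteq> L w" for w by (rule res_subset)
  have NL: "N a w \<subseteq> L w" for a w using res_subset res_subset unfolding N_def by (rule order_trans)
  have bad: "\<not> colorable C (N a)" if "a \<in> ?M y" for a
    using colorable_union[OF proper_singleton[of a ?M y, OF that]] f(2) yC unfolding N_def by auto
  have Mcard: "card C - 1 + dg {y} w \<le> card (?M w)" if "w \<in> C" for w
    using card_res_excess[OF U f(1), of w] excess_low that CV dU[of w] dg_clique[OF cl that finC] by auto
  have Ncard: "card C - 1 \<le> card (N a w)" if "w \<in> C" "a \<in> ?M y" for w a
  proof -
    have "card (?M w) \<le> card (N a w) + dg {y} w"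
      unfolding N_def by (rule card_residual) (use that y CV resL in auto)
    then show ?thesis using Mcard[OF that(1)] by simp
  qed
  have zx: "x \<noteq> z" using x z by auto
  have N1: "card (N a x) = card C - 1" "N a x = {k \<in> L x. \<exists>k'\<in>?M z. cf k' k}" if "a \<in> ?M y" for a
  proof -
    have "N a z = ?M z" using z adj_commute by (auto simp: N_def residual_def)
    then show "card (N a x) = card C - 1" "N a x = {k \<in> L x. \<exists>k'\<in>?M z. cf k' k}"
      using clique_lists[OF CV(1) cl NL Ncard bad x(1) z(1) zx, of a] that by simp_all
  qed
  have "dg {y} x > 0" using x adj_sym by (intro dg_pos[of _ y]) auto
  then have "card (N c x) < card (?M x)" using N1(1)[OF cc(1)] Mcard[OF x(1)] by simp
  then have "\<not> ?M x \<subseteq> N c x"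
    using card_mono[of "N c x" "?M x"] NL[of c x] finL[of x] x CV finite_subset by (metis not_le subset_eq)
  then obtain k where k: "k \<in> ?M x" "k \<notin> N c x" by blast
  then have "k \<notin> N c' x" using N1(2) cc by simp
  then have "cf c k" "cf c' k" using k by (auto simp: N_def residual_def)
  then show False
    using cf_inj[of x y k c c'] cc cf_sym x y CV adj_sym k(1) resL by blast
qed

text \<open>
  Otherwise all vertices of \<open>C\<close> have the same closed neighbourhood. Its size is \<open>d + 1\<close>, so it is not
  a clique, and two nonadjacent members \<open>u, w\<close> of it can be
  coloured so that together they spoil only one colour at one vertex of \<open>C\<close>.
\<close>

lemma rich_or_partial_neighbour:
  assumes C: "C \<in> pieces" and x: "x \<in> C"
  shows "\<exists>y\<in>V - low. adj x y \<and> (d \<le> 9 * excess y \<or> (\<exists>x'\<in>C. \<not> adj y x'))"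
proof (rule ccontr)
  assume n: "\<not> ?thesis"
  have full: "adj y x'" and poor: "9 * excess y < d" if "y \<in> V - low" "adj x y" "x' \<in> C" for y x'
    using n that by auto
  have CV: "C \<subseteq> V" "C \<subseteq> low" using C pieceV piecesD(6) x by auto
  have finC: "finite C" using finite_pieces C by auto
  have cl: "clique C" using C by (rule pieces_clique)
  have lowV: "low \<subseteq> V" by (auto simp: low_def)
  have V_split: "nb V w = nb low w \<union> nb (V - low) w" for w using lowV by (auto simp: nb_def)
  have dV: "dg V w = dg low w + dg (V - low) w" for w
    using dg_V_split[OF lowV] .
  have same: "cl V x' = cl V x" if x': "x' \<in> C" for x'
  proof -
    have l: "cl low x' = cl low x"
      using piecesD(1)[OF C x] x' by (auto simp: twins_def)
    have "card (cl low w) = Suc (dg low w)" for w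
      using finB adj_irrefl by (simp add: cl_def dg_def) (simp add: nb_def)
    then have "dg low x' = dg low x" using l by (metis Suc_inject)
    moreover have "x \<in> low" "x' \<in> low" using CV x x' by auto
    then have "dg V x' = dg V x" using dg_excess[of x] dg_excess[of x'] excess_low by simp
    ultimately have "card (nb (V - low) x') = card (nb (V - low) x)"
      using dV[of x] dV[of x'] by (simp add: dg_def)
    moreover have "nb (V - low) x \<subseteq> nb (V - low) x'"
      using full x' adj_sym by (auto simp: nb_def)
    ultimately have "nb (V - low) x = nb (V - low) x'"
      using finV by (intro card_subset_eq) auto
    moreover have "cl V w = cl low w \<union> nb (V - low) w" for w
      using V_split by (auto simp: cl_def)
    ultimately show ?thesis using l by simp
  qed
  let ?K = "cl V x"
  have KV: "?K \<subseteq> V" using x CV by (auto simp: cl_def nb_def)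
  have "card ?K = Suc (dg V x)"
    using finV adj_irrefl by (simp add: cl_def dg_def) (simp add: nb_def)
  then have "card ?K = d + 1" using dg_excess[of x] excess_low x CV by auto
  then have "\<not> clique ?K" using no_clique[OF KV] by auto
  then obtain u w where uw: "u \<in> ?K" "w \<in> ?K" "u \<noteq> w" "\<not> adj u w" by (auto simp: clique_def)
  have notC: "a \<notin> C" if "a \<in> ?K" "b \<in> ?K" "a \<noteq> b" "\<not> adj a b" for a b
    using same[of a] that by (auto simp: cl_def nb_def)
  have uC: "u \<notin> C" "w \<notin> C" using notC uw adj_sym by metis+
  have adjC: "adj a x'" if "a \<in> ?K" "a \<notin> C" "x' \<in> C" for a x'
  proof -
    have "a \<in> cl V x'" "a \<noteq> x'" using same[of x'] that by auto
    then show ?thesis using adj_sym by (auto simp: cl_def nb_def)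
  qed
  have poorK: "9 * excess a < d" if "a \<in> ?K" "a \<notin> C" for a
  proof (cases "a \<in> low")
    case True then show ?thesis using excess_low d3 by simp
  next
    case False then show ?thesis using poor[of a x] that x KV adj_sym adjC by blast
  qed
  let ?U = "{u, w} \<union> C"
  have U: "?U \<subseteq> V" using uw KV CV by auto
  obtain f where f: "prop_col (V - ?U) L f" "\<not> colorable ?U (res (V - ?U) L f)"
    using remainder_not_colorable[OF U] by auto
  let ?M = "res (V - ?U) L f"
  have resL: "?M v \<subseteq> L v" for v by (rule res_subset)
  have dU: "dg ?U v = dg {u, w} v + dg C v" for v
    by (rule dg_union) (use finC uC in auto)
  have Muw: "card C \<le> card (?M a) + excess a" if "a \<in> {u, w}" for a
  proof -
    have "nb C a = C" using that adjC uw uC by (auto simp: nb_def)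
    then have "dg C a = card C" by (simp add: dg_def)
    then show ?thesis using card_res_excess[OF U f(1), of a] that U dU[of a] by auto
  qed
  have xlow: "x \<in> V" "card (L x) = d" using x CV card_L by auto
  have duw: "dg {u, w} v = 2" if "v \<in> C" for v
  proof -
    have "nb {u, w} v = {u, w}" using adjC uw uC that adj_sym by (auto simp: nb_def)
    then show ?thesis using uw by (simp add: dg_def)
  qed
  have uniq: "b = b'" if "a \<in> {u, w}" "e \<in> ?M a" "b \<in> L x" "b' \<in> L x" "cf e b" "cf e b'" for a e b b'
    using cf_inj[of a x e b b'] that U xlow adjC uw uC x resL by blast
  (* The lists of u and w have together more than d colours, so if every one of them conflicts with
     one of the d colours of x, then two of them conflict with the same one. *)
  have "\<exists>cu\<in>?M u. \<exists>cw\<in>?M w. \<exists>k. \<forall>b\<in>L x. cf cu b \<or> cf cw b \<longrightarrow> b = k"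
  proof -
    have big: "card (L x) < card (?M u) + card (?M w)"
      using Muw[of u] Muw[of w] poorK[OF uw(1) uC(1)] poorK[OF uw(2) uC(2)] piecesD(4)[OF C x] xlow
      by simp
    have ne: "?M u \<noteq> {}" "?M w \<noteq> {}"
      using Muw[of u] Muw[of w] poorK[OF uw(1) uC(1)] poorK[OF uw(2) uC(2)] piecesD(4)[OF C x] d3
      by (auto intro: ccontr)
    consider cu where "cu \<in> ?M u" "\<forall>b\<in>L x. \<not> cf cu b" | cw where "cw \<in> ?M w" "\<forall>b\<in>L x. \<not> cf cw b"
      | "\<forall>c\<in>?M u. \<exists>b\<in>L x. cf c b" "\<forall>c\<in>?M w. \<exists>b\<in>L x. cf c b" by blast
    then show ?thesis
    proof cases
      case 1
      obtain cw where cw: "cw \<in> ?M w" using ne by blast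
      show ?thesis
      proof (intro bexI[OF _ cw] bexI[OF _ 1(1)] exI ballI impI)
        fix b assume b: "b \<in> L x" "cf cu b \<or> cf cw b"
        then have "cf cw b" using 1 by blast
        then have "(SOME b. b \<in> L x \<and> cf cw b) \<in> L x \<and> cf cw (SOME b. b \<in> L x \<and> cf cw b)"
          using b by (intro someI) blast
        then show "b = (SOME b. b \<in> L x \<and> cf cw b)" using uniq[of w cw] cw b \<open>cf cw b\<close> by blast
      qed
    next
      case 2
      obtain cu where cu: "cu \<in> ?M u" using ne by blast
      show ?thesis
      proof (intro bexI[OF _ cu] bexI[OF _ 2(1)] exI ballI impI)
        fix b assume b: "b \<in> L x" "cf cu b \<or> cf cw b"
        then have "cf cu b" using 2 by blast
        then have "(SOME b. b \<in> L x \<and> cf cu b) \<in> L x \<and> cf cu (SOME b. b \<in> L x \<and> cf cu b)"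
          using b by (intro someI) blast
        then show "b = (SOME b. b \<in> L x \<and> cf cu b)" using uniq[of u cu] cu b \<open>cf cu b\<close> by blast
      qed
    next
      case 3
      then obtain ku kw where k: "\<And>c. c \<in> ?M u \<Longrightarrow> ku c \<in> L x \<and> cf c (ku c)"
        "\<And>c. c \<in> ?M w \<Longrightarrow> kw c \<in> L x \<and> cf c (kw c)" by metis
      have inj: "inj_on k (?M a)" if a: "a \<in> {u, w}" and k: "\<And>c. c \<in> ?M a \<Longrightarrow> k c \<in> L x \<and> cf c (k c)" for a k
      proof (rule inj_onI)
        fix e e' assume e: "e \<in> ?M a" "e' \<in> ?M a" "k e = k e'"
        have "adj x a" using adjC a uw uC x adj_sym by blast
        then show "e = e'"
          using cf_inj[of x a "k e" e e'] k[OF e(1)] k[OF e(2)] e resL cf_sym xlow U a by (metis UnI1 subset_eq)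
      qed
      have "ku ` ?M u \<inter> kw ` ?M w \<noteq> {}"
      proof
        assume dis: "ku ` ?M u \<inter> kw ` ?M w = {}"
        have fin: "finite (L x)" using finL xlow by blast
        have sub: "ku ` ?M u \<union> kw ` ?M w \<subseteq> L x" using k by blast
        then have "finite (ku ` ?M u)" "finite (kw ` ?M w)" using fin finite_subset by blast+
        then have "card (ku ` ?M u) + card (kw ` ?M w) = card (ku ` ?M u \<union> kw ` ?M w)"
          using dis by (simp add: card_Un_disjoint)
        also have "\<dots> \<le> card (L x)" using sub fin by (intro card_mono)
        finally show False using big card_image[OF inj[of u ku]] card_image[OF inj[of w kw]] k by simp
      qed
      then obtain cu cw where c: "cu \<in> ?M u" "cw \<in> ?M w" "ku cu = kw cw" by blast
      show ?thesis
      proof (intro bexI[OF _ c(2)] bexI[OF _ c(1)] exI ballI impI)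
        fix b assume b: "b \<in> L x" "cf cu b \<or> cf cw b"
        have "ku cu \<in> L x" "cf cu (ku cu)" "cf cw (ku cu)"
          using k(1)[OF c(1)] k(2)[OF c(2)] unfolding c(3) by blast+
        then show "b = ku cu"
          using uniq[of u cu b "ku cu"] uniq[of w cw b "ku cu"] c b by blast
      qed
    qed
  qed
  then obtain cu cw k where c: "cu \<in> ?M u" "cw \<in> ?M w" and k: "\<And>b. b \<in> L x \<Longrightarrow> cf cu b \<or> cf cw b \<Longrightarrow> b = k"
    by blast
  let ?g = "\<lambda>v. if v = u then cu else cw"
  have g: "prop_col {u, w} ?M ?g"
    using c uw adj_irrefl adj_sym by (auto simp: proper_def)
  let ?N = "res {u, w} ?M ?g"
  have NL: "?N v \<subseteq> L v" for v using res_subset res_subset by (rule order_trans)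
  have Mcard: "card C + 1 \<le> card (?M v)" if "v \<in> C" for v
    using card_res_excess[OF U f(1), of v] excess_low[of v] that CV dU[of v] dg_clique[OF cl that finC] duw[OF that] by auto
  have N2: "dg C v \<le> card (?N v)" if "v \<in> C" for v
  proof -
    have "card (?M v) \<le> card (?N v) + dg {u, w} v"
      by (rule card_residual) (use that U CV resL c in auto)
    then show ?thesis using Mcard[OF that] duw[OF that] dg_clique[OF cl that finC] by simp
  qed
  have "?M x - {k} \<subseteq> ?N x"
  proof
    fix b assume b: "b \<in> ?M x - {k}"
    then have "b \<in> L x" using resL by blast
    then have "\<not> cf cu b" "\<not> cf cw b" using k b by blast+
    then have "\<forall>a\<in>{u, w}. \<not> cf (?g a) b" by simp
    then show "b \<in> ?N x" using b unfolding residual_def by blast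
  qed
  moreover have "finite (?N x)" using NL[of x] finL[OF xlow(1)] finite_subset by blast
  ultimately have "card (?M x - {k}) \<le> card (?N x)" by (intro card_mono)
  moreover have "card (?M x) \<le> Suc (card (?M x - {k}))"
  proof -
    have "finite (?M x)" using resL[of x] finL[OF xlow(1)] finite_subset by blast
    then show ?thesis by (cases "k \<in> ?M x") simp_all
  qed
  moreover have "0 < card C" using finC x by (auto simp: card_gt_0_iff)
  ultimately have "dg C x < card (?N x)"
    using Mcard[OF x] dg_clique[OF cl x finC] by linarith
  then have "colorable C ?N"
    using greedy[OF CV(1) conn_clique[OF cl] NL N2 x] x by auto
  then have "colorable ({u, w} \<union> C) ?M"
    using colorable_union[OF g] uC by auto
  then show False using f by simp
qed

end

context critical_cover begin

text \<open>
  Each vertex of a piece singles out one high neighbour, to which it is counted when high vertices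
  are discarded in \<open>select\<close>.
\<close>

definition partner :: "'a \<Rightarrow> 'a" where
  "partner x = (SOME y. y \<in> V - low \<and> adj x y \<and> (d \<le> 9 * excess y \<or> (\<exists>x'\<in>twins low x. \<not> adj y x')))"

lemma partner:
  assumes "C \<in> pieces" "x \<in> C"
  shows "partner x \<in> V - low" "adj x (partner x)" "d \<le> 9 * excess (partner x) \<or> (\<exists>x'\<in>C. \<not> adj (partner x) x')"
proof -
  have "C = twins low x" using piecesD(1)[OF assms] .
  then have "\<exists>y. y \<in> V - low \<and> adj x y \<and> (d \<le> 9 * excess y \<or> (\<exists>x'\<in>twins low x. \<not> adj y x'))"
    using rich_or_partial_neighbour[OF assms] by blast
  from someI_ex[OF this] show "partner x \<in> V - low" "adj x (partner x)"
    "d \<le> 9 * excess (partner x) \<or> (\<exists>x'\<in>C. \<not> adj (partner x) x')"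
    using \<open>C = twins low x\<close> unfolding partner_def by auto
qed

definition partial :: "'a \<Rightarrow> 'a set \<Rightarrow> bool" where
  "partial y C \<longleftrightarrow> (\<exists>x\<in>C. adj y x) \<and> (\<exists>x\<in>C. \<not> adj y x)"

lemma dg_pieces: "A \<subseteq> pieces \<Longrightarrow> dg (\<Union>A) y = (\<Sum>C\<in>A. dg C y)"
proof -
  assume A: "A \<subseteq> pieces"
  have "nb (\<Union>A) y = (\<Union>C\<in>A. nb C y)" by (auto simp: nb_def)
  moreover have "card (\<Union>C\<in>A. nb C y) = (\<Sum>C\<in>A. card (nb C y))"
  proof (rule card_UN_disjoint)
    show "finite A" using A finite_pieces finite_subset by blast
    show "\<forall>C\<in>A. finite (nb C y)" using A finite_pieces(2) by (auto intro!: finite_nb)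
    show "\<forall>C\<in>A. \<forall>C'\<in>A. C \<noteq> C' \<longrightarrow> nb C y \<inter> nb C' y = {}"
    proof (intro ballI impI equals0I)
      fix C C' x assume "C \<in> A" "C' \<in> A" "C \<noteq> C'" "x \<in> nb C y \<inter> nb C' y"
      then show False using A pieces_disjoint[of C C' x] by (auto simp: nb_def)
    qed
  qed
  ultimately show ?thesis by (simp add: dg_def)
qed

text \<open>
  Each piece \<open>C\<close> earns the number of its vertices with partner in \<open>S\<close> beyond the threshold \<open>t\<close>, and each
  vertex of \<open>S\<close> costs ten times its excess. For a set \<open>S\<close> maximizing the balance \<open>\<Psi>\<close>, discarding
  a vertex with fewer than ten times its excess of neighbours in the earning pieces would be
  profitable. The threshold exceeds the number of vertices of a piece that a single partial neighbour of
  small excess can be the partner of, so an earning piece has two of them. Vertices of excess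
  at least \<open>d/9\<close> are never admitted: their degree is at most ten times their excess, so
  they cannot be the partners of too many vertices.
\<close>

lemma select:
  assumes mass: "10 * (\<Sum>y\<in>V - low. real (excess y)) < (\<Sum>C\<in>pieces. real (card C) - (real d / 9 + 1))"
  shows "\<exists>S A. S \<subseteq> V - low \<and> (\<forall>y\<in>S. 9 * excess y < d) \<and> A \<subseteq> pieces \<and> A \<noteq> {} \<and>
    (\<forall>y\<in>S. 10 * excess y \<le> dg (\<Union>A) y) \<and>
    (\<forall>C\<in>A. \<exists>z\<in>S. \<exists>z'\<in>S. z \<noteq> z' \<and> partial z C \<and> partial z' C)"
proof -
  let ?Y = "V - low"
  define t where "t = real d / 9 + 1"
  define S0 where "S0 = {y \<in> ?Y. 9 * excess y < d}"
  define h where "h S C = card {x \<in> C. partner x \<in> S}" for S C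
  define \<phi> where "\<phi> S C = max 0 (real (h S C) - t)" for S C
  define \<Psi> where "\<Psi> S = (\<Sum>C\<in>pieces. \<phi> S C) - 10 * (\<Sum>y\<in>S. real (excess y))" for S
  have fY: "finite ?Y" "finite S0" using finV by (auto simp: S0_def)
  have finC: "finite C" if "C \<in> pieces" for C using finite_pieces that by blast
  have ne: "Pow S0 \<noteq> {}" "finite (Pow S0)" using fY by auto
  define S where "S = (SOME S. S \<in> Pow S0 \<and> (\<forall>S'\<in>Pow S0. \<Psi> S' \<le> \<Psi> S))"
  have "\<exists>S. S \<in> Pow S0 \<and> (\<forall>S'\<in>Pow S0. \<Psi> S' \<le> \<Psi> S)"
  proof -
    have "Max (\<Psi> ` Pow S0) \<in> \<Psi> ` Pow S0" using ne by (intro Max_in) auto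
    then obtain S where "S \<in> Pow S0" "\<Psi> S = Max (\<Psi> ` Pow S0)" by force
    then show ?thesis using ne by (metis Max_ge finite_imageI imageI)
  qed
  from someI_ex[OF this] have S: "S \<subseteq> S0" and max: "\<And>S'. S' \<subseteq> S0 \<Longrightarrow> \<Psi> S' \<le> \<Psi> S"
    unfolding S_def by auto
  define A where "A = {C \<in> pieces. t < real (h S C)}"
  have fA: "finite A" "A \<subseteq> pieces" using finite_pieces by (auto simp: A_def)
  have fS: "finite S" using S fY finite_subset by blast
  have "\<Psi> S0 > 0"
  proof -
    have split: "real (card C) = real (h S0 C) + (\<Sum>y\<in>?Y - S0. real (card {x \<in> C. partner x = y}))"
      if C: "C \<in> pieces" for C
    proof -
      have "C = {x \<in> C. partner x \<in> S0} \<union> (\<Union>y\<in>?Y - S0. {x \<in> C. partner x = y})"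
        using partner(1)[OF C] by auto
      then have "card C = card ({x \<in> C. partner x \<in> S0} \<union> (\<Union>y\<in>?Y - S0. {x \<in> C. partner x = y}))"
        by simp
      also have "\<dots> = h S0 C + card (\<Union>y\<in>?Y - S0. {x \<in> C. partner x = y})"
        unfolding h_def using finC[OF C] fY by (intro card_Un_disjoint) auto
      also have "card (\<Union>y\<in>?Y - S0. {x \<in> C. partner x = y}) = (\<Sum>y\<in>?Y - S0. card {x \<in> C. partner x = y})"
        using finC[OF C] fY by (intro card_UN_disjoint) auto
      finally show ?thesis by simp
    qed
    have rich: "(\<Sum>C\<in>pieces. real (card {x \<in> C. partner x = y})) \<le> 10 * real (excess y)" if y: "y \<in> ?Y - S0" for y
    proof -
      have "(\<Sum>C\<in>pieces. card {x \<in> C. partner x = y}) \<le> (\<Sum>C\<in>pieces. dg C y)"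
      proof (rule sum_mono)
        fix C assume C: "C \<in> pieces"
        show "card {x \<in> C. partner x = y} \<le> dg C y"
          unfolding dg_def nb_def using partner(2)[OF C] finC[OF C] adj_sym by (intro card_mono) auto
      qed
      also have "\<dots> = dg (\<Union>pieces) y" by (simp add: dg_pieces)
      also have "\<dots> \<le> dg V y" using finV pieceV by (intro dg_mono) auto
      also have "\<dots> = d + excess y" using dg_excess y by simp
      also have "\<dots> \<le> 10 * excess y" using y by (auto simp: S0_def)
      finally show ?thesis by (simp flip: of_nat_sum)
    qed
    have "(\<Sum>C\<in>pieces. real (card C) - t)
        = (\<Sum>C\<in>pieces. real (h S0 C) - t) + (\<Sum>C\<in>pieces. \<Sum>y\<in>?Y - S0. real (card {x \<in> C. partner x = y}))"
      by (simp add: split sum.distrib[symmetric] algebra_simps)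
    also have "(\<Sum>C\<in>pieces. \<Sum>y\<in>?Y - S0. real (card {x \<in> C. partner x = y}))
        = (\<Sum>y\<in>?Y - S0. \<Sum>C\<in>pieces. real (card {x \<in> C. partner x = y}))"
      by (rule sum.swap)
    also have "\<dots> \<le> (\<Sum>y\<in>?Y - S0. 10 * real (excess y))" using rich by (intro sum_mono)
    also have "(\<Sum>C\<in>pieces. real (h S0 C) - t) \<le> (\<Sum>C\<in>pieces. \<phi> S0 C)"
      by (intro sum_mono) (simp add: \<phi>_def)
    finally have "(\<Sum>C\<in>pieces. real (card C) - t) \<le> (\<Sum>C\<in>pieces. \<phi> S0 C) + 10 * (\<Sum>y\<in>?Y - S0. real (excess y))"
      by (simp add: sum_distrib_left)
    moreover have "(\<Sum>y\<in>?Y. real (excess y)) = (\<Sum>y\<in>?Y - S0. real (excess y)) + (\<Sum>y\<in>S0. real (excess y))"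
      using fY by (intro sum.subset_diff) (auto simp: S0_def)
    ultimately show ?thesis using mass by (simp add: \<Psi>_def t_def)
  qed
  then have pos: "\<Psi> S > 0" using max[of S0] by auto
  have "A \<noteq> {}"
  proof
    assume "A = {}"
    then have "(\<Sum>C\<in>pieces. \<phi> S C) \<le> 0" by (intro sum_nonpos) (force simp: A_def \<phi>_def)
    moreover have "0 \<le> (\<Sum>y\<in>S. real (excess y))" by (intro sum_nonneg) auto
    ultimately show False using pos by (simp add: \<Psi>_def)
  qed
  moreover have "10 * excess y \<le> dg (\<Union>A) y" if y: "y \<in> S" for y
  proof -
    have sumS: "(\<Sum>y\<in>S. real (excess y)) = real (excess y) + (\<Sum>y\<in>S - {y}. real (excess y))"
      using y fS by (intro sum.remove)
    have diff: "\<phi> S C \<le> \<phi> (S - {y}) C + (if C \<in> A then real (dg C y) else 0)" if C: "C \<in> pieces" for C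
    proof (cases "C \<in> A")
      case False
      then show ?thesis using C by (simp add: A_def \<phi>_def)
    next
      case True
      have "{x \<in> C. partner x \<in> S} \<subseteq> {x \<in> C. partner x \<in> S - {y}} \<union> nb C y"
        using partner(2)[OF C] adj_sym by (auto simp: nb_def)
      then have "h S C \<le> card ({x \<in> C. partner x \<in> S - {y}} \<union> nb C y)"
        unfolding h_def using finC[OF C] by (intro card_mono) auto
      also have "\<dots> \<le> h (S - {y}) C + dg C y" unfolding h_def dg_def by (rule card_Un_le)
      finally show ?thesis using True by (simp add: \<phi>_def)
    qed
    have "(\<Sum>C\<in>pieces. \<phi> S C) \<le> (\<Sum>C\<in>pieces. \<phi> (S - {y}) C) + (\<Sum>C\<in>pieces. if C \<in> A then real (dg C y) else 0)"
      unfolding sum.distrib[symmetric] using diff by (intro sum_mono)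
    also have "(\<Sum>C\<in>pieces. if C \<in> A then real (dg C y) else 0) = (\<Sum>C\<in>A. real (dg C y))"
      using finite_pieces fA by (simp add: sum.If_cases Int_absorb1)
    also have "\<dots> = real (dg (\<Union>A) y)" using fA by (simp add: dg_pieces)
    finally have "\<Psi> S \<le> \<Psi> (S - {y}) + real (dg (\<Union>A) y) - 10 * real (excess y)"
      using sumS by (simp add: \<Psi>_def)
    moreover have "\<Psi> (S - {y}) \<le> \<Psi> S" using S by (intro max) auto
    ultimately show ?thesis by linarith
  qed
  moreover have "\<exists>z\<in>S. \<exists>z'\<in>S. z \<noteq> z' \<and> partial z C \<and> partial z' C" if C: "C \<in> A" for C
  proof -
    have Cp: "C \<in> pieces" using C fA by auto
    have part: "partial (partner x) C" if x: "x \<in> C" "partner x \<in> S" for x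
    proof -
      have "9 * excess (partner x) < d" using x S by (auto simp: S0_def)
      then show ?thesis using partner(2,3)[OF Cp x(1)] x adj_sym by (auto simp: partial_def)
    qed
    have th: "t < real (h S C)" using C by (simp add: A_def)
    then have "h S C \<noteq> 0" by (auto simp: t_def)
    then have "{x \<in> C. partner x \<in> S} \<noteq> {}" unfolding h_def by (metis card.empty)
    then obtain x where x: "x \<in> C" "partner x \<in> S" by blast
    have "\<exists>x'\<in>C. partner x' \<in> S \<and> partner x' \<noteq> partner x"
    proof (rule ccontr)
      assume n: "\<not> ?thesis"
      obtain w where w: "w \<in> C" "\<not> adj (partner x) w" using part[OF x] by (auto simp: partial_def)
      have "{x' \<in> C. partner x' \<in> S} \<subseteq> nb C (partner x)"
      proof
        fix x' assume x': "x' \<in> {x' \<in> C. partner x' \<in> S}"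
        then have "partner x' = partner x" using n by blast
        then show "x' \<in> nb C (partner x)" using partner(2)[OF Cp, of x'] x' adj_sym by (auto simp: nb_def)
      qed
      then have "h S C \<le> dg C (partner x)"
        unfolding h_def dg_def using finC[OF Cp] by (intro card_mono) auto
      also have "\<dots> \<le> excess (partner x) + 1"
        using few_neighbours[OF Cp partner(1)[OF Cp x(1)] x(1) _ w] partner(2)[OF Cp x(1)] adj_sym by blast
      finally have "real (h S C) \<le> t"
        using x S by (auto simp: S0_def t_def)
      then show False using th by simp
    qed
    then show ?thesis using x part by metis
  qed
  moreover have "S \<subseteq> V - low \<and> (\<forall>y\<in>S. 9 * excess y < d)" using S by (auto simp: S0_def)
  ultimately show ?thesis using fA(2) by (intro exI[of _ S] exI[of _ A]) blast
qed

end

section \<open>Failing pieces determine colours\<close>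

context cover begin

lemma res_cong: "(\<And>w. w \<in> W \<Longrightarrow> adj v w \<Longrightarrow> f w = g w) \<Longrightarrow> res W M f v = res W M g v"
  by (auto simp: residual_def)

lemma res_res: "res Y (res W M f) f v = res (W \<union> Y) M f v"
  by (auto simp: residual_def)

lemma colorable_cong: "(\<And>v. v \<in> X \<Longrightarrow> M v = N v) \<Longrightarrow> colorable X M \<longleftrightarrow> colorable X N"
  unfolding colorable_def proper_def by simp

text \<open>
  If the clique \<open>C\<close> cannot be finished after \<open>g\<close>, all remaining lists are determined by the one of
  the vertex \<open>z\<close>. Given the colours outside \<open>{a, b}\<close>, both of whose members miss \<open>z\<close>, the colours
  of \<open>a\<close> and \<open>b\<close> must delete prescribed sets of at most two colours, which leaves two
  possibilities.
\<close>

lemma card_bad_pair: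
  assumes C: "C \<subseteq> V" "clique C" and X: "X \<subseteq> V" "X \<inter> C = {}" and ab: "a \<in> X" "b \<in> X" "a \<noteq> b"
    and z: "z \<in> C" "\<not> adj z a" "\<not> adj z b" and xa: "xa \<in> C" "adj xa a" and xb: "xb \<in> C" "adj xb b"
    and M: "\<And>v. M v \<subseteq> L v" "\<And>x. x \<in> C \<Longrightarrow> card C - 1 + dg X x \<le> card (M x)"
    and G: "\<And>g. g \<in> G \<Longrightarrow> g \<in> Pi\<^sub>E X M" "\<And>g. g \<in> G \<Longrightarrow> \<not> colorable C (res X M g)"
    and agree: "\<And>g g' w. g \<in> G \<Longrightarrow> g' \<in> G \<Longrightarrow> w \<in> X - {a, b} \<Longrightarrow> g w = g' w"
  shows "card G \<le> 2"
proof (cases "G = {}")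
  case False
  then obtain g0 where g0: "g0 \<in> G" by blast
  have finX: "finite X" using X finV finite_subset by blast
  have GM: "g w \<in> M w" if "g \<in> G" "w \<in> X" for g w
    by (rule PiE_mem[OF G(1)[OF that(1)] that(2)])
  have GL: "g w \<in> L w" if "g \<in> G" "w \<in> X" for g w
    using subsetD[OF M(1) GM[OF that]] .
  have resL: "res Y M g v \<subseteq> L v" for Y g v
    using subset_trans[OF res_subset[of Y M g v] M(1)[of v]] .
  have fin: "finite (res Y M g v)" if "v \<in> V" for Y g v
    using finite_subset[OF resL finL[OF that]] .
  have N: "card C - 1 \<le> card (res X M g x)" if "g \<in> G" "x \<in> C" for g x
  proof -
    have "x \<in> V" using that C by blast
    then have "card (M x) \<le> card (res X M g x) + dg X x"
      by (rule card_residual[OF X(1) _ M(1) GL[OF that(1)]])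
    then show ?thesis using M(2)[OF that(2)] by simp
  qed
  have zsame: "res X M g z = res X M g' z" if "g \<in> G" "g' \<in> G" for g g'
    by (rule res_cong) (use agree[OF that] z in auto)
  have det: "card (res X M g x) = card C - 1 \<and> res X M g x = {c \<in> L x. \<exists>c'\<in>res X M g z. cf c' c}"
    if "g \<in> G" "x \<in> C" "x \<noteq> z" for g x
    using clique_lists[OF C resL N[OF that(1)] G(2)[OF that(1)] that(2) z(1) that(3)] by blast
  have same: "res X M g x = res X M g' x" if "g \<in> G" "g' \<in> G" "x \<in> C" for g g' x
    using det[OF that(1,3)] det[OF that(2,3)] zsame[OF that(1,2)] by (cases "x = z") auto
  have kill: "\<exists>k\<in>res (X - {e}) M g x - res X M g x. cf (g e) k"
    if "g \<in> G" "e \<in> X" "x \<in> C" "x \<noteq> z" "adj x e" for g e x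
  proof -
    have "dg X x = dg (X - {e}) x + dg {e} x"
      using dg_union[of "X - {e}" "{e}" x] finX that(2) by (simp add: insert_absorb)
    moreover have "dg {e} x > 0" using that by (intro dg_pos[of _ e]) auto
    moreover have "card (M x) \<le> card (res (X - {e}) M g x) + dg (X - {e}) x"
    proof (rule card_residual)
      show "X - {e} \<subseteq> V" "x \<in> V" using X C that by auto
      show "g w \<in> L w" if "w \<in> X - {e}" for w using GL[OF \<open>g \<in> G\<close>] that by blast
    qed (rule M(1))
    moreover have "card (res X M g x) = card C - 1" using det that by blast
    ultimately have "card (res X M g x) < card (res (X - {e}) M g x)" using M(2)[OF that(3)] by simp
    moreover have "x \<in> V" using that C by blast
    ultimately have "\<not> res (X - {e}) M g x \<subseteq> res X M g x"
      using card_mono[OF fin] by (meson not_le)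
    then obtain k where k: "k \<in> res (X - {e}) M g x" "k \<notin> res X M g x" by blast
    then have "cf (g e) k" unfolding residual_def by blast
    then show ?thesis using k by (intro bexI[of _ k]) auto
  qed
  have xz: "xa \<noteq> z" "xb \<noteq> z" using xa xb z by auto
  have V: "xa \<in> V" "xb \<in> V" "a \<in> V" "b \<in> V" using xa xb C ab X by auto
  have inj: "g = g'" if g: "g \<in> G" "g' \<in> G" "g a = g' a" for g g'
  proof -
    obtain k where k: "k \<in> res (X - {b}) M g xb" "k \<notin> res X M g xb" "cf (g b) k"
      using kill[OF g(1) ab(2) xb(1) xz(2) xb(2)] by blast
    have "res (X - {b}) M g xb = res (X - {b}) M g' xb"
    proof (rule res_cong)
      fix w assume "w \<in> X - {b}"
      then show "g w = g' w" using agree[OF g(1,2), of w] g(3) by (cases "w = a") auto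
    qed
    then have "k \<in> res (X - {b}) M g' xb" "k \<notin> res X M g' xb" using k same[OF g(1,2) xb(1)] by auto
    then have "cf (g' b) k" unfolding residual_def by blast
    then have "g b = g' b"
      using cf_inj[OF V(2,4) xb(2), of k "g b" "g' b"] k resL GL g ab cf_sym by blast
    then have eq: "g w = g' w" if "w \<in> X" for w
      using agree[OF g(1,2), of w] g(3) that by blast
    show ?thesis by (rule PiE_ext[OF G(1)[OF g(1)] G(1)[OF g(2)] eq])
  qed
  let ?P = "res (X - {a, b}) M g0 xa" and ?N = "res X M g0 xa"
  have "card ?P \<le> card (res {a, b} (res (X - {a, b}) M g0) g0 xa) + dg {a, b} xa"
  proof (rule card_residual)
    show "{a, b} \<subseteq> V" using V by blast
    show "g0 w \<in> L w" if "w \<in> {a, b}" for w using GL[OF g0, of w] that ab by blast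
  qed (rule V resL)+
  also have "res {a, b} (res (X - {a, b}) M g0) g0 xa = ?N"
  proof -
    have "X - {a, b} \<union> {a, b} = X" using ab by auto
    then show ?thesis by (simp only: res_res)
  qed
  also have "dg {a, b} xa \<le> card {a, b}" unfolding dg_def nb_def by (intro card_mono) auto
  finally have "card ?P \<le> card ?N + 2" using ab by simp
  moreover have "?N \<subseteq> ?P" by (auto simp: residual_def)
  ultimately have K: "card (?P - ?N) \<le> 2" using fin[OF V(1)] by (simp add: card_Diff_subset)
  have "\<exists>k\<in>?P - ?N. cf (g a) k" if g: "g \<in> G" for g
  proof -
    obtain k where k: "k \<in> res (X - {a}) M g xa" "k \<notin> res X M g xa" "cf (g a) k"
      using kill[OF g ab(1) xa(1) xz(1) xa(2)] by blast
    have "k \<in> res (X - {a, b}) M g xa" using k(1) unfolding residual_def by blast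
    also have "res (X - {a, b}) M g xa = ?P" using agree[OF g g0] by (intro res_cong) auto
    finally show ?thesis using k same[OF g g0 xa(1)] by blast
  qed
  then obtain \<kappa> where \<kappa>: "\<And>g. g \<in> G \<Longrightarrow> \<kappa> g \<in> ?P - ?N \<and> cf (g a) (\<kappa> g)" by metis
  have "inj_on \<kappa> G"
  proof (rule inj_onI)
    fix g g' assume g: "g \<in> G" "g' \<in> G" "\<kappa> g = \<kappa> g'"
    have "\<kappa> g \<in> L xa" using \<kappa>[OF g(1)] resL by blast
    then have "g a = g' a"
      using cf_inj[OF V(1,3) xa(2), of "\<kappa> g" "g a" "g' a"] \<kappa>[OF g(1)] \<kappa>[OF g(2)] g GL ab cf_sym by metis
    then show "g = g'" using inj g by blast
  qed
  then have "card G \<le> card (?P - ?N)"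
    using \<kappa> fin[OF V(1)] by (intro card_inj_on_le[of \<kappa>]) auto
  then show ?thesis using K by simp
qed simp

end

lemma card_le_fibres:
  assumes "finite B" "\<pi> ` A \<subseteq> B" "\<And>b. b \<in> B \<Longrightarrow> card {a \<in> A. \<pi> a = b} \<le> k"
  shows "card A \<le> k * card B"
proof (cases "finite A")
  case True
  have "A = (\<Union>b\<in>B. {a \<in> A. \<pi> a = b})" using assms by auto
  then have "card A \<le> (\<Sum>b\<in>B. card {a \<in> A. \<pi> a = b})" using card_UN_le[OF assms(1)] by metis
  also have "\<dots> \<le> (\<Sum>b\<in>B. k)" using assms by (intro sum_mono)
  finally show ?thesis by (simp add: mult.commute)
qed simp

section \<open>Counting colourings\<close>

text \<open>
  The situation after \<open>select\<close>, with a colouring \<open>f\<close> of all vertices outside \<open>S\<close> and the selected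
  pieces.
\<close>

locale critical_core = critical_cover adj V L cf d
  for adj :: "'a \<Rightarrow> 'a \<Rightarrow> bool" and V and L :: "'a \<Rightarrow> 'b set" and cf and d +
  fixes S :: "'a set" and A :: "'a set set" and f :: "'a \<Rightarrow> 'b"
  assumes d24: "24 \<le> d"
    and S_high: "S \<subseteq> V - low"
    and S_poor: "y \<in> S \<Longrightarrow> 9 * excess y < d"
    and A_pieces: "A \<subseteq> pieces"
    and S_many: "y \<in> S \<Longrightarrow> 10 * excess y \<le> dg (\<Union>A) y"
    and A_two: "C \<in> A \<Longrightarrow> \<exists>z\<in>S. \<exists>z'\<in>S. z \<noteq> z' \<and> partial z C \<and> partial z' C"
    and f_rest: "prop_col (V - (S \<union> \<Union>A)) L f"
begin

abbreviation M :: "'a \<Rightarrow> 'b set" where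
  "M \<equiv> res (V - (S \<union> \<Union>A)) L f"

text \<open>
  Whether a piece can be finished is decided once these vertices are coloured.
\<close>

definition touch :: "'a set \<Rightarrow> 'a set" where
  "touch C = {y \<in> S. \<exists>x\<in>C. adj y x}"

definition good :: "'a set \<Rightarrow> ('a \<Rightarrow> 'b) set" where
  "good X = {g \<in> Pi\<^sub>E X M. prop_col X M g \<and> (\<forall>C\<in>A. touch C \<subseteq> X \<longrightarrow> colorable C (res X M g))}"

lemma SV: "S \<subseteq> V" "finite S"
  using S_high finV finite_subset by auto

lemma AV: "\<Union>A \<subseteq> V" "\<Union>A \<subseteq> low" "finite (\<Union>A)" "finite A"
proof -
  show "\<Union>A \<subseteq> V" using A_pieces pieceV by blast
  then show "finite (\<Union>A)" using finV finite_subset by blast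
  show "\<Union>A \<subseteq> low" using A_pieces piecesD(6) pieces_nonempty by blast
  show "finite A" using A_pieces finite_pieces finite_subset by blast
qed

lemma SA: "S \<inter> \<Union>A = {}"
  using S_high AV by blast

lemma C_facts:
  assumes "C \<in> A"
  shows "C \<in> pieces" "C \<subseteq> V" "clique C" "finite C" "2 * d \<le> 3 * card C" "C \<inter> S = {}"
proof -
  show C: "C \<in> pieces" using assms A_pieces by blast
  show "C \<subseteq> V" "clique C" "finite C" using C pieceV pieces_clique finite_pieces by auto
  show "2 * d \<le> 3 * card C" using C piecesD(4) pieces_nonempty by blast
  show "C \<inter> S = {}" using assms SA by blast
qed

lemma M_sub: "M v \<subseteq> L v"
  by (rule res_subset)

lemma M_fin: "v \<in> V \<Longrightarrow> finite (M v)"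
  using finite_subset[OF M_sub finL] .

lemma M_card: "v \<in> V \<Longrightarrow> dg S v + dg (\<Union>A) v \<le> card (M v) + excess v"
  using card_res_excess[OF _ f_rest, of v] dg_union[OF SV(2) AV(3) SA, of v] SV AV by auto

lemma M_card_piece:
  assumes "C \<in> A" "x \<in> C" "X \<subseteq> S"
  shows "card C - 1 + dg X x \<le> card (M x)"
proof -
  have "dg X x \<le> dg S x" using assms SV by (intro dg_mono) auto
  moreover have "dg C x \<le> dg (\<Union>A) x" using assms AV by (intro dg_mono) auto
  moreover have "dg C x = card C - 1" using C_facts[OF assms(1)] assms(2) by (intro dg_clique)
  moreover have "x \<in> V" "x \<in> low" using assms AV by auto
  ultimately show ?thesis using M_card[of x] excess_low[of x] by simp
qed

lemma partial_few:
  assumes "C \<in> A" "y \<in> S" "partial y C"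
  shows "9 * dg C y < d + 9"
proof -
  have "dg C y \<le> excess y + 1"
    using few_neighbours[of C y] C_facts[OF assms(1)] assms(2,3) S_high by (auto simp: partial_def)
  then show ?thesis using S_poor[OF assms(2)] by simp
qed

text \<open>
  The vertex obtained here is the one whose list determines all others in \<open>card_bad_pair\<close>.
\<close>

lemma partial_common_miss:
  assumes "C \<in> A" "y \<in> S" "partial y C" "z \<in> S" "partial z C"
  shows "\<exists>x\<in>C. \<not> adj x y \<and> \<not> adj x z"
proof (rule ccontr)
  assume "\<not> ?thesis"
  then have "C \<subseteq> nb C y \<union> nb C z" using adj_sym by (auto simp: nb_def)
  then have "card C \<le> card (nb C y \<union> nb C z)" using C_facts[OF assms(1)] by (intro card_mono) auto
  also have "\<dots> \<le> dg C y + dg C z" unfolding dg_def by (rule card_Un_le)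
  finally show False
    using partial_few[OF assms(1-3)] partial_few[OF assms(1,4,5)] C_facts(5)[OF assms(1)] d24 by linarith
qed

lemma finite_good: "X \<subseteq> S \<Longrightarrow> finite (good X)"
proof -
  assume X: "X \<subseteq> S"
  have "finite (Pi\<^sub>E X M)" using X SV M_fin finite_subset by (intro finite_PiE) blast+
  then show ?thesis by (rule rev_finite_subset) (auto simp: good_def)
qed

lemma res_restrict:
  assumes "C \<in> A" "x \<in> C" "touch C \<subseteq> Y" "Y \<subseteq> X" "X \<subseteq> S"
  shows "res Y M (restrict g Y) x = res X M g x"
proof -
  have "w \<in> Y" if "w \<in> X" "adj x w" for w
  proof -
    have "w \<in> touch C" unfolding touch_def using that assms(2,5) adj_sym by blast
    then show ?thesis using assms(3) by blast
  qed
  then show ?thesis using assms(4) by (auto simp: residual_def)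
qed

lemma restrict_good:
  assumes g: "g \<in> Pi\<^sub>E X M" "prop_col X M g" and Y: "Y \<subseteq> X" "X \<subseteq> S"
    and C: "\<And>C. C \<in> A \<Longrightarrow> touch C \<subseteq> Y \<Longrightarrow> colorable C (res X M g)"
  shows "restrict g Y \<in> good Y"
  unfolding good_def
proof (intro CollectI conjI ballI impI)
  show "restrict g Y \<in> Pi\<^sub>E Y M" using g Y by (auto simp: PiE_def Pi_def)
  have "prop_col Y M g" using proper_mono[OF g(2) Y(1)] .
  then show "prop_col Y M (restrict g Y)" using proper_cong[of Y "restrict g Y" g M] by simp
  fix C assume "C \<in> A" "touch C \<subseteq> Y"
  then show "colorable C (res Y M (restrict g Y))"
    using C colorable_cong[of C "res Y M (restrict g Y)" "res X M g"] res_restrict[OF \<open>C \<in> A\<close> _ _ Y] by blast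
qed

text \<open>
  Each good colouring of \<open>X\<close> has many proper extensions to \<open>v\<close>, namely at least the number of
  neighbours of \<open>v\<close> in the pieces minus its excess. An extension destroying a piece \<open>C\<close> is
  determined, up to two choices, by its restriction to the complement of two partial neighbours
  of \<open>C\<close>, and by induction there are correspondingly fewer such restrictions. One of the two may
  be \<open>v\<close> itself unless \<open>v\<close> is adjacent to all of \<open>C\<close>; since \<open>C\<close> fills more than half of the
  neighbourhood of such a \<open>v\<close>, that happens for one piece only.
\<close>

lemma good_extensions:
  assumes "X \<subseteq> S" "v \<in> S - X"
  shows "4 * card (good X) \<le> card (good (insert v X))"
  using assms
proof (induction "card X" arbitrary: X v rule: less_induct)
  case less
  let ?X = "insert v X"
  have X: "X \<subseteq> S" "?X \<subseteq> S" "v \<notin> X" "v \<in> S" "v \<in> V" using less.prems SV by auto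
  have fX: "finite X" "X \<subseteq> V" "?X \<subseteq> V" using X SV finite_subset by auto
  have IH: "4 * card (good (Y - {z})) \<le> card (good Y)" if "z \<in> Y" "Y \<subseteq> X" for Y z
  proof -
    have "finite Y" using that fX finite_subset by blast
    then have "card (Y - {z}) < card Y" using that by (intro psubset_card_mono) auto
    also have "\<dots> \<le> card X" using that fX by (intro card_mono)
    finally have "4 * card (good (Y - {z})) \<le> card (good (insert z (Y - {z})))"
      using that X by (intro less.hyps) auto
    then show ?thesis using that by (simp add: insert_absorb)
  qed
  (* E: proper extensions to v of good colourings; T: pieces that become fully touched with v *)
  define E where "E = (\<lambda>(h, c). h(v := c)) ` (SIGMA h : good X. res X M h v)"
  have hX: "h \<in> Pi\<^sub>E X M" "prop_col X M h" if "h \<in> good X" for h using that by (auto simp: good_def)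
  have finRes: "finite (res X M h v)" for h
    using finite_subset[OF res_subset[of X M h v] M_fin[OF X(5)]] .
  have finE: "finite E"
    unfolding E_def using finite_good[OF X(1)] finRes by (intro finite_imageI finite_SigmaI) auto
  have E: "g \<in> Pi\<^sub>E ?X M" "prop_col ?X M g" "restrict g X \<in> good X" if gE: "g \<in> E" for g
  proof -
    obtain h c where hc: "h \<in> good X" "c \<in> res X M h v" "g = h(v := c)"
      using gE unfolding E_def by force
    have c: "c \<in> M v" using hc(2) res_subset by blast
    show "g \<in> Pi\<^sub>E ?X M" unfolding hc(3) by (rule PiE_fun_upd[where S = X, OF c hX(1)[OF hc(1)]])
    have "prop_col {v} (res X M h) (\<lambda>_. c)" using proper_singleton hc(2) .
    from proper_union[OF hX(2)[OF hc(1)] this]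
    have "prop_col (X \<union> {v}) M (\<lambda>u. if u \<in> {v} then c else h u)" using X by auto
    moreover have "(\<lambda>u. if u \<in> {v} then c else h u) = g" using hc(3) by auto
    ultimately show "prop_col ?X M g" by simp
    have "restrict g X = restrict h X" unfolding hc(3) using X(3) by (auto simp: restrict_def fun_eq_iff)
    also have "\<dots> = h" using PiE_restrict[OF hX(1)[OF hc(1)]] .
    finally show "restrict g X \<in> good X" using hc by simp
  qed
  let ?p = "dg (\<Union>A) v"
  have cE: "?p * card (good X) \<le> card E + excess v * card (good X)"
  proof -
    have inj: "inj_on (\<lambda>(h, c). h(v := c)) (SIGMA h : good X. res X M h v)"
    proof (rule inj_onI, clarify)
      fix h c h' c'
      assume h: "h \<in> good X" "h' \<in> good X" and eq: "h(v := c) = h'(v := c')"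
      have "h u = h' u" for u
      proof (cases "u = v")
        case True
        then show ?thesis using hX(1)[OF h(1)] hX(1)[OF h(2)] X by (auto simp: PiE_def extensional_def)
      next
        case False then show ?thesis using fun_cong[OF eq, of u] by simp
      qed
      then show "h = h' \<and> c = c'" using fun_cong[OF eq, of v] by auto
    qed
    have "card E = (\<Sum>h\<in>good X. card (res X M h v))"
      unfolding E_def using card_image[OF inj] finite_good[OF X(1)] finRes by (simp add: card_SigmaI)
    moreover have "?p \<le> card (res X M h v) + excess v" if h: "h \<in> good X" for h
    proof -
      have "card (M v) \<le> card (res X M h v) + dg X v"
      proof (rule card_residual[where M = M and f = h, OF fX(2) X(5) M_sub])
        show "h w \<in> L w" if "w \<in> X" for w
          using subsetD[OF M_sub PiE_mem[OF hX(1)[OF h] that]] .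
      qed
      moreover have "dg X v \<le> dg S v" using X SV by (intro dg_mono) auto
      ultimately show ?thesis using M_card[OF X(5)] by simp
    qed
    then have "(\<Sum>h\<in>good X. ?p) \<le> (\<Sum>h\<in>good X. card (res X M h v) + excess v)" by (intro sum_mono)
    ultimately show ?thesis by (simp add: sum.distrib mult.commute)
  qed
  define T where "T = {C \<in> A. v \<in> touch C \<and> touch C \<subseteq> ?X}"
  define bad where "bad C = {g \<in> E. \<not> colorable C (res ?X M g)}" for C
  have fT: "finite T" "T \<subseteq> A" using AV by (auto simp: T_def)
  have fbad: "finite (bad C)" for C using finE by (simp add: bad_def)
  have "E \<subseteq> good ?X \<union> (\<Union>C\<in>T. bad C)"
  proof
    fix g assume g: "g \<in> E"
    show "g \<in> good ?X \<union> (\<Union>C\<in>T. bad C)"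
    proof (rule ccontr)
      assume n: "g \<notin> good ?X \<union> (\<Union>C\<in>T. bad C)"
      then obtain C where C: "C \<in> A" "touch C \<subseteq> ?X" "\<not> colorable C (res ?X M g)"
        using E[OF g] by (auto simp: good_def)
      then have "v \<notin> touch C" using n g by (auto simp: T_def bad_def)
      then have tX: "touch C \<subseteq> X" using C by auto
      then have "colorable C (res X M (restrict g X))" using E(3)[OF g] C(1) by (auto simp: good_def)
      moreover have "colorable C (res X M (restrict g X)) \<longleftrightarrow> colorable C (res ?X M g)"
        by (rule colorable_cong) (use res_restrict[OF C(1) _ tX, of _ ?X g] X in auto)
      ultimately show False using C by simp
    qed
  qed
  then have "card E \<le> card (good ?X \<union> (\<Union>C\<in>T. bad C))"
    using finite_good[OF X(2)] fT fbad by (intro card_mono) auto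
  also have "\<dots> \<le> card (good ?X) + (\<Sum>C\<in>T. card (bad C))"
    using card_Un_le[of "good ?X" "\<Union>C\<in>T. bad C"] card_UN_le[OF fT(1), of bad] by linarith
  finally have main: "?p * card (good X) \<le> card (good ?X) + (\<Sum>C\<in>T. card (bad C)) + excess v * card (good X)"
    using cE by linarith
  have fibre: "card G \<le> 2"
    if C: "C \<in> T" and ab: "a \<in> ?X" "b \<in> ?X" "a \<noteq> b" "partial a C" "partial b C"
      and G: "G \<subseteq> bad C" and agree: "\<And>g g' w. g \<in> G \<Longrightarrow> g' \<in> G \<Longrightarrow> w \<in> ?X - {a, b} \<Longrightarrow> g w = g' w"
    for C a b G
  proof -
    have CA: "C \<in> A" using C fT by auto
    obtain z where z: "z \<in> C" "\<not> adj z a" "\<not> adj z b"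
      using partial_common_miss[OF CA, of a b] ab X by auto
    obtain xa xb where x: "xa \<in> C" "adj xa a" "xb \<in> C" "adj xb b"
      using ab adj_sym by (auto simp: partial_def)
    have XC: "?X \<inter> C = {}" using C_facts(6)[OF CA] X(2) by blast
    show ?thesis
    proof (rule card_bad_pair[OF C_facts(2,3)[OF CA] fX(3) XC ab(1-3) z x, where M = M and G = G])
      show "card C - 1 + dg ?X y \<le> card (M y)" if "y \<in> C" for y
        using M_card_piece[OF CA that X(2)] .
      show "g \<in> Pi\<^sub>E ?X M" "\<not> colorable C (res ?X M g)" if "g \<in> G" for g
        using E(1)[of g] G that unfolding bad_def by blast+
    qed (fact M_sub agree)+
  qed
  have bad_partial: "2 * card (bad C) \<le> card (good X)" if C: "C \<in> T" and p: "partial v C" for C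
  proof -
    have CA: "C \<in> A" "touch C \<subseteq> ?X" using C by (auto simp: T_def)
    obtain z where z: "z \<in> S" "z \<noteq> v" "partial z C" using A_two[OF CA(1)] by metis
    have zX: "z \<in> X" using z CA by (auto simp: touch_def partial_def)
    let ?\<pi> = "\<lambda>g. restrict g (X - {z})"
    have "card (bad C) \<le> 2 * card (good (X - {z}))"
    proof (rule card_le_fibres[where \<pi> = ?\<pi>])
      show "finite (good (X - {z}))" using X by (intro finite_good) auto
      show "?\<pi> ` bad C \<subseteq> good (X - {z})"
      proof clarify
        fix g assume "g \<in> bad C"
        then have "restrict g X \<in> good X" using E(3) by (auto simp: bad_def)
        then have "restrict (restrict g X) (X - {z}) \<in> good (X - {z})"
          by (intro restrict_good[of _ X]) (use X in \<open>auto simp: good_def\<close>)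
        moreover have "restrict (restrict g X) (X - {z}) = ?\<pi> g" by (auto simp: restrict_def)
        ultimately show "?\<pi> g \<in> good (X - {z})" by simp
      qed
      fix h assume "h \<in> good (X - {z})"
      show "card {g \<in> bad C. ?\<pi> g = h} \<le> 2"
      proof (rule fibre[OF C, of v z])
        fix g g' w assume "g \<in> {g \<in> bad C. ?\<pi> g = h}" "g' \<in> {g \<in> bad C. ?\<pi> g = h}" "w \<in> ?X - {v, z}"
        then have "?\<pi> g = ?\<pi> g'" "w \<in> X - {z}" by auto
        then show "g w = g' w" by (metis restrict_apply')
      qed (use z zX p X in auto)
    qed
    then show ?thesis using IH[OF zX subset_refl] by linarith
  qed
  have bad_full: "8 * card (bad C) \<le> d * card (good X)" if C: "C \<in> T" and p: "\<not> partial v C" for C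
  proof -
    have CA: "C \<in> A" "touch C \<subseteq> ?X" using C by (auto simp: T_def)
    obtain a b where ab: "a \<in> S" "b \<in> S" "a \<noteq> b" "partial a C" "partial b C" using A_two[OF CA(1)] by metis
    have av: "a \<noteq> v" "b \<noteq> v" using p ab by auto
    have abX: "a \<in> X" "b \<in> X" using ab av CA by (auto simp: touch_def partial_def)
    let ?Z = "X - {a} - {b}"
    let ?\<pi> = "\<lambda>g. (g v, restrict g ?Z)"
    have fin: "finite (M v \<times> good ?Z)" using M_fin X by (intro finite_cartesian_product finite_good) auto
    have "card (bad C) \<le> 2 * card (M v \<times> good ?Z)"
    proof (rule card_le_fibres[where \<pi> = ?\<pi>, OF fin])
      show "?\<pi> ` bad C \<subseteq> M v \<times> good ?Z"
      proof clarify
        fix g assume "g \<in> bad C"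
        then have gE: "g \<in> E" by (simp add: bad_def)
        then have "restrict g X \<in> good X" by (rule E)
        then have "restrict (restrict g X) ?Z \<in> good ?Z"
          by (intro restrict_good[of _ X]) (use X in \<open>auto simp: good_def\<close>)
        moreover have "restrict (restrict g X) ?Z = restrict g ?Z" by (auto simp: restrict_def)
        moreover have "g v \<in> M v" using PiE_mem[OF E(1)[OF gE]] by auto
        ultimately show "g v \<in> M v \<and> restrict g ?Z \<in> good ?Z" by simp
      qed
      fix h assume "h \<in> M v \<times> good ?Z"
      show "card {g \<in> bad C. ?\<pi> g = h} \<le> 2"
      proof (rule fibre[OF C, of a b])
        fix g g' w assume gg: "g \<in> {g \<in> bad C. ?\<pi> g = h}" "g' \<in> {g \<in> bad C. ?\<pi> g = h}" "w \<in> ?X - {a, b}"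
        then have eq: "g v = g' v" "restrict g ?Z = restrict g' ?Z" by auto
        show "g w = g' w"
        proof (cases "w = v")
          case False then have "w \<in> ?Z" using gg by auto
          then show ?thesis using eq(2) by (metis restrict_apply')
        qed (use eq in simp)
      qed (use ab abX in auto)
    qed
    also have "card (M v \<times> good ?Z) \<le> d * card (good ?Z)"
      using card_mono[OF finL[OF X(5)] M_sub] card_L[OF X(5)] by (simp add: card_cartesian_product)
    finally have 1: "card (bad C) \<le> 2 * (d * card (good ?Z))" by simp
    have "4 * card (good ?Z) \<le> card (good (X - {a}))" using abX ab(3) by (intro IH) auto
    also have "4 * \<dots> \<le> card (good X)" using IH[OF abX(1)] by simp
    finally have "16 * (d * card (good ?Z)) \<le> d * card (good X)" by simp
    then show ?thesis using 1 by linarith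
  qed
  have full_card: "card C \<le> dg C v" if "C \<in> T" "\<not> partial v C" for C
  proof -
    have "nb C v = C" using that by (auto simp: T_def touch_def partial_def nb_def)
    then show ?thesis by (simp add: dg_def)
  qed
  have touch_pos: "1 \<le> dg C v" if C: "C \<in> T" for C
  proof -
    obtain x where "x \<in> C" "adj v x" using C by (auto simp: T_def touch_def)
    then show ?thesis using dg_pos[of C x v] C_facts(4)[of C] C fT by auto
  qed
  have pT: "(\<Sum>C\<in>T. dg C v) \<le> ?p"
  proof -
    have "(\<Sum>C\<in>T. dg C v) \<le> (\<Sum>C\<in>A. dg C v)" using fT AV by (intro sum_mono2) auto
    then show ?thesis using dg_pieces[OF A_pieces] by simp
  qed
  let ?g = "real (card (good X))"
  have g0: "0 \<le> ?g" by simp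
  have main': "real ?p * ?g \<le> real (card (good ?X)) + (\<Sum>C\<in>T. real (card (bad C))) + real (excess v) * ?g"
    using main by (simp flip: of_nat_mult of_nat_add of_nat_sum add: of_nat_le_iff)
  have e: "1 \<le> real (excess v)" "10 * real (excess v) \<le> real ?p" "9 * real (excess v) < real d"
    using excess_high[of v] S_many[OF X(4)] S_poor[OF X(4)] S_high X by auto
  have partial_sum: "(\<Sum>C\<in>T'. real (card (bad C))) \<le> real (card T') * (?g / 2)"
    if "T' \<subseteq> T" "\<And>C. C \<in> T' \<Longrightarrow> partial v C" for T'
  proof (rule sum_bounded_above)
    fix C assume "C \<in> T'"
    then have "2 * card (bad C) \<le> card (good X)" using bad_partial that by auto
    then show "real (card (bad C)) \<le> ?g / 2" by linarith
  qed
  have "4 * ?g \<le> real (card (good ?X))"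
  proof (cases "\<forall>C\<in>T. partial v C")
    case True
    have "(\<Sum>C\<in>T. 1) \<le> (\<Sum>C\<in>T. dg C v)" using touch_pos by (intro sum_mono)
    then have "card T \<le> ?p" using pT by simp
    then have "real (card T) * (?g / 2) \<le> real ?p * (?g / 2)" by (intro mult_right_mono) auto
    then have "(real ?p / 2 - real (excess v)) * ?g \<le> real (card (good ?X))"
      using main' partial_sum[OF subset_refl] True by (simp add: algebra_simps)
    moreover have "4 * ?g \<le> (real ?p / 2 - real (excess v)) * ?g" using e by (intro mult_right_mono) auto
    ultimately show ?thesis by simp
  next
    case False
    then obtain D where D: "D \<in> T" "\<not> partial v D" by blast
    have DA: "D \<in> A" using D fT by auto
    have split: "sum h T = h D + sum h (T - {D})" for h :: "'a set \<Rightarrow> 'z::comm_monoid_add"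
      using D fT by (intro sum.remove)
    have uniq: "partial v C" if C: "C \<in> T - {D}" for C
    proof (rule ccontr)
      assume n: "\<not> partial v C"
      have "dg C v \<le> (\<Sum>C\<in>T - {D}. dg C v)" using C fT by (intro member_le_sum) auto
      then have "card D + card C \<le> ?p"
        using split[of "\<lambda>C. dg C v"] pT full_card[OF D] full_card[of C] C n by auto
      also have "?p \<le> dg V v" using AV finV by (intro dg_mono)
      also have "\<dots> = d + excess v" using dg_excess X by simp
      finally show False
        using C_facts(5)[OF DA] C_facts(5)[of C] C fT S_poor[OF X(4)] by auto
    qed
    have "(\<Sum>C\<in>T - {D}. 1) \<le> (\<Sum>C\<in>T - {D}. dg C v)" using touch_pos by (intro sum_mono) auto
    then have p: "card D + card (T - {D}) \<le> ?p"
      using pT split[of "\<lambda>C. dg C v"] full_card[OF D] by simp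
    have "real (card (bad D)) \<le> real d / 8 * ?g"
    proof -
      have "real (8 * card (bad D)) \<le> real (d * card (good X))" using bad_full[OF D] of_nat_le_iff by blast
      then show ?thesis by simp
    qed
    then have "(\<Sum>C\<in>T. real (card (bad C))) \<le> real d / 8 * ?g + real (card (T - {D})) * (?g / 2)"
      using split[of "\<lambda>C. real (card (bad C))"] partial_sum[of "T - {D}"] uniq by auto
    then have "(real ?p - real (excess v) - real d / 8 - real (card (T - {D})) / 2) * ?g \<le> real (card (good ?X))"
      using main' by (simp add: algebra_simps)
    moreover have "4 * ?g \<le> (real ?p - real (excess v) - real d / 8 - real (card (T - {D})) / 2) * ?g"
      using e p C_facts(5)[OF DA] d24 by (intro mult_right_mono) auto
    ultimately show ?thesis by simp
  qed
  then show ?case by linarith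
qed

lemma good_nonempty: "good S \<noteq> {}"
proof -
  have "card (good X) > 0" if "X \<subseteq> S" for X
    using finite_subset[OF that SV(2)] that
  proof (induction X rule: finite_induct)
    case empty
    have "touch C \<noteq> {}" if "C \<in> A" for C using A_two[OF that] by (auto simp: touch_def partial_def)
    then have "(\<lambda>_. undefined) \<in> good {}" by (auto simp: good_def proper_def)
    then show ?case using finite_good[of "{}"] by (auto simp: card_gt_0_iff)
  next
    case (insert v X)
    then show ?case using good_extensions[of X v] by auto
  qed
  then show ?thesis by (metis card.empty less_irrefl subset_refl)
qed

text \<open>
  The pieces are pairwise nonadjacent, so the colourings of the single pieces fit together.
\<close>

lemma core_colorable: "colorable (S \<union> \<Union>A) M"
proof -
  obtain g where g: "g \<in> good S" using good_nonempty by blast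
  then have pg: "prop_col S M g" by (simp add: good_def)
  have "\<exists>h. prop_col C (res S M g) h" if "C \<in> A" for C
    using g that by (auto simp: good_def touch_def colorable_def)
  then obtain h where h: "\<And>C. C \<in> A \<Longrightarrow> prop_col C (res S M g) (h C)" by metis
  let ?h = "\<lambda>x. h (twins low x) x"
  have tw: "twins low x = C" if "C \<in> A" "x \<in> C" for C x
    using piecesD(1)[OF C_facts(1)[OF that(1)] that(2)] by simp
  have "prop_col (\<Union>A) (res S M g) ?h"
    unfolding proper_def
  proof (intro conjI ballI impI)
    fix x assume "x \<in> \<Union>A"
    then obtain C where C: "C \<in> A" "x \<in> C" by blast
    then show "?h x \<in> res S M g x" using h[OF C(1)] tw[OF C] by (simp add: proper_def)
  next
    fix x y assume "x \<in> \<Union>A" "y \<in> \<Union>A" and xy: "adj x y"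
    then obtain C C' where C: "C \<in> A" "x \<in> C" "C' \<in> A" "y \<in> C'" by blast
    then have "C = C'" using pieces_separated[OF _ _ _ _ xy] C_facts(1) by blast
    then show "\<not> cf (?h x) (?h y)"
      using h[OF C(1)] tw[OF C(1,2)] tw[OF C(3,4)] C xy by (simp add: proper_def)
  qed
  then show ?thesis using colorable_union[OF pg] SA by (auto simp: colorable_def Int_commute)
qed

end

section \<open>Critical covers are not sparse\<close>

context critical_cover begin

text \<open>
  Here \<open>e\<close> is the total excess and \<open>m\<close> the number of vertices in pieces. For \<open>d \<le> 23\<close> Gallai's
  bound suffices. Otherwise \<open>m\<close> is at least \<open>27 e\<close> or \<open>23 e\<close> minus about \<open>10 e\<close> vertices outside
  pieces; the thresholds in \<open>select\<close> take away less than a quarter of each piece, and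
  what is left has to exceed \<open>10 e\<close>.
\<close>

lemma not_sparse:
  assumes "28 * (\<Sum>v\<in>V. real (dg V v)) \<le> (28 * real d + 1) * real (card V) \<or>
    351 \<le> d \<and> 24 * (\<Sum>v\<in>V. real (dg V v)) \<le> (24 * real d + 1) * real (card V)"
  shows False
proof -
  let ?Y = "V - low"
  define e where "e = (\<Sum>y\<in>?Y. real (excess y))"
  have lowV: "low \<subseteq> V" by (auto simp: low_def)
  have fin: "finite ?Y" "finite low" using finV finB by auto
  have "V \<noteq> {}" using not_colorable by (auto simp: colorable_def proper_def)
  then have n0: "0 < card V" using finV by (simp add: card_gt_0_iff)
  have dgr: "real (dg V v) = real d + real (excess v)" if "v \<in> V" for v using dg_excess[OF that] by simp
  have "(\<Sum>v\<in>V. real (dg V v)) = real d * real (card V) + (\<Sum>v\<in>V. real (excess v))"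
    using dgr by (simp add: sum.distrib)
  also have "(\<Sum>v\<in>V. real (excess v)) = e"
    unfolding e_def using finV excess_low by (intro sum.mono_neutral_right) auto
  finally have tot: "(\<Sum>v\<in>V. real (dg V v)) = real d * real (card V) + e" .
  have cY: "real (card ?Y) \<le> e"
  proof -
    have "(\<Sum>y\<in>?Y. 1) \<le> e" unfolding e_def using excess_high by (intro sum_mono) fastforce
    then show ?thesis by simp
  qed
  have cV: "real (card V) = real (card low) + real (card ?Y)"
    using lowV finV by (metis card_Diff_subset card_mono finite_subset le_add_diff_inverse of_nat_add)
  have df: "defect d low \<le> (real d + 1) * e"
  proof -
    have "defect d low = (\<Sum>x\<in>low. real (dg ?Y x))"
      unfolding defect_def
    proof (rule sum.cong)
      fix x assume x: "x \<in> low"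
      then show "real d - real (dg low x) = real (dg ?Y x)"
        using dg_V_split[OF lowV, of x] dg_excess[of x] excess_low by simp
    qed simp
    also have "\<dots> = real (\<Sum>y\<in>?Y. dg low y)"
      using sum_dg_commute[OF fin(2,1)] by (simp flip: of_nat_sum)
    also have "\<dots> \<le> (\<Sum>y\<in>?Y. real d + real (excess y))"
      unfolding of_nat_sum
    proof (rule sum_mono)
      fix y assume y: "y \<in> ?Y"
      have "dg low y \<le> dg V y" using lowV finV by (intro dg_mono)
      then show "real (dg low y) \<le> real d + real (excess y)" using dgr[of y] y by simp
    qed
    also have "\<dots> = real d * real (card ?Y) + e" by (simp add: sum.distrib e_def)
    also have "\<dots> \<le> real d * e + e" using cY by (intro add_mono mult_left_mono) auto
    finally show ?thesis by (simp add: algebra_simps)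
  qed
  have d3': "real d \<ge> 3" using d3 by simp
  have gal: "(real d - 2) * real (card low) \<le> real d * ((real d + 1) * e)"
    using gallai_bound[OF subset_refl] mult_left_mono[OF df, of "real d"] by simp
  have e0: "0 < e"
  proof (rule ccontr)
    assume "\<not> 0 < e"
    then have e: "e = 0" using cY by simp
    then have "real (card low) > 0" using cV cY n0 by simp
    then have "0 < (real d - 2) * real (card low)" using d3' by simp
    then show False using gal e by simp
  qed
  have low27: "27 * e \<le> real (card low) \<or> 351 \<le> d \<and> 23 * e \<le> real (card low)"
    using assms tot cV cY by (auto simp: algebra_simps)
  show False
  proof (cases "24 \<le> d")
    case False
    then have "27 * e \<le> real (card low)" using low27 by simp
    then have "(real d - 2) * (27 * e) \<le> (real d - 2) * real (card low)"
      using d3' by (intro mult_left_mono) auto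
    also note gal
    finally have "(27 * (real d - 2)) * e \<le> (real d * (real d + 1)) * e" by (simp add: mult_ac)
    then have "27 * (real d - 2) \<le> real d * (real d + 1)" by (rule mult_right_le_imp_le[OF _ e0])
    moreover have "0 \<le> (real d - 3) * (23 - real d)" using False d3' by simp
    ultimately show False by (simp add: algebra_simps)
  next
    case True
    then have d24: "real d \<ge> 24" by simp
    define m where "m = (\<Sum>C\<in>pieces. real (card C))"
    have fp: "finite pieces" "\<And>C. C \<in> pieces \<Longrightarrow> finite C" using finite_pieces by auto
    have Usub: "\<Union>pieces \<subseteq> low" using piecesD(6) pieces_nonempty by blast
    have "card (\<Union>pieces) = (\<Sum>C\<in>pieces. card C)"
    proof (rule card_Union_disjoint)
      show "pairwise disjnt pieces"
      proof (rule pairwiseI)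
        fix C C' assume C: "C \<in> pieces" "C' \<in> pieces" "C \<noteq> C'"
        then show "disjnt C C'" using pieces_disjoint[OF C(1,2)] unfolding disjnt_def by blast
      qed
    qed (rule fp)
    then have "real (card low) = real (card (low - \<Union>pieces)) + m"
      using Usub fin(2) unfolding m_def
      by (metis card_Diff_subset card_mono finite_subset le_add_diff_inverse2 of_nat_add of_nat_sum)
    then have "real (card low) \<le> m + (\<Sum>x\<in>low. weight d low x)"
      using card_outside_pieces[OF True] by simp
    then have "(real d - 2) * (real (card low) - m) \<le> (real d - 2) * (\<Sum>x\<in>low. weight d low x)"
      using d24 by (intro mult_left_mono) auto
    also have "\<dots> \<le> 10 * defect d low" by (rule defect_ge_weight[OF subset_refl True])
    also have "\<dots> \<le> 10 * ((real d + 1) * e)" using df by simp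
    finally have out: "(real d - 2) * (real (card low) - m) \<le> (10 * (real d + 1)) * e" by (simp only: mult.assoc)
    have outc: "real (card low) - m \<le> c * e" if "10 * (real d + 1) \<le> (real d - 2) * c" for c
    proof -
      have "(real d - 2) * (real (card low) - m) \<le> ((real d - 2) * c) * e"
        by (rule order_trans[OF out mult_right_mono[OF that]]) (use e0 in simp)
      then have "(real d - 2) * (real (card low) - m) \<le> (real d - 2) * (c * e)" by (simp only: mult.assoc)
      then show ?thesis by (rule mult_left_le_imp_le) (use d24 in simp)
    qed
    have mass: "(1 - c) * m \<le> (\<Sum>C\<in>pieces. real (card C) - (real d / 9 + 1))"
      if "real d / 9 + 1 \<le> c * (2 * real d / 3)" "0 \<le> c" for c
      unfolding m_def sum_distrib_left
    proof (rule sum_mono)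
      fix C assume C: "C \<in> pieces"
      then have "2 * d \<le> 3 * card C" using piecesD(4) pieces_nonempty by blast
      then have "2 * real d / 3 \<le> real (card C)" by linarith
      then have "c * (2 * real d / 3) \<le> c * real (card C)" using that by (intro mult_left_mono)
      then show "(1 - c) * real (card C) \<le> real (card C) - (real d / 9 + 1)"
        using that by (simp add: algebra_simps)
    qed
    have "10 * e < (\<Sum>C\<in>pieces. real (card C) - (real d / 9 + 1))"
      using low27
    proof
      assume l: "27 * e \<le> real (card low)"
      (* For d = 24: 10 (d + 1) / (d - 2) = 125/11, and 11/48 is the threshold d/9 + 1 divided by 2d/3. *)
      have "real (card low) - m \<le> 125 / 11 * e" using d24 by (intro outc) simp
      then have "(1 - 11 / 48) * m > 10 * e" using l e0 by simp
      moreover have "(1 - 11 / 48) * m \<le> (\<Sum>C\<in>pieces. real (card C) - (real d / 9 + 1))"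
        using d24 by (intro mass) auto
      ultimately show ?thesis by simp
    next
      assume l: "351 \<le> d \<and> 23 * e \<le> real (card low)"
      (* For d = 351: 10 (d + 1) / (d - 2) = 3520/349, and 6/35 is slightly more than (d/9 + 1) / (2d/3). *)
      have "real (card low) - m \<le> 3520 / 349 * e" using l by (intro outc) simp
      then have "(1 - 6 / 35) * m > 10 * e" using l e0 by simp
      moreover have "(1 - 6 / 35) * m \<le> (\<Sum>C\<in>pieces. real (card C) - (real d / 9 + 1))"
        using l by (intro mass) auto
      ultimately show ?thesis by simp
    qed
    from select[OF this[unfolded e_def]] obtain S A where SA: "S \<subseteq> V - low" "\<forall>y\<in>S. 9 * excess y < d"
      "A \<subseteq> pieces" "A \<noteq> {}" "\<forall>y\<in>S. 10 * excess y \<le> dg (\<Union>A) y"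
      "\<forall>C\<in>A. \<exists>z\<in>S. \<exists>z'\<in>S. z \<noteq> z' \<and> partial z C \<and> partial z' C"
      by (elim exE conjE)
    have U: "S \<union> \<Union>A \<subseteq> V" using SA(1,3) Usub lowV by blast
    obtain C where "C \<in> A" using SA(4) by blast
    then have "S \<noteq> {}" using SA(6) by blast
    then have "S \<union> \<Union>A \<noteq> {}" by blast
    from remainder_not_colorable[OF U this] obtain f
      where f: "prop_col (V - (S \<union> \<Union>A)) L f" "\<not> colorable (S \<union> \<Union>A) (res (V - (S \<union> \<Union>A)) L f)" .
    interpret critical_core adj V L cf d S A f
      by unfold_locales (use True SA f(1) in blast)+
    show False using core_colorable f(2) by simp
  qed
qed

end

context cover begin

text \<open>
  A smallest non-colourable set of vertices induces a critical cover.
\<close>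

lemma sparse_colorable:
  assumes "3 \<le> d" "\<And>v. v \<in> V \<Longrightarrow> card (L v) = d"
    and no_clique: "\<And>K. K \<subseteq> V \<Longrightarrow> clique K \<Longrightarrow> card K \<noteq> d + 1"
    and sparse: "(\<forall>X\<subseteq>V. 28 * (\<Sum>v\<in>X. real (dg X v)) \<le> (28 * real d + 1) * real (card X)) \<or>
      351 \<le> d \<and> (\<forall>X\<subseteq>V. 24 * (\<Sum>v\<in>X. real (dg X v)) \<le> (24 * real d + 1) * real (card X))"
  shows "colorable V L"
proof (rule ccontr)
  assume "\<not> colorable V L"
  define n where "n = (LEAST n. \<exists>X. X \<subseteq> V \<and> \<not> colorable X L \<and> card X = n)"
  have "\<exists>X. X \<subseteq> V \<and> \<not> colorable X L \<and> card X = n"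
    unfolding n_def by (rule LeastI_ex) (use \<open>\<not> colorable V L\<close> in blast)
  then obtain X where X: "X \<subseteq> V" "\<not> colorable X L" "card X = n" by blast
  have finX: "finite X" using X(1) finV finite_subset by blast
  have minimal: "colorable Y L" if "Y \<subset> X" for Y
  proof (rule ccontr)
    assume "\<not> colorable Y L"
    moreover have "Y \<subseteq> V" using that X by auto
    ultimately have "n \<le> card Y" unfolding n_def by (intro Least_le) blast
    then show False using psubset_card_mono[OF finX that] X(3) by simp
  qed
  have sub: "v \<in> V" if "v \<in> X" for v using that X(1) by blast
  interpret X: cover adj X L cf
  proof unfold_locales
    show "finite X" by (rule finX)
    show "finite (L v)" if "v \<in> X" for v using finL[OF sub[OF that]] .
    show "cf b a" if "cf a b" for a b using cf_sym[OF that] .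
    show "b = b'" if "u \<in> X" "v \<in> X" "adj u v" "a \<in> L u" "b \<in> L v" "b' \<in> L v" "cf a b" "cf a b'"
      for u v a b b'
      using cf_inj[OF sub[OF that(1)] sub[OF that(2)] that(3-)] .
  qed
  interpret X: critical_cover adj X L cf d
  proof unfold_locales
    show "card K \<noteq> d + 1" if "K \<subseteq> X" "clique K" for K
      using no_clique[OF subset_trans[OF that(1) X(1)] that(2)] .
    show "3 \<le> d" by (rule assms(1))
    show "card (L v) = d" if "v \<in> X" for v using assms(2)[OF sub[OF that]] .
    show "\<not> colorable X L" by (rule X(2))
    show "colorable Y L" if "Y \<subset> X" for Y using minimal[OF that] .
  qed
  show False using X.not_sparse sparse X(1) by blast
qed

end

section \<open>Correspondence covers of finite graphs\<close>

lemma pair_graph_arcs: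
  assumes "pair_graph G"
  shows "finite (pverts G)" "finite (parcs G)" "parcs G \<subseteq> pverts G \<times> pverts G"
    "(u, v) \<in> parcs G \<Longrightarrow> (v, u) \<in> parcs G" "(v, v) \<notin> parcs G"
proof -
  interpret pair_graph G by fact
  show "finite (pverts G)" "finite (parcs G)" by (rule pair_finite_verts pair_finite_arcs)+
  show "parcs G \<subseteq> pverts G \<times> pverts G" using wellformed' by auto
  show "(u, v) \<in> parcs G \<Longrightarrow> (v, u) \<in> parcs G"
    using pair_sym_arcs by (auto simp: symmetric_def dest: symD)
  show "(v, v) \<notin> parcs G" using pair_no_loops by force
qed

lemma pair_graphI:
  assumes "finite V" "E \<subseteq> V \<times> V" "sym E" "irrefl E"
  shows "pair_graph \<lparr>pverts = V, parcs = E\<rparr>"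
proof
  show "finite (parcs \<lparr>pverts = V, parcs = E\<rparr>)" using assms finite_subset by fastforce
qed (use assms in \<open>auto simp: symmetric_def irrefl_def\<close>)

lemma simple_subgraphI:
  assumes G: "pair_graph G" and X: "X \<subseteq> pverts G" and E: "E \<subseteq> parcs G" "E \<subseteq> X \<times> X" "sym E"
  shows "simple_subgraph \<lparr>pverts = X, parcs = E\<rparr> G"
proof -
  have "finite X" "irrefl E"
    using pair_graph_arcs[OF G] X E finite_subset by (auto simp: irrefl_def)
  then have F: "pair_graph \<lparr>pverts = X, parcs = E\<rparr>" using E by (intro pair_graphI)
  then interpret F: pair_graph "\<lparr>pverts = X, parcs = E\<rparr>" .
  interpret G: pair_graph G by fact
  have "wf_digraph (with_proj \<lparr>pverts = X, parcs = E\<rparr>)" "wf_digraph (with_proj G)"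
    by (rule F.wf_digraph G.wf_digraph)+
  then show ?thesis using F X E by (auto simp: simple_subgraph_def subgraph_def compatible_def)
qed

lemma edges_iff: "pair_graph G \<Longrightarrow> {u, v} \<in> edges G \<longleftrightarrow> (u, v) \<in> parcs G"
  using pair_graph_arcs(4)[of G] by (auto simp: edges_def doubleton_eq_iff)

lemma card_parcs:
  assumes G: "pair_graph G"
  shows "card (parcs G) = 2 * card (edges G)"
proof -
  let ?f = "\<lambda>(u, v). {u, v}"
  have im: "edges G = ?f ` parcs G" by (force simp: edges_def)
  have fin: "finite (parcs G)" "finite (edges G)" using pair_graph_arcs[OF G] by (simp_all add: im)
  have "card {p \<in> parcs G. ?f p = e} = 2" if e: "e \<in> edges G" for e
  proof -
    obtain u v where uv: "(u, v) \<in> parcs G" "e = {u, v}" using e by (auto simp: edges_def)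
    then have "{p \<in> parcs G. ?f p = e} = {(u, v), (v, u)}"
      using pair_graph_arcs(4)[OF G] by (auto simp: doubleton_eq_iff)
    moreover have "u \<noteq> v" using uv pair_graph_arcs(5)[OF G] by auto
    ultimately show ?thesis by simp
  qed
  then have "(\<Sum>e\<in>edges G. card {p \<in> parcs G. ?f p = e}) = 2 * card (edges G)" by simp
  moreover have "card (\<Union>e\<in>edges G. {p \<in> parcs G. ?f p = e}) = (\<Sum>e\<in>edges G. card {p \<in> parcs G. ?f p = e})"
    using fin by (intro card_UN_disjoint) auto
  moreover have "(\<Union>e\<in>edges G. {p \<in> parcs G. ?f p = e}) = parcs G" using im by auto
  ultimately show ?thesis by simp
qed

lemma sym_graph_parcs: "pair_graph G \<Longrightarrow> sym_graph (\<lambda>u v. (u, v) \<in> parcs G)"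
  using pair_graph_arcs(4,5)[of G] by unfold_locales auto

lemma degree_sum_le_mad:
  assumes G: "pair_graph G" and X: "X \<subseteq> pverts G"
  shows "(\<Sum>v\<in>X. real (sym_graph.dg (\<lambda>u v. (u, v) \<in> parcs G) X v)) \<le> mad G * real (card X)"
proof (cases "X = {}")
  case False
  interpret sym_graph "\<lambda>u v. (u, v) \<in> parcs G" by (rule sym_graph_parcs[OF G])
  have finX: "finite X" using X pair_graph_arcs(1)[OF G] finite_subset by blast
  let ?F = "\<lparr>pverts = X, parcs = parcs G \<inter> X \<times> X\<rparr>"
  have sub: "simple_subgraph ?F G"
    using G X pair_graph_arcs(4)[OF G] by (intro simple_subgraphI) (auto intro: symI)
  have "finite {2 * real (card (edges F)) / real (card (pverts F)) | F. simple_subgraph F G \<and> pverts F \<noteq> {}}"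
    by (rule finite_subset[OF _ finite_imageI[OF finite_simple_subgraphs[OF G],
          of "\<lambda>F. 2 * real (card (edges F)) / real (card (pverts F))"]]) auto
  then have "2 * real (card (edges ?F)) / real (card (pverts ?F)) \<le> mad G"
    unfolding mad_def by (rule Max_ge, intro CollectI exI[of _ ?F]) (use sub False in simp)
  then have "2 * real (card (edges ?F)) \<le> mad G * real (card X)"
    using False finX by (simp add: divide_le_eq card_gt_0_iff)
  moreover have "2 * card (edges ?F) = card (parcs G \<inter> X \<times> X)"
    using card_parcs[of ?F] sub by (simp add: simple_subgraph_def)
  moreover have "parcs G \<inter> X \<times> X = (SIGMA v : X. nb X v)" by (auto simp: nb_def)
  moreover have "card (SIGMA v : X. nb X v) = (\<Sum>v\<in>X. dg X v)"
    using finX by (simp add: card_SigmaI dg_def)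
  ultimately show ?thesis by (simp flip: of_nat_sum of_nat_mult)
qed simp

lemma no_clique_parcs:
  assumes G: "pair_graph G" and no: "\<not> (\<exists>F. simple_subgraph F G \<and> complete_digraph (d + 1) (with_proj F))"
    and K: "K \<subseteq> pverts G" "sym_graph.clique (\<lambda>u v. (u, v) \<in> parcs G) K"
  shows "card K \<noteq> d + 1"
proof
  interpret sym_graph "\<lambda>u v. (u, v) \<in> parcs G" by (rule sym_graph_parcs[OF G])
  assume c: "card K = d + 1"
  let ?F = "\<lparr>pverts = K, parcs = {(u, v). (u, v) \<in> K \<times> K \<and> u \<noteq> v}\<rparr>"
  have "simple_subgraph ?F G"
    using K by (intro simple_subgraphI[OF G K(1)]) (auto simp: clique_def intro: symI)
  moreover have "complete_digraph (d + 1) (with_proj ?F)"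
    unfolding complete_digraph_pair_def using c by (auto intro: card_ge_0_finite)
  ultimately show False using no by blast
qed

theorem theorem1p10:
  fixes d :: nat and G :: "'a pair_pre_digraph"
  assumes "d \<ge> 3"
    and "pair_graph G"
    and "\<not> (\<exists>F. simple_subgraph F G \<and> complete_digraph (d + 1) (with_proj F))"
  shows "(mad G \<le> real d + 1 / 28 \<longrightarrow> correspondence_colorable TYPE('b) d G) \<and>
         (d \<ge> 351 \<and> mad G \<le> real d + 1 / 24 \<longrightarrow> correspondence_colorable TYPE('b) d G)"
proof -
  let ?adj = "\<lambda>u v. (u, v) \<in> parcs G"
  interpret sym_graph ?adj by (rule sym_graph_parcs[OF assms(2)])
  have main: "correspondence_colorable TYPE('b) d G"
    if m: "mad G \<le> real d + 1 / 28 \<or> 351 \<le> d \<and> mad G \<le> real d + 1 / 24"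
    unfolding correspondence_colorable_def
  proof (intro allI impI, elim conjE)
    fix H :: "'b pair_pre_digraph" and L
    assume cov: "correspondence_cover G H L" and big: "\<forall>v\<in>pverts G. d \<le> card (L v)"
    have H: "pair_graph H" and indep: "\<And>v. v \<in> pverts G \<Longrightarrow> independent_in H (L v)"
      and mat: "\<And>u v. u \<in> pverts G \<Longrightarrow> v \<in> pverts G \<Longrightarrow> u \<noteq> v \<Longrightarrow> {u, v} \<in> edges G \<Longrightarrow>
          matching (edges_between H (L u) (L v))"
      and non: "\<And>u v. u \<in> pverts G \<Longrightarrow> v \<in> pverts G \<Longrightarrow> u \<noteq> v \<Longrightarrow> {u, v} \<notin> edges G \<Longrightarrow>
          edges_between H (L u) (L v) = {}"
      using cov unfolding correspondence_cover_def by auto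
    (* The lists are shrunk to size exactly d. *)
    have "\<forall>v\<in>pverts G. \<exists>M. M \<subseteq> L v \<and> card M = d"
      using big by (metis obtain_subset_with_card_n)
    then obtain M where M: "\<And>v. v \<in> pverts G \<Longrightarrow> M v \<subseteq> L v \<and> card (M v) = d" by metis
    let ?cf = "\<lambda>a b. (a, b) \<in> parcs H"
    have between: "{a, b} \<in> edges_between H (L u) (L v)" if "a \<in> L u" "b \<in> L v" "?cf a b" for a b u v
      using that edges_iff[OF H] by (auto simp: edges_between_def)
    interpret cover ?adj "pverts G" M ?cf
    proof unfold_locales
      show "finite (pverts G)" using pair_graph_arcs(1)[OF assms(2)] .
      show "finite (M v)" if "v \<in> pverts G" for v
      proof (rule card_ge_0_finite)
        show "card (M v) > 0" using M[OF that] assms(1) by linarith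
      qed
      show "?cf b a" if "?cf a b" for a b using pair_graph_arcs(4)[OF H that] .
      show "b = b'" if uv: "u \<in> pverts G" "v \<in> pverts G" "?adj u v" and ab: "a \<in> M u" "b \<in> M v" "b' \<in> M v"
        "?cf a b" "?cf a b'" for u v a b b'
      proof (rule ccontr)
        assume "b \<noteq> b'"
        then have ne: "{a, b} \<noteq> {a, b'}" by (auto simp: doubleton_eq_iff)
        have "u \<noteq> v" using uv adj_irrefl by blast
        then have m: "matching (edges_between H (L u) (L v))"
          using mat[OF uv(1,2)] uv(3) edges_iff[OF assms(2)] by simp
        have "a \<in> L u" "b \<in> L v" "b' \<in> L v" using M uv ab by blast+
        then have "{a, b} \<in> edges_between H (L u) (L v)" "{a, b'} \<in> edges_between H (L u) (L v)"
          using between ab(4,5) by simp_all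
        then have "{a, b} \<inter> {a, b'} = {}" using m ne unfolding matching_def by metis
        then show False by blast
      qed
    qed
    have "colorable (pverts G) M"
    proof (rule sparse_colorable[OF assms(1)])
      show "card (M v) = d" if "v \<in> pverts G" for v using M[OF that] by blast
      show "card K \<noteq> d + 1" if "K \<subseteq> pverts G" "clique K" for K
        using no_clique_parcs[OF assms(2,3) that] .
      have dens: "(\<Sum>v\<in>X. real (dg X v)) \<le> c * real (card X)" if "X \<subseteq> pverts G" "mad G \<le> c" for X c
        using degree_sum_le_mad[OF assms(2) that(1)] mult_right_mono[OF that(2), of "real (card X)"] by simp
      show "(\<forall>X\<subseteq>pverts G. 28 * (\<Sum>v\<in>X. real (dg X v)) \<le> (28 * real d + 1) * real (card X)) \<or>
        351 \<le> d \<and> (\<forall>X\<subseteq>pverts G. 24 * (\<Sum>v\<in>X. real (dg X v)) \<le> (24 * real d + 1) * real (card X))"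
        using m
      proof (elim disjE conjE)
        assume "mad G \<le> real d + 1 / 28"
        then have "28 * (\<Sum>v\<in>X. real (dg X v)) \<le> (28 * real d + 1) * real (card X)" if "X \<subseteq> pverts G" for X
          using dens[OF that, of "real d + 1 / 28"] by (simp add: algebra_simps)
        then show ?thesis by blast
      next
        assume "351 \<le> d" "mad G \<le> real d + 1 / 24"
        then have "24 * (\<Sum>v\<in>X. real (dg X v)) \<le> (24 * real d + 1) * real (card X)" if "X \<subseteq> pverts G" for X
          using dens[OF that, of "real d + 1 / 24"] by (simp add: algebra_simps)
        then show ?thesis using \<open>351 \<le> d\<close> by blast
      qed
    qed
    then obtain \<phi> where \<phi>: "\<And>v. v \<in> pverts G \<Longrightarrow> \<phi> v \<in> M v"
      "\<And>u v. u \<in> pverts G \<Longrightarrow> v \<in> pverts G \<Longrightarrow> ?adj u v \<Longrightarrow> \<not> ?cf (\<phi> u) (\<phi> v)"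
      unfolding colorable_def proper_def by blast
    have \<phi>L: "\<phi> v \<in> L v" if "v \<in> pverts G" for v using \<phi>(1)[OF that] M[OF that] by blast
    have "\<not> ?cf (\<phi> u) (\<phi> v)" if uv: "u \<in> pverts G" "v \<in> pverts G" for u v
    proof (cases "u = v")
      case True then show ?thesis using pair_graph_arcs(5)[OF H] by simp
    next
      case False
      show ?thesis
      proof (cases "?adj u v")
        case True then show ?thesis using \<phi>(2) uv by blast
      next
        case nadj: False
        then have "edges_between H (L u) (L v) = {}" using non[OF uv False] edges_iff[OF assms(2)] by simp
        then show ?thesis using between[OF \<phi>L[OF uv(1)] \<phi>L[OF uv(2)]] by blast
      qed
    qed
    moreover have "\<phi> v \<in> pverts H" if "v \<in> pverts G" for v
      using \<phi>L[OF that] indep[OF that] by (auto simp: independent_in_def)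
    ultimately have "cover_coloring G H L \<phi>"
      using \<phi>L edges_iff[OF H] by (auto simp: cover_coloring_def independent_in_def)
    then show "\<exists>\<phi>. cover_coloring G H L \<phi>" by blast
  qed
  show ?thesis using main by blast
qed

end
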